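(* If $m\ge5$ is prime, then there are exactly $(m^2-1)/12$ projective equivalence classes of single orbit complex $[m,4]$-half grids.
   Context: Work in $\mathbb P^3_{\mathbb C}$. Two finite sets of points are projectively equivalent if an element of $PGL_4(\mathbb C)$ takes one to the other. For a finite set $Z$, $\overline{Z}$ denotes its image under projection from a general point to a plane $H$ (similarly $\overline L$ for a line $L$). A set $Z$ of $ab$ points is $\{a,b\}$-geproci if $\overline Z$ is the transverse intersection (in $ab$ distinct points) of plane curves in $H$ of degrees $a$ and $b$. An $\{a,b\}$-geproci set $Z$ is $[a,b]$-geproci with respect to a set $\mathcal L$ of $b$ skew lines if $Z$ consists of $a$ points on each of the $b$ lines and $\overline Z$ is the transverse intersection of a plane curve of degree $a$ with $\bigcup_{L\in\mathcal L}\overline L$. $Z$ is an $\{a,b\}$-grid if $Z=C_1\cap C_2$ where $C_1$ is a union of $a$ skew lines, $C_2$ a union of $b$ skew lines, and each component of $C_1$ meets each component of $C_2$ in exactly one point. $Z$ is an $[a,b]$-half grid (with respect to $\mathcal L$) if it is $[a,b]$-geproci (with respect to $\mathcal L$) but not a grid. For a set $\mathcal L=\{L_1,\dots,L_s\}$ of $s\ge3$ skew lines and distinct $i,j,k$, let $f_{ijk}\colon L_i\to L_j$ be the linear isomorphism sending $p\in L_i$ to the point where the plane spanned by $p$ and $L_k$ meets $L_j$. The groupoid $C_{\mathcal L}$ has the lines $L_i$ as objects and all possible compositions of the maps $f_{ijk}$ as arrows; the orbit of $p\in L_i$ is $[p]=\bigcup_j\{g(p):g\in\mathrm{Hom}_{C_{\mathcal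 L}}(L_i,L_j)\}$. A single orbit $[m,4]$-half grid is a set $Z$ which is an $[m,4]$-half grid with respect to a set $\mathcal L$ of 4 skew lines and which is a single $C_{\mathcal L}$-orbit. *)

theory Defs
  imports "HOL-Analysis.Analysis"
begin

text \<open>
  Linear subspaces of \<open>complex ^ 4\<close> (over the complex numbers) of dimension 1, 2, 3
  represent the points, lines and planes of complex projective 3-space, so incidence is inclusion,
  and two lines are skew iff they intersect in \<open>{0}\<close>.
\<close>

type_synonym subsp = "(complex ^ 4) set"

definition proj_point :: "subsp \<Rightarrow> bool" where
  "proj_point p \<longleftrightarrow> vec.subspace p \<and> vec.dim p = 1"

definition proj_line :: "subsp \<Rightarrow> bool" where
  "proj_line L \<longleftrightarrow> vec.subspace L \<and> vec.dim L = 2"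

definition proj_plane :: "subsp \<Rightarrow> bool" where
  "proj_plane H \<longleftrightarrow> vec.subspace H \<and> vec.dim H = 3"

definition skew_lines :: "subsp set \<Rightarrow> bool" where
  "skew_lines \<L> \<longleftrightarrow> finite \<L> \<and> (\<forall>L\<in>\<L>. proj_line L) \<and>
     (\<forall>L\<in>\<L>. \<forall>M\<in>\<L>. L \<noteq> M \<longrightarrow> L \<inter> M = {0})"

definition projectively_equivalent :: "subsp set \<Rightarrow> subsp set \<Rightarrow> bool" where
  "projectively_equivalent Z W \<longleftrightarrow>
     (\<exists>A :: complex ^ 4 ^ 4. invertible A \<and> W = (\<lambda>p. (\<lambda>v. A *v v) ` p) ` Z)"

text \<open>
  Homogeneous polynomials of degree \<open>d\<close> in four variables, as functions; since the field is
  infinite, a form and its polynomial function determine each other.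
\<close>

definition form :: "nat \<Rightarrow> (complex ^ 4 \<Rightarrow> complex) \<Rightarrow> bool" where
  "form d F \<longleftrightarrow> (\<exists>c :: (4 \<Rightarrow> nat) \<Rightarrow> complex.
     F = (\<lambda>v. \<Sum>e | (\<Sum>i\<in>UNIV. e i) = d. c e * (\<Prod>i\<in>UNIV. v $ i ^ e i)))"

text \<open>
  A property holds for a general point if it holds on a nonempty Zariski open set; every such set
  contains the complement of the zero locus of a single nonzero form.
\<close>

definition general_point :: "(subsp \<Rightarrow> bool) \<Rightarrow> bool" where
  "general_point Q \<longleftrightarrow> (\<exists>d G. form d G \<and> (\<exists>v. G v \<noteq> 0) \<and>
     (\<forall>P. proj_point P \<and> (\<exists>v\<in>P. G v \<noteq> 0) \<longrightarrow> Q P))"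

text \<open>
  Projection from the point \<open>P\<close> to the plane \<open>H\<close>, for points and lines not containing \<open>P\<close>.
\<close>

definition project :: "subsp \<Rightarrow> subsp \<Rightarrow> subsp \<Rightarrow> subsp" where
  "project P H X = vec.span (P \<union> X) \<inter> H"

text \<open>
  Every form on the 3-dimensional space \<open>H\<close> is the restriction of a form on the whole space, so
  plane curves in \<open>H\<close> are given by forms in four variables that do not vanish identically on \<open>H\<close>.
\<close>

definition plane_curve :: "subsp \<Rightarrow> nat \<Rightarrow> (complex ^ 4 \<Rightarrow> complex) \<Rightarrow> bool" where
  "plane_curve H d F \<longleftrightarrow> form d F \<and> (\<exists>v\<in>H. F v \<noteq> 0)"

definition curve_points :: "subsp \<Rightarrow> (complex ^ 4 \<Rightarrow> complex) \<Rightarrow> subsp set" where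
  "curve_points H F = {p. proj_point p \<and> p \<subseteq> H \<and> (\<forall>v\<in>p. F v = 0)}"

definition dir_deriv :: "(complex ^ 4 \<Rightarrow> complex) \<Rightarrow> complex ^ 4 \<Rightarrow> complex ^ 4 \<Rightarrow> complex" where
  "dir_deriv F v w = deriv (\<lambda>t. F (v + t *s w)) 0"

text \<open>
  Two curves meet transversely at a common point (both are smooth there, with distinct tangent
  lines) iff their differentials at that point are linearly independent functionals on \<open>H\<close>.
\<close>

definition transverse_at ::
  "subsp \<Rightarrow> (complex ^ 4 \<Rightarrow> complex) \<Rightarrow> (complex ^ 4 \<Rightarrow> complex) \<Rightarrow> subsp \<Rightarrow> bool" where
  "transverse_at H F G p \<longleftrightarrow> (\<forall>v\<in>p - {0}. \<forall>\<alpha> \<beta>.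
     (\<forall>w\<in>H. \<alpha> * dir_deriv F v w + \<beta> * dir_deriv G v w = 0) \<longrightarrow> \<alpha> = 0 \<and> \<beta> = 0)"

definition transverse_intersection ::
  "subsp \<Rightarrow> (complex ^ 4 \<Rightarrow> complex) \<Rightarrow> (complex ^ 4 \<Rightarrow> complex) \<Rightarrow> subsp set \<Rightarrow> bool" where
  "transverse_intersection H F G S \<longleftrightarrow>
     S = curve_points H F \<inter> curve_points H G \<and> (\<forall>p\<in>S. transverse_at H F G p)"

definition geproci :: "nat \<Rightarrow> nat \<Rightarrow> subsp set \<Rightarrow> bool" where
  "geproci a b Z \<longleftrightarrow>
     finite Z \<and> card Z = a * b \<and> (\<forall>p\<in>Z. proj_point p) \<and>
     (\<forall>H. proj_plane H \<longrightarrow> general_point (\<lambda>P.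
        card (project P H ` Z) = a * b \<and>
        (\<exists>F G. plane_curve H a F \<and> plane_curve H b G \<and>
           transverse_intersection H F G (project P H ` Z))))"

text \<open>
  In the next definition the union of the projected lines, as a plane curve, is given by the product
  of linear forms defining these lines in \<open>H\<close>.
\<close>

definition geproci_wrt :: "nat \<Rightarrow> nat \<Rightarrow> subsp set \<Rightarrow> subsp set \<Rightarrow> bool" where
  "geproci_wrt a b \<L> Z \<longleftrightarrow>
     geproci a b Z \<and> skew_lines \<L> \<and> card \<L> = b \<and>
     (\<forall>p\<in>Z. \<exists>L\<in>\<L>. p \<subseteq> L) \<and> (\<forall>L\<in>\<L>. card {p \<in> Z. p \<subseteq> L} = a) \<and>
     (\<forall>H. proj_plane H \<longrightarrow> general_point (\<lambda>P.
        \<exists>F l. plane_curve H a F \<and>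
          (\<forall>L\<in>\<L>. plane_curve H 1 (l L) \<and> {v\<in>H. l L v = 0} = project P H L) \<and>
          transverse_intersection H F (\<lambda>v. \<Prod>L\<in>\<L>. l L v) (project P H ` Z)))"

definition grid :: "nat \<Rightarrow> nat \<Rightarrow> subsp set \<Rightarrow> bool" where
  "grid a b Z \<longleftrightarrow> (\<exists>A B. skew_lines A \<and> card A = a \<and> skew_lines B \<and> card B = b \<and>
     (\<forall>L\<in>A. \<forall>M\<in>B. \<exists>!p. proj_point p \<and> p \<subseteq> L \<and> p \<subseteq> M) \<and>
     Z = {p. proj_point p \<and> (\<exists>L\<in>A. p \<subseteq> L) \<and> (\<exists>M\<in>B. p \<subseteq> M)})"

definition half_grid_wrt :: "nat \<Rightarrow> nat \<Rightarrow> subsp set \<Rightarrow> subsp set \<Rightarrow> bool" where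
  "half_grid_wrt a b \<L> Z \<longleftrightarrow> geproci_wrt a b \<L> Z \<and> \<not> (\<exists>c d. grid c d Z)"

text \<open>
  \<open>transfer_map K M\<close> sends a point \<open>p\<close> of a line \<open>L\<close> to the point where the plane spanned by
  \<open>p\<close> and \<open>K\<close> meets \<open>M\<close>, for three distinct skew lines \<open>L\<close>, \<open>M\<close>, \<open>K\<close>.
\<close>

definition transfer_map :: "subsp \<Rightarrow> subsp \<Rightarrow> subsp \<Rightarrow> subsp" where
  "transfer_map K M p = vec.span (p \<union> K) \<inter> M"

text \<open>
  \<open>groupoid_arrow \<L> L M g\<close>: on the points of \<open>L\<close>, the map \<open>g\<close> is an arrow from \<open>L\<close> to \<open>M\<close>;
  its values elsewhere are irrelevant.
\<close>

inductive groupoid_arrow :: "subsp set \<Rightarrow> subsp \<Rightarrow> subsp \<Rightarrow> (subsp \<Rightarrow> subsp) \<Rightarrow> bool"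
  for \<L> :: "subsp set" where
  identity: "L \<in> \<L> \<Longrightarrow> groupoid_arrow \<L> L L (\<lambda>p. p)"
| compose: "groupoid_arrow \<L> L M g \<Longrightarrow> N \<in> \<L> \<Longrightarrow> K \<in> \<L> \<Longrightarrow> M \<noteq> N \<Longrightarrow> M \<noteq> K \<Longrightarrow> N \<noteq> K \<Longrightarrow>
    groupoid_arrow \<L> L N (transfer_map K N \<circ> g)"

definition groupoid_orbit :: "subsp set \<Rightarrow> subsp \<Rightarrow> subsp set" where
  "groupoid_orbit \<L> p = {g p | L M g. L \<in> \<L> \<and> p \<subseteq> L \<and> groupoid_arrow \<L> L M g}"

definition single_orbit_half_grid :: "nat \<Rightarrow> subsp set \<Rightarrow> bool" where
  "single_orbit_half_grid m Z \<longleftrightarrow> (\<exists>\<L>. half_grid_wrt m 4 \<L> Z \<and>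
     (\<exists>L\<in>\<L>. \<exists>p. proj_point p \<and> p \<subseteq> L \<and> Z = groupoid_orbit \<L> p))"

end

theory Submission
  imports Defs "HOL-Library.Multiset"
begin

text \<open>
  Four skew lines can be written as \<open>(u, 0)\<close>, \<open>(0, u)\<close>, \<open>(u, u)\<close>, \<open>(u, A u)\<close> for a matrix \<open>A\<close>, and the
  vertex group of their groupoid is the image of the group generated by \<open>A\<close> and \<open>A - 1\<close> in the projective
  linear group of the line. An orbit with at least two points on each line starts away from the eigenvectors
  of \<open>A\<close>, and if it is finite then \<open>A\<close> is diagonalizable with distinct eigenvalues \<open>\<alpha>\<close>, \<open>\<beta>\<close>. If there are \<open>m\<close>
  points on each line, \<open>s = \<beta> / \<alpha>\<close> and \<open>t = (\<beta> - 1) / (\<alpha> - 1)\<close> are \<open>m\<close>-th roots of unity; they are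
  distinct and different from 1, and they determine the orbit up to projective equivalence.

  Conversely, each such pair yields a half grid. In projection from a general point the forms
  \<open>c * (x ^ m - y ^ m)\<close> on the four lines, with suitable constants \<open>c\<close>, agree at the six crossings, so that
  they extend to a curve of degree \<open>m\<close>. The orbit is no grid, since a grid would need a transversal of
  the four lines through each of its points.

  A line with more than four points of the orbit is one of the four lines. Hence a projective equivalence
  permutes these lines and acts on \<open>\<alpha>\<close> and \<open>\<beta>\<close>, which are cross ratios on the two transversals, by the same
  anharmonic substitution, up to exchanging \<open>\<alpha>\<close> and \<open>\<beta>\<close>. On the triple \<open>(s, 1 / t, t / s)\<close>, whose product is 1, this
  amounts to permutation and inversion. For a primitive root of unity with exponents \<open>x\<close>, \<open>y\<close>, \<open>z\<close> between 0
  and \<open>m\<close>, inversion exchanges the sums \<open>x + y + z = m\<close> and \<open>x + y + z = 2 m\<close>; so the classes correspond to the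
  partitions of \<open>m\<close> into three positive parts.
\<close>

section \<open>Points, lines and groupoid orbits\<close>

text \<open>Two loops of the groupoid act on the first line, in the coordinate y / x, as
  multiplication by s and by s / t. The coordinates of the orbit points there form a set of m
  nonzero numbers, which both multiplications permute; comparing the products over this set gives
  s^m = t^m = 1. A double eigenvalue is excluded because a loop then acts as a translation, which
  has infinite order in characteristic 0. Primality of m enters three times. The powers of a root s
  other than 1 exhaust the m-th roots of unity, so that an orbit is a whole standard configuration;
  s and t are powers of one fixed root, which makes exponents available; and m is prime to 6, where
  the number of partitions has the closed form (m^2 - 1) / 12. The bound m >= 5 makes the points of
  a configuration determine its four lines.\<close>

lemma index_4_distinct [simp]:
  "(1::4) \<noteq> 2" "(1::4) \<noteq> 3" "(1::4) \<noteq> 4" "(2::4) \<noteq> 1" "(2::4) \<noteq> 3" "(2::4) \<noteq> 4"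
  "(3::4) \<noteq> 1" "(3::4) \<noteq> 2" "(3::4) \<noteq> 4" "(4::4) \<noteq> 1" "(4::4) \<noteq> 2" "(4::4) \<noteq> 3"
  by simp_all

lemma proj_point_span: "v \<noteq> 0 \<Longrightarrow> proj_point (vec.span {v})"
  by (simp add: proj_point_def vec.dim_insert)

lemma proj_pointE:
  assumes "proj_point p"
  obtains v where "v \<noteq> 0" "p = vec.span {v}"
proof -
  obtain B where B: "B \<subseteq> p" "vec.independent B" "p \<subseteq> vec.span B" "card B = vec.dim p"
    using vec.basis_exists .
  then have "card B = 1" using assms by (simp add: proj_point_def)
  then obtain v where v: "B = {v}" by (auto simp: card_1_singleton_iff)
  have "vec.span B = p"
    using B assms by (metis proj_point_def subset_antisym vec.span_minimal)
  moreover have "v \<noteq> 0" using B(2) v by simp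
  ultimately show ?thesis using that v by auto
qed

lemma span_sing_subset: "vec.subspace L \<Longrightarrow> vec.span {v} \<subseteq> L \<longleftrightarrow> v \<in> L"
  by (meson empty_subsetI insert_subset subset_trans vec.span_minimal vec.span_superset)

lemma span_sing_scale:
  assumes "c \<noteq> 0" shows "vec.span {c *s v} = vec.span {v}"
  using vec.span_image_scale[of "{v}" "\<lambda>_. c"] assms by simp

lemma span_sing_eqE:
  assumes "vec.span {v} = vec.span {w}"
  obtains c where "v = c *s w"
  using assms unfolding vec.span_singleton by (metis UNIV_I image_iff vec.scale_one)

text \<open>The span of n + k and K is the sum of the span of n and K, and K meets N only in 0, so N
  keeps just the multiples of n. Transfer is therefore projection onto N along K.\<close>

lemma transfer_map_span:
  assumes "vec.subspace N" "vec.subspace K" "K \<inter> N = {0}" "n \<in> N" "k \<in> K"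
  shows "transfer_map K N (vec.span {n + k}) = vec.span {n}"
proof
  have *: "vec.span (vec.span {n + k} \<union> K) = {x + y |x y. x \<in> vec.span {n + k} \<and> y \<in> K}"
    using assms(2) by (simp add: vec.span_Un vec.span_eq_iff[THEN iffD2])
  show "vec.span {n} \<subseteq> transfer_map K N (vec.span {n + k})"
    unfolding transfer_map_def
  proof (rule vec.span_minimal)
    have "n = (n + k) + (- k)" by simp
    moreover have "- k \<in> K" using assms by (simp add: vec.subspace_neg)
    moreover have "n + k \<in> vec.span {n + k}" by (simp add: vec.span_base)
    ultimately have "n \<in> vec.span (vec.span {n + k} \<union> K)" unfolding * by blast
    then show "{n} \<subseteq> vec.span (vec.span {n + k} \<union> K) \<inter> N" using assms by simp
    show "vec.subspace (vec.span (vec.span {n + k} \<union> K) \<inter> N)"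
      using assms(1) by (simp add: vec.subspace_inter)
  qed
  show "transfer_map K N (vec.span {n + k}) \<subseteq> vec.span {n}"
  proof
    fix x assume "x \<in> transfer_map K N (vec.span {n + k})"
    then obtain c y where x: "x = c *s (n + k) + y" "y \<in> K" "x \<in> N"
      unfolding transfer_map_def * by (auto simp: vec.span_singleton)
    have "x - c *s n \<in> N"
      using x(3) assms(1,4) by (intro vec.subspace_diff vec.subspace_scale)
    moreover have "x - c *s n = c *s k + y" using x by (simp add: vec.scale_right_distrib)
    moreover have "c *s k + y \<in> K" using x assms by (simp add: vec.subspace_add vec.subspace_scale)
    ultimately have "x - c *s n \<in> K \<inter> N" by auto
    then have "x = c *s n" using assms(3) by auto
    then show "x \<in> vec.span {n}" by (auto simp: vec.span_singleton)
  qed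
qed

text \<open>Orbits are handled through a line and a point on it rather than through composed maps,
  so that arguments about arrows become rule inductions.\<close>

inductive reaches :: "subsp set \<Rightarrow> subsp \<Rightarrow> subsp \<Rightarrow> subsp \<Rightarrow> bool"
  for \<L> :: "subsp set" and p :: subsp where
  start: "L \<in> \<L> \<Longrightarrow> p \<subseteq> L \<Longrightarrow> reaches \<L> p L p"
| step: "reaches \<L> p M q \<Longrightarrow> N \<in> \<L> \<Longrightarrow> K \<in> \<L> \<Longrightarrow> M \<noteq> N \<Longrightarrow> M \<noteq> K \<Longrightarrow> N \<noteq> K \<Longrightarrow>
    reaches \<L> p N (transfer_map K N q)"

lemma reaches_iff:
  "reaches \<L> p M q \<longleftrightarrow> (\<exists>L g. L \<in> \<L> \<and> p \<subseteq> L \<and> groupoid_arrow \<L> L M g \<and> q = g p)"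
proof
  assume "reaches \<L> p M q"
  then show "\<exists>L g. L \<in> \<L> \<and> p \<subseteq> L \<and> groupoid_arrow \<L> L M g \<and> q = g p"
  proof induction
    case (start L)
    then show ?case using groupoid_arrow.identity by blast
  next
    case (step M q N K)
    then obtain L g where "L \<in> \<L>" "p \<subseteq> L" "groupoid_arrow \<L> L M g" "q = g p" by auto
    then show ?case using groupoid_arrow.compose[of \<L> L M g N K] step.hyps
      by (metis comp_apply)
  qed
next
  assume "\<exists>L g. L \<in> \<L> \<and> p \<subseteq> L \<and> groupoid_arrow \<L> L M g \<and> q = g p"
  then obtain L g where "p \<subseteq> L" "groupoid_arrow \<L> L M g" "q = g p" by auto
  from this(2,1,3) show "reaches \<L> p M q"
    by (induction arbitrary: q) (auto intro: reaches.intros)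
qed

lemma groupoid_orbit_eq: "groupoid_orbit \<L> p = {q. \<exists>M. reaches \<L> p M q}"
  unfolding groupoid_orbit_def reaches_iff by auto

lemma reaches_subset: "reaches \<L> p M q \<Longrightarrow> q \<subseteq> M"
  by (induction rule: reaches.induct) (auto simp: transfer_map_def)

lemma transfer_map_image:
  fixes T :: "complex^4^4"
  assumes "invertible T"
  shows "transfer_map ((*v) T ` K) ((*v) T ` N) ((*v) T ` p) = (*v) T ` transfer_map K N p"
proof -
  have inj: "inj ((*v) T)" using assms by (simp add: inj_matrix_vector_mult)
  show ?thesis
    unfolding transfer_map_def image_Un[symmetric] vec.span_image
    using inj by (simp add: image_Int)
qed

lemma reaches_image:
  fixes T :: "complex^4^4"
  assumes T: "invertible T" and "reaches \<L> p M q"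
  shows "reaches ((`) ((*v) T) ` \<L>) ((*v) T ` p) ((*v) T ` M) ((*v) T ` q)"
  using assms(2)
proof induction
  case (start L)
  then show ?case by (auto intro!: reaches.start)
next
  case (step M q N K)
  have "inj ((*v) T)" using T by (simp add: inj_matrix_vector_mult)
  then have "\<And>A B. A \<noteq> B \<Longrightarrow> (*v) T ` A \<noteq> (*v) T ` B" by (simp add: inj_image_eq_iff)
  then show ?case
    unfolding transfer_map_image[OF T, symmetric]
    by (intro reaches.step[OF step.IH]) (use step in auto)
qed

text \<open>The \<open>i\<close>-th line consists of the points \<open>pt \<alpha> \<beta> i x y\<close>. Writing the space as a sum of two copies
  of a plane with coordinates \<open>x\<close>, \<open>y\<close>, the four lines are \<open>(u, 0)\<close>, \<open>(0, u)\<close>, \<open>(u, u)\<close> and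
  \<open>(u, A u)\<close> with \<open>A = diag(\<alpha>, \<beta>)\<close>; the coordinates are ordered so that each eigenvector of \<open>A\<close>
  contributes two consecutive ones.\<close>

definition crd0 :: "4 \<Rightarrow> complex" where "crd0 i = (if i = 2 then 0 else 1)"
definition crd1 :: "complex \<Rightarrow> 4 \<Rightarrow> complex" where
  "crd1 z i = (if i = 1 then 0 else if i = 4 then z else 1)"

text \<open>The determinant of the i-th and j-th among the vectors (1, 0), (0, 1), (1, 1), (1, z),
  which represent four points of a projective line.\<close>

definition bracket :: "complex \<Rightarrow> 4 \<Rightarrow> 4 \<Rightarrow> complex" where
  "bracket z i j = crd0 i * crd1 z j - crd1 z i * crd0 j"

definition pt :: "complex \<Rightarrow> complex \<Rightarrow> 4 \<Rightarrow> complex \<Rightarrow> complex \<Rightarrow> complex ^ 4" where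
  "pt \<alpha> \<beta> i x y = (\<chi> k. if k = 1 then crd0 i * x else if k = 2 then crd1 \<alpha> i * x
     else if k = 3 then crd0 i * y else crd1 \<beta> i * y)"

definition std_line :: "complex \<Rightarrow> complex \<Rightarrow> 4 \<Rightarrow> subsp" where
  "std_line \<alpha> \<beta> i = {pt \<alpha> \<beta> i x y | x y. True}"

definition std_config :: "nat \<Rightarrow> complex \<Rightarrow> complex \<Rightarrow> subsp set" where
  "std_config m \<alpha> \<beta> = {vec.span {pt \<alpha> \<beta> i 1 r} | i r. r ^ m = 1}"

lemma pt_nth [simp]:
  "pt \<alpha> \<beta> i x y $ 1 = crd0 i * x" "pt \<alpha> \<beta> i x y $ 2 = crd1 \<alpha> i * x"
  "pt \<alpha> \<beta> i x y $ 3 = crd0 i * y" "pt \<alpha> \<beta> i x y $ 4 = crd1 \<beta> i * y"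
  by (simp_all add: pt_def)

lemma crd_nonzero: "crd0 i \<noteq> 0 \<or> crd1 z i \<noteq> 0"
  by (simp add: crd0_def crd1_def)

lemma pt_add: "pt \<alpha> \<beta> i x y + pt \<alpha> \<beta> i x' y' = pt \<alpha> \<beta> i (x + x') (y + y')"
  by (simp add: vec_eq_iff forall_4 algebra_simps)

lemma pt_diff: "pt \<alpha> \<beta> i x y - pt \<alpha> \<beta> i x' y' = pt \<alpha> \<beta> i (x - x') (y - y')"
  by (simp add: vec_eq_iff forall_4 algebra_simps)

lemma pt_scale: "c *s pt \<alpha> \<beta> i x y = pt \<alpha> \<beta> i (c * x) (c * y)"
  by (simp add: vec_eq_iff forall_4 algebra_simps)

lemma pt_eq_iff [simp]: "pt \<alpha> \<beta> i x y = pt \<alpha> \<beta> i x' y' \<longleftrightarrow> x = x' \<and> y = y'"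
  using crd_nonzero[of i \<alpha>] crd_nonzero[of i \<beta>] by (auto simp: vec_eq_iff forall_4)

lemma pt_zero [simp]: "pt \<alpha> \<beta> i 0 0 = 0"
  by (simp add: vec_eq_iff forall_4)

lemma pt_eq_0_iff [simp]: "pt \<alpha> \<beta> i x y = 0 \<longleftrightarrow> x = 0 \<and> y = 0"
  using pt_eq_iff[of \<alpha> \<beta> i x y 0 0] by (simp del: pt_eq_iff)

lemma span_pt_eq_iff:
  assumes "r \<noteq> 0 \<or> r' \<noteq> 0"
  shows "vec.span {pt \<alpha> \<beta> i 1 r} = vec.span {pt \<alpha> \<beta> i 1 r'} \<longleftrightarrow> r = r'"
proof
  assume "vec.span {pt \<alpha> \<beta> i 1 r} = vec.span {pt \<alpha> \<beta> i 1 r'}"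
  then obtain c where "pt \<alpha> \<beta> i 1 r = c *s pt \<alpha> \<beta> i 1 r'" by (rule span_sing_eqE)
  then show "r = r'" by (simp add: pt_scale)
qed simp

lemma span_pt_normalize:
  assumes "x \<noteq> 0" shows "vec.span {pt \<alpha> \<beta> i x y} = vec.span {pt \<alpha> \<beta> i 1 (y / x)}"
  using span_sing_scale[OF assms, of "pt \<alpha> \<beta> i 1 (y / x)"] assms by (simp add: pt_scale)

lemma bracket_antisym: "bracket z j i = - bracket z i j"
  by (simp add: bracket_def)

lemma bracket_nonzero:
  assumes "z \<noteq> 0" "z \<noteq> 1" "i \<noteq> j" shows "bracket z i j \<noteq> 0"
  using assms exhaust_4[of i] exhaust_4[of j] by (auto simp: bracket_def crd0_def crd1_def)

text \<open>Cramer's rule in a plane, applied to the x-part with \<alpha> and to the y-part with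
  \<beta>. It supplies the decomposition that \<open>transfer_map_span\<close> asks for.\<close>

lemma pt_cramer:
  assumes "\<alpha> \<noteq> 0" "\<alpha> \<noteq> 1" "\<beta> \<noteq> 0" "\<beta> \<noteq> 1" "j \<noteq> k"
  shows "pt \<alpha> \<beta> i x y =
    pt \<alpha> \<beta> j (bracket \<alpha> i k / bracket \<alpha> j k * x) (bracket \<beta> i k / bracket \<beta> j k * y) +
    pt \<alpha> \<beta> k (bracket \<alpha> i j / bracket \<alpha> k j * x) (bracket \<beta> i j / bracket \<beta> k j * y)"
  using bracket_nonzero[of \<alpha> j k] bracket_nonzero[of \<beta> j k] assms bracket_antisym[of \<alpha> j k]
    bracket_antisym[of \<beta> j k]
  by (simp add: vec_eq_iff forall_4 field_simps) (simp add: bracket_def algebra_simps)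

lemma subspace_std_line: "vec.subspace (std_line \<alpha> \<beta> i)"
  unfolding std_line_def
  by (rule vec.subspaceI) (auto simp: pt_add pt_scale intro: exI[of _ 0] pt_zero[symmetric])

lemma pt_in_std_line [simp]: "pt \<alpha> \<beta> i x y \<in> std_line \<alpha> \<beta> i"
  by (auto simp: std_line_def)

lemma proj_line_std_line: "proj_line (std_line \<alpha> \<beta> i)"
proof -
  have "std_line \<alpha> \<beta> i = vec.span {pt \<alpha> \<beta> i 1 0, pt \<alpha> \<beta> i 0 1}"
  proof
    show "vec.span {pt \<alpha> \<beta> i 1 0, pt \<alpha> \<beta> i 0 1} \<subseteq> std_line \<alpha> \<beta> i"
      by (rule vec.span_minimal) (auto simp: subspace_std_line)
    show "std_line \<alpha> \<beta> i \<subseteq> vec.span {pt \<alpha> \<beta> i 1 0, pt \<alpha> \<beta> i 0 1}"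
      by (auto simp: std_line_def vec.span_breakdown_eq pt_scale pt_diff)
  qed
  moreover have "pt \<alpha> \<beta> i 1 0 \<notin> vec.span {pt \<alpha> \<beta> i 0 1}"
    by (auto simp: vec.span_singleton pt_scale)
  ultimately show ?thesis
    using subspace_std_line[of \<alpha> \<beta> i] by (simp add: proj_line_def vec.dim_insert)
qed

lemma std_line_Int:
  assumes "\<alpha> \<noteq> 0" "\<alpha> \<noteq> 1" "\<beta> \<noteq> 0" "\<beta> \<noteq> 1" "i \<noteq> j"
  shows "std_line \<alpha> \<beta> i \<inter> std_line \<alpha> \<beta> j = {0}"
proof -
  have "x = 0 \<and> y = 0" if "pt \<alpha> \<beta> i x y = pt \<alpha> \<beta> j x' y'" for x y x' y'
  proof -
    have e: "crd0 i * x = crd0 j * x'" "crd1 \<alpha> i * x = crd1 \<alpha> j * x'"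
      "crd0 i * y = crd0 j * y'" "crd1 \<beta> i * y = crd1 \<beta> j * y'"
      using arg_cong[OF that, of "\<lambda>v. v $ 1"] arg_cong[OF that, of "\<lambda>v. v $ 2"]
        arg_cong[OF that, of "\<lambda>v. v $ 3"] arg_cong[OF that, of "\<lambda>v. v $ 4"] by simp_all
    have "bracket \<alpha> i j * x = (crd0 i * x) * crd1 \<alpha> j - (crd1 \<alpha> i * x) * crd0 j"
      by (simp add: bracket_def algebra_simps)
    then have "bracket \<alpha> i j * x = 0" unfolding e by simp
    moreover have "bracket \<beta> i j * y = (crd0 i * y) * crd1 \<beta> j - (crd1 \<beta> i * y) * crd0 j"
      by (simp add: bracket_def algebra_simps)
    then have "bracket \<beta> i j * y = 0" unfolding e by simp
    ultimately show ?thesis using bracket_nonzero assms by auto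
  qed
  then have "std_line \<alpha> \<beta> i \<inter> std_line \<alpha> \<beta> j \<subseteq> {0}"
    by (smt (verit) IntE mem_Collect_eq pt_zero singletonI std_line_def subsetI)
  moreover have "0 \<in> std_line \<alpha> \<beta> i \<inter> std_line \<alpha> \<beta> j"
    using subspace_std_line by (simp add: vec.subspace_0)
  ultimately show ?thesis by blast
qed

lemma transfer_map_pt:
  assumes "\<alpha> \<noteq> 0" "\<alpha> \<noteq> 1" "\<beta> \<noteq> 0" "\<beta> \<noteq> 1" "j \<noteq> k"
  shows "transfer_map (std_line \<alpha> \<beta> k) (std_line \<alpha> \<beta> j) (vec.span {pt \<alpha> \<beta> i x y}) =
    vec.span {pt \<alpha> \<beta> j (bracket \<alpha> i k / bracket \<alpha> j k * x) (bracket \<beta> i k / bracket \<beta> j k * y)}"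
  by (subst pt_cramer[OF assms], rule transfer_map_span)
    (use assms std_line_Int[of \<alpha> \<beta> k j] in \<open>auto simp: subspace_std_line\<close>)

lemma card_std_config:
  assumes "m > 0" "\<alpha> \<noteq> 0" "\<alpha> \<noteq> 1" "\<beta> \<noteq> 0" "\<beta> \<noteq> 1"
  shows "card (std_config m \<alpha> \<beta>) = m * 4" "finite (std_config m \<alpha> \<beta>)"
proof -
  let ?f = "\<lambda>(i, r). vec.span {pt \<alpha> \<beta> i 1 r}"
  let ?A = "(UNIV :: 4 set) \<times> {r :: complex. r ^ m = 1}"
  have eq: "std_config m \<alpha> \<beta> = ?f ` ?A" by (auto simp: std_config_def)
  have inj: "inj_on ?f ?A"
  proof (rule inj_onI, clarify)
    fix i j r s assume rs: "r ^ m = (1::complex)" "s ^ m = (1::complex)"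
      and e: "vec.span {pt \<alpha> \<beta> i 1 r} = vec.span {pt \<alpha> \<beta> j 1 s}"
    have "i = j"
    proof (rule ccontr)
      assume "i \<noteq> j"
      then have "std_line \<alpha> \<beta> i \<inter> std_line \<alpha> \<beta> j = {0}" using std_line_Int assms by blast
      moreover have "pt \<alpha> \<beta> i 1 r \<in> std_line \<alpha> \<beta> j"
        using e span_sing_subset[OF subspace_std_line] by (metis pt_in_std_line)
      ultimately have "pt \<alpha> \<beta> i 1 r = 0" by (metis IntI pt_in_std_line singletonD)
      then show False by simp
    qed
    moreover have "r \<noteq> 0" using rs assms(1) by (auto simp: power_0_left)
    ultimately show "i = j \<and> r = s" using e span_pt_eq_iff by auto
  qed
  have "card {r :: complex. r ^ m = 1} = m" using card_roots_unity_eq assms(1) by auto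
  then show "card (std_config m \<alpha> \<beta>) = m * 4"
    unfolding eq card_image[OF inj] by (simp add: card_cartesian_product)
  show "finite (std_config m \<alpha> \<beta>)"
    unfolding eq using assms(1) finite_roots_unity[of m]
    by (intro finite_imageI finite_cartesian_product) auto
qed

section \<open>Forms in four and in two variables\<close>

abbreviation monom4 :: "(4 \<Rightarrow> nat) \<Rightarrow> complex ^ 4 \<Rightarrow> complex" where
  "monom4 e v \<equiv> \<Prod>i\<in>UNIV. v $ i ^ e i"

lemma finite_exponents: "finite {e :: 4 \<Rightarrow> nat. (\<Sum>i\<in>UNIV. e i) = d}"
proof (rule finite_subset)
  have "e i \<le> d" if "(\<Sum>i\<in>UNIV. e i) = d" for e :: "4 \<Rightarrow> nat" and i
    using that member_le_sum[of i UNIV e] by simp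
  then show "{e :: 4 \<Rightarrow> nat. (\<Sum>i\<in>UNIV. e i) = d} \<subseteq> PiE UNIV (\<lambda>_. {..d})"
    by auto
qed (auto intro: finite_PiE)

lemma form_monom:
  fixes e :: "4 \<Rightarrow> nat"
  assumes "(\<Sum>i\<in>UNIV. e i) = d"
  shows "form d (\<lambda>v. c * monom4 e v)"
  unfolding form_def
proof (intro exI ext)
  fix v
  have "(\<Sum>e' | (\<Sum>i\<in>UNIV. e' i) = d. (if e' = e then c else 0) * monom4 e' v) =
      (\<Sum>e' | (\<Sum>i\<in>UNIV. e' i) = d. if e' = e then c * monom4 e v else 0)"
    by (rule sum.cong) auto
  then show "c * monom4 e v =
      (\<Sum>e' | (\<Sum>i\<in>UNIV. e' i) = d. (\<lambda>e'. if e' = e then c else 0) e' * monom4 e' v)"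
    using assms finite_exponents[of d] by simp
qed

lemma form_add:
  assumes "form d F" "form d G" shows "form d (\<lambda>v. F v + G v)"
proof -
  obtain b c where
    "F = (\<lambda>v. \<Sum>e | (\<Sum>i\<in>UNIV. e i) = d. b e * monom4 e v)"
    "G = (\<lambda>v. \<Sum>e | (\<Sum>i\<in>UNIV. e i) = d. c e * monom4 e v)"
    using assms unfolding form_def by auto
  then show ?thesis
    unfolding form_def
    by (intro exI[of _ "\<lambda>e. b e + c e"]) (simp add: sum.distrib[symmetric] ring_distribs)
qed

lemma form_scale:
  assumes "form d F" shows "form d (\<lambda>v. c * F v)"
proof -
  obtain b where "F = (\<lambda>v. \<Sum>e | (\<Sum>i\<in>UNIV. e i) = d. b e * monom4 e v)"
    using assms unfolding form_def by auto
  then show ?thesis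
    unfolding form_def
    by (intro exI[of _ "\<lambda>e. c * b e"]) (simp add: sum_distrib_left mult.assoc)
qed

lemma form_zero: "form d (\<lambda>v. 0)"
  unfolding form_def by (rule exI[of _ "\<lambda>_. 0"]) simp

lemma form_diff:
  assumes "form d F" "form d G" shows "form d (\<lambda>v. F v - G v)"
  using form_add[OF assms(1) form_scale[OF assms(2), of "-1"]] by simp

lemma form_sum:
  assumes "\<And>a. a \<in> A \<Longrightarrow> form d (F a)" shows "form d (\<lambda>v. \<Sum>a\<in>A. F a v)"
  using assms
  by (induction A rule: infinite_finite_induct) (auto intro: form_zero form_add)

lemma form_mult:
  assumes "form d F" "form d' G" shows "form (d + d') (\<lambda>v. F v * G v)"
proof -
  obtain b c where
    F: "F = (\<lambda>v. \<Sum>e | (\<Sum>i\<in>UNIV. e i) = d. b e * monom4 e v)" and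
    G: "G = (\<lambda>v. \<Sum>e | (\<Sum>i\<in>UNIV. e i) = d'. c e * monom4 e v)"
    using assms unfolding form_def by auto
  have *: "(\<lambda>v. F v * G v) = (\<lambda>v. \<Sum>e | (\<Sum>i\<in>UNIV. e i) = d. \<Sum>e' | (\<Sum>i\<in>UNIV. e' i) = d'.
      b e * c e' * monom4 (\<lambda>i. e i + e' i) v)"
    unfolding F G sum_product
    by (intro ext sum.cong refl) (simp add: power_add prod.distrib)
  show ?thesis
    unfolding * by (rule form_sum, rule form_sum, rule form_monom) (simp add: sum.distrib)
qed

lemma form_const: "form 0 (\<lambda>v. c)"
  using form_monom[of "\<lambda>_. 0" 0 c] by simp

lemma form_power:
  assumes "form d F" shows "form (d * n) (\<lambda>v. F v ^ n)"
proof (induction n)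
  case (Suc n)
  then show ?case using form_mult[OF assms Suc.IH] by simp
qed (simp add: form_const)

lemma form_prod:
  assumes "\<And>a. a \<in> A \<Longrightarrow> form (d a) (F a)" shows "form (sum d A) (\<lambda>v. \<Prod>a\<in>A. F a v)"
  using assms
  by (induction A rule: infinite_finite_induct) (auto intro: form_const form_mult)

lemma form_coord: "form 1 (\<lambda>v. v $ i)"
proof -
  have "(\<lambda>v :: complex^4. v $ i) = (\<lambda>v. 1 * monom4 (\<lambda>j. if j = i then 1 else 0) v)"
    by (rule ext, subst prod.remove[of _ i]) auto
  then show ?thesis using form_monom[of "\<lambda>j. if j = i then 1 else 0" 1 1] by simp
qed

lemma poly_on_line:
  assumes "form d F"
  shows "\<exists>q. \<forall>t. F (v + t *s w) = poly q t"
proof -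
  obtain b where F: "F = (\<lambda>v. \<Sum>e | (\<Sum>i\<in>UNIV. e i) = d. b e * monom4 e v)"
    using assms unfolding form_def by auto
  show ?thesis
    unfolding F
    by (intro exI[of _ "\<Sum>e | (\<Sum>i\<in>UNIV. e i) = d. smult (b e) (\<Prod>i\<in>UNIV. [:v $ i, w $ i:] ^ e i)"])
      (simp add: poly_sum poly_prod)
qed

definition nzform :: "nat \<Rightarrow> (complex ^ 4 \<Rightarrow> complex) \<Rightarrow> bool" where
  "nzform d F \<longleftrightarrow> form d F \<and> (\<exists>v. F v \<noteq> 0)"

text \<open>Join a point where F is nonzero to one where G is nonzero. On this line both forms
  become nonzero polynomials in one variable, and so does their product.\<close>

lemma nzform_mult:
  assumes "nzform d F" "nzform d' G" shows "nzform (d + d') (\<lambda>v. F v * G v)"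
proof -
  obtain u w where uw: "F u \<noteq> 0" "G w \<noteq> 0" using assms by (auto simp: nzform_def)
  obtain p q where p: "\<And>t. F (u + t *s (w - u)) = poly p t"
    and q: "\<And>t. G (u + t *s (w - u)) = poly q t"
    using poly_on_line assms unfolding nzform_def by meson
  have "poly p 0 \<noteq> 0" "poly q 1 \<noteq> 0" using p[of 0] q[of 1] uw by auto
  then have "p * q \<noteq> 0" by auto
  then obtain t where "poly (p * q) t \<noteq> 0" using poly_all_0_iff_0 by blast
  then have "F (u + t *s (w - u)) * G (u + t *s (w - u)) \<noteq> 0" unfolding p q by simp
  then show ?thesis using assms form_mult by (auto simp: nzform_def)
qed

lemma nzform_prod:
  assumes "\<And>a. a \<in> A \<Longrightarrow> nzform (d a) (F a)" shows "nzform (sum d A) (\<lambda>v. \<Prod>a\<in>A. F a v)"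
  using assms
proof (induction A rule: infinite_finite_induct)
  case (insert a A)
  then show ?case using nzform_mult[of "d a" "F a" "sum d A"] by simp
qed (auto simp: nzform_def form_const)

section \<open>Binary forms: restriction to a line and division by zeros\<close>

definition bform :: "nat \<Rightarrow> (complex \<Rightarrow> complex \<Rightarrow> complex) \<Rightarrow> bool" where
  "bform d B \<longleftrightarrow> (\<exists>c. B = (\<lambda>x y. \<Sum>k\<le>d. c k * x ^ k * y ^ (d - k)))"

lemma bform_add:
  assumes "bform d F" "bform d G" shows "bform d (\<lambda>x y. F x y + G x y)"
proof -
  obtain b c where "F = (\<lambda>x y. \<Sum>k\<le>d. b k * x ^ k * y ^ (d - k))"
    "G = (\<lambda>x y. \<Sum>k\<le>d. c k * x ^ k * y ^ (d - k))"
    using assms unfolding bform_def by auto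
  then show ?thesis
    unfolding bform_def
    by (intro exI[of _ "\<lambda>k. b k + c k"]) (simp add: sum.distrib[symmetric] ring_distribs)
qed

lemma bform_scale:
  assumes "bform d F" shows "bform d (\<lambda>x y. a * F x y)"
proof -
  obtain b where "F = (\<lambda>x y. \<Sum>k\<le>d. b k * x ^ k * y ^ (d - k))"
    using assms unfolding bform_def by auto
  then show ?thesis
    unfolding bform_def
    by (intro exI[of _ "\<lambda>k. a * b k"]) (simp add: sum_distrib_left mult.assoc)
qed

lemma bform_zero: "bform d (\<lambda>x y. 0)"
  unfolding bform_def by (rule exI[of _ "\<lambda>_. 0"]) simp

lemma bform_sum:
  assumes "\<And>a. a \<in> A \<Longrightarrow> bform d (F a)" shows "bform d (\<lambda>x y. \<Sum>a\<in>A. F a x y)"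
  using assms
  by (induction A rule: infinite_finite_induct) (auto intro: bform_zero bform_add)

lemma bform_monom:
  assumes "j + k = d" shows "bform d (\<lambda>x y. c * x ^ j * y ^ k)"
  unfolding bform_def
proof (intro exI ext)
  fix x y
  have "(\<Sum>i\<le>d. (if i = j then c else 0) * x ^ i * y ^ (d - i)) =
      (\<Sum>i\<le>d. if i = j then c * x ^ j * y ^ k else 0)"
    by (rule sum.cong) (use assms in auto)
  then show "c * x ^ j * y ^ k = (\<Sum>i\<le>d. (\<lambda>i. if i = j then c else 0) i * x ^ i * y ^ (d - i))"
    using assms by simp
qed

lemma bform_pt:
  assumes "form d F" shows "bform d (\<lambda>x y. F (pt \<alpha> \<beta> i x y))"
proof -
  obtain b where F: "F = (\<lambda>v. \<Sum>e | (\<Sum>i\<in>UNIV. e i) = d. b e * monom4 e v)"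
    using assms unfolding form_def by auto
  have m: "b e * monom4 e (pt \<alpha> \<beta> i x y) =
      (b e * crd0 i ^ e 1 * crd1 \<alpha> i ^ e 2 * crd0 i ^ e 3 * crd1 \<beta> i ^ e 4) *
        x ^ (e 1 + e 2) * y ^ (e 3 + e 4)" for e x y
    unfolding UNIV_4 by (simp only: prod.insert prod.empty finite.intros insert_iff empty_iff
      index_4_distinct simp_thms pt_nth power_mult_distrib power_add) (simp only: mult_ac mult_1_left)
  show ?thesis
    unfolding F m by (rule bform_sum, rule bform_monom) (simp add: sum_4)
qed

lemma form_bform:
  assumes "bform d h" "form 1 l" "form 1 l'" shows "form d (\<lambda>v. h (l v) (l' v))"
proof -
  obtain b where h: "h = (\<lambda>x y. \<Sum>k\<le>d. b k * x ^ k * y ^ (d - k))"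
    using assms unfolding bform_def by auto
  have "form d (\<lambda>v. b k * (l v ^ k * l' v ^ (d - k)))" if "k \<le> d" for k
    using form_scale[OF form_mult[OF form_power[OF assms(2), of k] form_power[OF assms(3), of "d - k"]]]
      that by simp
  then show ?thesis
    unfolding h mult.assoc by (rule form_sum) simp
qed

text \<open>Homogeneous factor theorem. Subtracting the vanishing value turns each power of x into a
  multiple of (b x)^k - (a y)^k, which is divisible by b x - a y. For d = 0 the form g is zero, so
  the truncated d - 1 does no harm.\<close>

lemma bform_factor:
  assumes "bform d g" "g a b = 0" "b \<noteq> 0"
  obtains h where "bform (d - 1) h" "\<And>x y. g x y = (b * x - a * y) * h x y"
proof -
  obtain c where g: "g = (\<lambda>x y. \<Sum>k\<le>d. c k * x ^ k * y ^ (d - k))"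
    using assms(1) unfolding bform_def by (elim exE)
  define h where "h = (\<lambda>x y. \<Sum>k\<le>d. \<Sum>i<k.
      c k / b ^ k * a ^ (k - Suc i) * b ^ i * x ^ i * y ^ (d - Suc i))"
  have m: "bform (d - 1) (\<lambda>x y. c k / b ^ k * a ^ (k - Suc i) * b ^ i * x ^ i * y ^ (d - Suc i))"
    if "k \<le> d" "i < k" for k i
    by (rule bform_monom) (use that in simp)
  have 1: "bform (d - 1) h"
    unfolding h_def by (rule bform_sum, rule bform_sum, rule m) simp_all
  have 2: "g x y = (b * x - a * y) * h x y" for x y
  proof -
    \<comment> \<open>Dividing \<open>y ^ d * g a b = 0\<close> by b^d gives a vanishing sum with
      the same factors \<open>y ^ (d - k)\<close> as in \<open>g x y\<close>, ready to be subtracted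
      term by term.\<close>
    have "y ^ d * g a b = (\<Sum>k\<le>d. c k / b ^ k * (a * y) ^ k * (b * y) ^ (d - k) * b ^ k)"
      unfolding g sum_distrib_left
    proof (rule sum.cong[OF refl])
      fix k assume "k \<in> {..d}"
      then have "y ^ d = y ^ k * y ^ (d - k)" by (simp flip: power_add)
      then show "y ^ d * (c k * a ^ k * b ^ (d - k)) =
          c k / b ^ k * (a * y) ^ k * (b * y) ^ (d - k) * b ^ k"
        using assms(3) by (simp add: power_mult_distrib)
    qed
    also have "\<dots> = b ^ d * (\<Sum>k\<le>d. c k / b ^ k * (a * y) ^ k * y ^ (d - k))"
      unfolding sum_distrib_left
    proof (rule sum.cong[OF refl])
      fix k assume "k \<in> {..d}"
      then have "b ^ d = b ^ k * b ^ (d - k)" by (simp flip: power_add)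
      then show "c k / b ^ k * (a * y) ^ k * (b * y) ^ (d - k) * b ^ k =
          b ^ d * (c k / b ^ k * (a * y) ^ k * y ^ (d - k))"
        by (simp add: power_mult_distrib)
    qed
    finally have z: "(\<Sum>k\<le>d. c k / b ^ k * (a * y) ^ k * y ^ (d - k)) = 0"
      using assms by simp
    have "g x y = (\<Sum>k\<le>d. c k / b ^ k * (b * x) ^ k * y ^ (d - k)) -
        (\<Sum>k\<le>d. c k / b ^ k * (a * y) ^ k * y ^ (d - k))"
      unfolding z g using assms(3) by (simp add: power_mult_distrib)
    also have "\<dots> = (\<Sum>k\<le>d. c k / b ^ k * y ^ (d - k) * ((b * x) ^ k - (a * y) ^ k))"
      unfolding sum_subtractf[symmetric] by (rule sum.cong) (simp_all add: algebra_simps)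
    also have "\<dots> = (\<Sum>k\<le>d. c k / b ^ k * y ^ (d - k) *
        ((b * x - a * y) * (\<Sum>i<k. (a * y) ^ (k - Suc i) * (b * x) ^ i)))"
      by (simp only: power_diff_sumr2)
    also have "\<dots> = (b * x - a * y) * h x y"
      unfolding h_def sum_distrib_left
    proof (rule sum.cong[OF refl], rule sum.cong[OF refl])
      fix k i assume "k \<in> {..d}" "i \<in> {..<k}"
      then have "y ^ (d - Suc i) = y ^ (d - k) * y ^ (k - Suc i)" by (simp flip: power_add)
      then show "c k / b ^ k * y ^ (d - k) * ((b * x - a * y) * ((a * y) ^ (k - Suc i) * (b * x) ^ i)) =
        (b * x - a * y) * (c k / b ^ k * a ^ (k - Suc i) * b ^ i * x ^ i * y ^ (d - Suc i))"
        by (simp add: power_mult_distrib)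
    qed
    finally show ?thesis .
  qed
  show ?thesis by (rule that[OF 1 2])
qed

text \<open>The zeros are pairwise non-proportional, so the linear factors already split off do not
  vanish at the next zero, which is then a zero of the cofactor.\<close>

lemma bform_factor_prod:
  assumes "finite J" "bform d g" "\<And>j. j \<in> J \<Longrightarrow> g (a j) (b j) = 0" "\<And>j. j \<in> J \<Longrightarrow> b j \<noteq> 0"
    "\<And>j k. j \<in> J \<Longrightarrow> k \<in> J \<Longrightarrow> j \<noteq> k \<Longrightarrow> a j * b k \<noteq> a k * b j"
  shows "\<exists>h. bform (d - card J) h \<and> (\<forall>x y. g x y = (\<Prod>j\<in>J. b j * x - a j * y) * h x y)"
  using assms
proof (induction J rule: finite_induct)
  case (insert j J)
  then obtain h where h: "bform (d - card J) h" "\<And>x y. g x y = (\<Prod>j\<in>J. b j * x - a j * y) * h x y"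
    by auto
  have "(\<Prod>k\<in>J. b k * a j - a k * b j) \<noteq> 0"
  proof -
    have "b k * a j - a k * b j \<noteq> 0" if "k \<in> J" for k
      using insert.prems(4)[of j k] insert.hyps(2) that by (auto simp: mult.commute)
    then show ?thesis using insert.hyps(1) by simp
  qed
  then have "h (a j) (b j) = 0" using insert.prems(2)[of j] h(2) by simp
  then obtain h' where h': "bform (d - card J - 1) h'" "\<And>x y. h x y = (b j * x - a j * y) * h' x y"
    using bform_factor[OF h(1)] insert.prems(3)[of j] by auto
  show ?case
  proof (intro exI conjI allI)
    show "bform (d - card (insert j J)) h'" using h'(1) insert.hyps by simp
    show "g x y = (\<Prod>k\<in>insert j J. b k * x - a k * y) * h' x y" for x y
      unfolding h(2) h'(2) using insert.hyps by simp
  qed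
next
  case empty
  then show ?case by (intro exI[of _ g]) simp
qed

section \<open>Projection of the standard configurations\<close>

lemma index_4_other:
  fixes i :: 4 obtains j where "j \<noteq> i"
proof (cases "i = 1")
  case True
  then show ?thesis using that[of 2] by simp
next
  case False
  then show ?thesis using that[of 1] by simp
qed

lemma form_linear: "form 1 (\<lambda>v. a * v $ i + b * v $ j)"
  by (intro form_add form_scale form_coord)

lemma functional_of_plane:
  assumes "proj_plane H"
  shows "\<exists>h. nzform 1 h \<and> (\<forall>u v. h (u + v) = h u + h v) \<and> (\<forall>c v. h (c *s v) = c * h v) \<and>
    H = {v. h v = 0}"
proof -
  have H: "vec.subspace H" "vec.dim H = 3" using assms by (auto simp: proj_plane_def)
  obtain B where B: "B \<subseteq> H" "vec.independent B" "H \<subseteq> vec.span B" "card B = vec.dim H"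
    using vec.basis_exists .
  have spB: "vec.span B = H" using B H by (simp add: subset_antisym vec.span_minimal)
  have "vec.dim (UNIV :: (complex^4) set) = 4"
    using vec_dim_card[where 'a = complex and 'n = 4] by (simp del: vec.dim_UNIV)
  then have "H \<noteq> UNIV" using H by auto
  then obtain w where w: "w \<notin> H" by auto
  have ind: "vec.independent (insert w B)"
    using vec.independent_insertI[of w B] B w spB by simp
  obtain g :: "complex^4 \<Rightarrow> complex^4" where g: "Vector_Spaces.linear (*s) (*s) g"
    "\<And>x. x \<in> insert w B \<Longrightarrow> g x = (if x = w then w else 0)"
    using vec.linear_independent_extend[OF ind, of "\<lambda>x. if x = w then w else 0"] by metis
  interpret g: Vector_Spaces.linear "(*s)" "(*s)" g by (rule g(1))
  have "w \<noteq> 0" using w H(1) vec.subspace_0 by auto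
  then obtain i where i: "w $ i \<noteq> 0" by (auto simp: vec_eq_iff)
  \<comment> \<open>A coordinate of an endomorphism that kills H and fixes w, at an index where w
    does not vanish.\<close>
  define h where "h = (\<lambda>v. g v $ i)"
  have add: "h (u + v) = h u + h v" for u v by (simp add: h_def g.add)
  have scale: "h (c *s v) = c * h v" for c v by (simp add: h_def g.scale)
  have hB: "h x = 0" if "x \<in> H" for x
  proof -
    have "w \<notin> B" using w B(1) by auto
    then have "\<And>x. x \<in> B \<Longrightarrow> g x = 0" using g(2) by auto
    then have "g x = 0" using that spB g.eq_0_on_span by blast
    then show ?thesis by (simp add: h_def)
  qed
  have hw: "h w \<noteq> 0" using g(2)[of w] i by (simp add: h_def)
  have "w \<notin> B" using w B(1) by auto
  then have "vec.dim (vec.span (insert w B)) = 4"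
    using ind B(1,4) w H(2) vec.finiteI_independent[OF B(2)]
    by (subst vec.dim_span_eq_card_independent) auto
  then have "vec.span (insert w B) = UNIV"
    by (metis \<open>vec.dim UNIV = 4\<close> subset_UNIV vec.dim_eq_full vec.dim_span vec.span_UNIV)
  then have dec: "\<exists>k. v - k *s w \<in> H" for v
    using spB vec.span_breakdown_eq[of v w B] by auto
  have "v \<in> H" if "h v = 0" for v
  proof -
    obtain k where k: "v - k *s w \<in> H" using dec by auto
    have "h v = h (v - k *s w) + h (k *s w)" by (subst add[symmetric]) simp
    then have "k = 0" using that hB[OF k] hw by (simp add: scale)
    then show ?thesis using k by simp
  qed
  then have HH: "H = {v. h v = 0}" using hB by auto
  have hx: "h v = (\<Sum>j\<in>UNIV. h (axis j 1) * v $ j)" for v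
  proof -
    have "g v = (\<Sum>j\<in>UNIV. v $ j *s g (axis j 1))"
      by (subst basis_expansion[symmetric]) (simp add: g.sum g.scale)
    then show ?thesis by (simp add: h_def sum_component mult.commute)
  qed
  have "form 1 (\<lambda>v. \<Sum>j\<in>UNIV. h (axis j 1) * v $ j)"
    by (rule form_sum, rule form_scale, rule form_coord)
  then have "form 1 h" unfolding hx[symmetric] .
  then have "nzform 1 h" using hw by (auto simp: nzform_def)
  then show ?thesis using add scale HH by (intro exI[of _ h]) simp
qed

text \<open>Since G vanishes at 0, a vector of P with nonzero value is itself nonzero and spans P;
  so an open condition on vectors becomes one on points.\<close>

lemma general_point_nzform:
  assumes "nzform d G" "G 0 = 0" "\<And>p. G p \<noteq> 0 \<Longrightarrow> Q (vec.span {p})"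
  shows "general_point Q"
  unfolding general_point_def
proof (rule exI[of _ d], rule exI[of _ G], intro conjI allI impI)
  show "form d G" "\<exists>v. G v \<noteq> 0" using assms(1) by (auto simp: nzform_def)
  fix P assume P: "proj_point P \<and> (\<exists>v\<in>P. G v \<noteq> 0)"
  then obtain v where v: "v \<in> P" "G v \<noteq> 0" by auto
  obtain w where w: "P = vec.span {w}" using P proj_pointE by blast
  then obtain c where c: "v = c *s w" using v(1) by (auto simp: vec.span_singleton)
  then have "c \<noteq> 0" using v assms(2) by auto
  then have "P = vec.span {v}" unfolding c w by (simp add: span_sing_scale)
  then show "Q P" using assms(3) v by auto
qed

text \<open>The root of unity conditions on s and t, stated for all pairs of lines at once. The
  bound 3 is the number of crossings of one line with the others, the most linear factors that the
  interpolation has to split off.\<close>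

locale unity_brackets =
  fixes m :: nat and \<alpha> \<beta> :: complex
  assumes m_ge: "m \<ge> 3"
    and params: "\<alpha> \<noteq> 0" "\<alpha> \<noteq> 1" "\<beta> \<noteq> 0" "\<beta> \<noteq> 1"
    and bracket_power: "i \<noteq> j \<Longrightarrow> bracket \<beta> i j ^ m = bracket \<alpha> i j ^ m"
begin

text \<open>\<open>dx i\<close> and \<open>dy i\<close> are coordinates on the quotient of the space
  by the i-th line: they vanish together exactly on that line.\<close>

definition dx :: "4 \<Rightarrow> complex ^ 4 \<Rightarrow> complex" where
  "dx i v = crd0 i * v $ 2 - crd1 \<alpha> i * v $ 1"
definition dy :: "4 \<Rightarrow> complex ^ 4 \<Rightarrow> complex" where
  "dy i v = crd0 i * v $ 4 - crd1 \<beta> i * v $ 3"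

text \<open>\<open>ell i p\<close> vanishes on the plane spanned by the point \<open>p\<close> and the line \<open>std_line \<alpha> \<beta> i\<close>.\<close>

definition ell :: "4 \<Rightarrow> complex ^ 4 \<Rightarrow> complex ^ 4 \<Rightarrow> complex" where
  "ell i p v = dy i p * dx i v - dx i p * dy i v"

text \<open>The constant that makes the forms on two lines agree at their crossing: there
  \<open>cf i p * (x ^ m - y ^ m)\<close> becomes \<open>cf i p * cf j p\<close> times the m-th
  power of a bracket, which is the same seen from either line.\<close>

definition cf :: "4 \<Rightarrow> complex ^ 4 \<Rightarrow> complex" where
  "cf i p = dx i p ^ m - dy i p ^ m"

text \<open>Nonzero iff the images of the lines \<open>i\<close>, \<open>j\<close>, \<open>k\<close> under projection from \<open>p\<close> are not concurrent.\<close>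

definition conc :: "4 \<Rightarrow> 4 \<Rightarrow> 4 \<Rightarrow> complex ^ 4 \<Rightarrow> complex" where
  "conc i j k p = dx j p * bracket \<beta> j i * (dy k p * bracket \<alpha> k i) -
     dx k p * bracket \<beta> k i * (dy j p * bracket \<alpha> j i)"

lemma bracket_nz: "i \<noteq> j \<Longrightarrow> bracket \<alpha> i j \<noteq> 0" "i \<noteq> j \<Longrightarrow> bracket \<beta> i j \<noteq> 0"
  using bracket_nonzero params by auto

lemma dx_pt: "dx i (pt \<alpha> \<beta> j x y) = bracket \<alpha> i j * x"
  by (simp add: dx_def bracket_def algebra_simps)
lemma dy_pt: "dy i (pt \<alpha> \<beta> j x y) = bracket \<beta> i j * y"
  by (simp add: dy_def bracket_def algebra_simps)
lemma dx_add: "dx i (u + t *s v) = dx i u + t * dx i v"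
  by (simp add: dx_def algebra_simps)
lemma dy_add: "dy i (u + t *s v) = dy i u + t * dy i v"
  by (simp add: dy_def algebra_simps)

lemma ell_pt: "ell i p (pt \<alpha> \<beta> j x y) = dy i p * bracket \<alpha> i j * x - dx i p * bracket \<beta> i j * y"
  by (simp add: ell_def dx_pt dy_pt)
lemma ell_pt_same: "ell i p (pt \<alpha> \<beta> i x y) = 0"
  by (simp add: ell_pt bracket_def)
lemma ell_add: "ell i p (u + t *s v) = ell i p u + t * ell i p v"
  by (simp add: ell_def dx_add dy_add algebra_simps)
lemma ell_self: "ell i p p = 0"
  by (simp add: ell_def)
lemma ell_scale: "ell i p (t *s v) = t * ell i p v"
  by (simp add: ell_def dx_def dy_def algebra_simps)

lemma form_dx: "form 1 (dx i)" and form_dy: "form 1 (dy i)"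
  using form_linear[of "crd0 i" 2 "- crd1 \<alpha> i" 1] form_linear[of "crd0 i" 4 "- crd1 \<beta> i" 3]
  unfolding dx_def[abs_def] dy_def[abs_def] by simp_all

lemma form_ell: "form 1 (ell i p)"
  unfolding ell_def[abs_def] by (intro form_diff form_scale form_dx form_dy)

lemma nzform_dx: "nzform 1 (dx i)"
proof -
  obtain j where "j \<noteq> i" by (rule index_4_other)
  then have "dx i (pt \<alpha> \<beta> j 1 1) \<noteq> 0" using bracket_nz by (auto simp: dx_pt)
  then show ?thesis using form_dx by (auto simp: nzform_def)
qed

lemma nzform_dy: "nzform 1 (dy i)"
proof -
  obtain j where "j \<noteq> i" by (rule index_4_other)
  then have "dy i (pt \<alpha> \<beta> j 1 1) \<noteq> 0" using bracket_nz by (auto simp: dy_pt)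
  then show ?thesis using form_dy by (auto simp: nzform_def)
qed

lemma nzform_cf: "nzform m (cf i)"
proof -
  obtain j where "j \<noteq> i" by (rule index_4_other)
  then have "cf i (pt \<alpha> \<beta> j 1 0) \<noteq> 0" using bracket_nz[of i j] m_ge
    by (auto simp: cf_def dx_pt dy_pt power_0_left)
  moreover have "form m (cf i)"
    using form_diff[OF form_power[OF form_dx, of m i] form_power[OF form_dy, of m i]]
    by (simp add: cf_def[abs_def])
  ultimately show ?thesis by (auto simp: nzform_def)
qed

lemma nzform_conc:
  assumes "i \<noteq> j" "i \<noteq> k" "j \<noteq> k"
  shows "nzform 2 (conc i j k)"
proof -
  have "form 2 (\<lambda>v. dx j v * dy k v)" "form 2 (\<lambda>v. dx k v * dy j v)"
    using form_mult[OF form_dx[of j] form_dy[of k]] form_mult[OF form_dx[of k] form_dy[of j]]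
    by (simp_all add: numeral_2_eq_2)
  then have "form 2 (\<lambda>v. (bracket \<beta> j i * bracket \<alpha> k i) * (dx j v * dy k v) -
      (bracket \<beta> k i * bracket \<alpha> j i) * (dx k v * dy j v))"
    by (intro form_diff form_scale)
  then have "form 2 (conc i j k)"
    unfolding conc_def[abs_def] by (simp add: mult_ac)
  \<comment> \<open>The x-part is taken from line k and the y-part from line j. Then
    \<open>dx k\<close> vanishes and a product of nonzero brackets remains.\<close>
  moreover define v :: "complex^4" where "v = (\<chi> n. if n = 1 then crd0 k else if n = 2 then crd1 \<alpha> k
      else if n = 3 then crd0 j else crd1 \<beta> j)"
  have "dx j v = bracket \<alpha> j k" "dx k v = 0" "dy k v = bracket \<beta> k j"
    by (simp_all add: v_def dx_def dy_def bracket_def mult.commute)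
  then have "conc i j k v \<noteq> 0"
    using bracket_nz assms by (auto simp: conc_def)
  ultimately show ?thesis by (auto simp: nzform_def)
qed

text \<open>Nonzero \<open>dx\<close> and \<open>dy\<close> make the coordinates of the crossings
  nonzero, nonzero \<open>cf\<close> keeps the projected points of one line off the other lines, and
  nonzero \<open>conc\<close> keeps the crossings on each line distinct.\<close>

definition generic :: "complex ^ 4 \<Rightarrow> bool" where
  "generic p \<longleftrightarrow> (\<forall>i. dx i p \<noteq> 0 \<and> dy i p \<noteq> 0 \<and> cf i p \<noteq> 0) \<and>
     (\<forall>i j k. i \<noteq> j \<longrightarrow> i \<noteq> k \<longrightarrow> j \<noteq> k \<longrightarrow> conc i j k p \<noteq> 0)"

text \<open>The crossing point of the images of two lines, seen on either line.\<close>

lemma crossing: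
  "pt \<alpha> \<beta> i (dx j p * bracket \<beta> j i) (dy j p * bracket \<alpha> j i) =
   pt \<alpha> \<beta> j (dx i p * bracket \<beta> j i) (dy i p * bracket \<alpha> j i) + (bracket \<alpha> j i * bracket \<beta> j i) *s p"
  by (simp add: vec_eq_iff forall_4 dx_def dy_def) (simp add: bracket_def algebra_simps)

text \<open>Newton interpolation, one line at a time: the difference between the prescribed form on a new
  line and the form found so far vanishes at the crossings with the previous lines, because there the
  prescribed values \<open>cf j p * (x ^ m - y ^ m)\<close> agree by \<open>crossing\<close> and \<open>bracket_power\<close>.\<close>

lemma interpolation:
  assumes p: "generic p"
  shows "\<exists>F. form m F \<and> (\<forall>v t. F (v + t *s p) = F v) \<and>
    (\<forall>j\<in>J. \<forall>x y. F (pt \<alpha> \<beta> j x y) = cf j p * (x ^ m - y ^ m))"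
proof (induction J rule: infinite_finite_induct)
  case (infinite A)
  then show ?case by simp
next
  case empty
  show ?case using form_zero by (intro exI[of _ "\<lambda>_. 0"]) simp
next
  case (insert i J)
  then obtain F where F: "form m F" "\<And>v t. F (v + t *s p) = F v"
    "\<And>j x y. j \<in> J \<Longrightarrow> F (pt \<alpha> \<beta> j x y) = cf j p * (x ^ m - y ^ m)" by blast
  have d: "dx j p \<noteq> 0" "dy j p \<noteq> 0" for j using p by (auto simp: generic_def)
  define a where "a j = dx j p * bracket \<beta> j i" for j
  define b where "b j = dy j p * bracket \<alpha> j i" for j
  define g where "g = (\<lambda>x y. cf i p * (x ^ m - y ^ m) - F (pt \<alpha> \<beta> i x y))"
  have ij: "j \<noteq> i" if "j \<in> J" for j using that insert.hyps by auto
  have "bform m (\<lambda>x y. cf i p * x ^ m * y ^ 0 +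
      ((- cf i p) * x ^ 0 * y ^ m + (-1) * F (pt \<alpha> \<beta> i x y)))"
    using bform_monom[of m 0 m "cf i p"] bform_monom[of 0 m m "- cf i p"]
      bform_scale[OF bform_pt[OF F(1), of \<alpha> \<beta> i], of "-1"]
    by (intro bform_add) simp_all
  moreover have "(\<lambda>x y. cf i p * x ^ m * y ^ 0 +
      ((- cf i p) * x ^ 0 * y ^ m + (-1) * F (pt \<alpha> \<beta> i x y))) = g"
    unfolding g_def by (intro ext) (simp add: algebra_simps)
  ultimately have "bform m g" by simp
  moreover have "g (a j) (b j) = 0" if j: "j \<in> J" for j
  proof -
    have e: "bracket \<beta> j i ^ m = bracket \<alpha> j i ^ m" using bracket_power ij[OF j] by simp
    show ?thesis
      unfolding g_def a_def b_def crossing F(2) F(3)[OF j] cf_def power_mult_distrib e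
      by (simp add: algebra_simps)
  qed
  moreover have "b j \<noteq> 0" if "j \<in> J" for j
    using d bracket_nz ij[OF that] by (simp add: b_def)
  moreover have "a j * b k \<noteq> a k * b j" if "j \<in> J" "k \<in> J" "j \<noteq> k" for j k
  proof -
    have "conc i j k p \<noteq> 0"
      using p ij[OF that(1)] ij[OF that(2)] that(3) unfolding generic_def by metis
    then show ?thesis by (simp add: conc_def a_def b_def)
  qed
  ultimately obtain h where h: "bform (m - card J) h"
    "\<And>x y. g x y = (\<Prod>j\<in>J. b j * x - a j * y) * h x y"
    using bform_factor_prod[OF insert.hyps(1), of m g a b] by blast
  have fac: "(\<Prod>j\<in>J. b j * x - a j * y) = (\<Prod>j\<in>J. ell j p (pt \<alpha> \<beta> i x y))" for x y
    by (rule prod.cong) (auto simp: ell_pt a_def b_def)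
  \<comment> \<open>\<open>X\<close> and \<open>Y\<close> vanish at p, hence are unchanged by
    translation along p, and on the new line they are the coordinates x and y.\<close>
  define X where "X v = 1 / dx i p * (p $ 2 * v $ 1 + (- p $ 1) * v $ 2)" for v :: "complex^4"
  define Y where "Y v = 1 / dy i p * (p $ 4 * v $ 3 + (- p $ 3) * v $ 4)" for v :: "complex^4"
  have X: "X (v + t *s p) = X v" "Y (v + t *s p) = Y v"
    "X (pt \<alpha> \<beta> i x y) = x" "Y (pt \<alpha> \<beta> i x y) = y" for v t x y
    using d[of i] by (simp_all add: X_def Y_def divide_simps) (simp_all add: dx_def dy_def algebra_simps)
  \<comment> \<open>The correction vanishes on an earlier line j through its factor
    \<open>ell j p\<close>, and on line i it equals \<open>g\<close>.\<close>
  define F' where "F' v = F v + (\<Prod>j\<in>J. ell j p v) * h (X v) (Y v)" for v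
  \<comment> \<open>As i is not in J, at most three factors were split off, so
    \<open>m - card J\<close> is an honest difference of degrees.\<close>
  have "card J \<noteq> 4" using insert.hyps(2) card_subset_eq[of UNIV J] by auto
  moreover have "card J \<le> 4" using card_mono[of "UNIV :: 4 set" J] by simp
  ultimately have "card J \<le> m" using m_ge by simp
  moreover have "form (card J + (m - card J)) (\<lambda>v. (\<Prod>j\<in>J. ell j p v) * h (X v) (Y v))"
  proof (rule form_mult)
    show "form (card J) (\<lambda>v. \<Prod>j\<in>J. ell j p v)"
      using form_prod[of J "\<lambda>_. 1" "\<lambda>j. ell j p"] form_ell by simp
    show "form (m - card J) (\<lambda>v. h (X v) (Y v))"
      unfolding X_def Y_def by (rule form_bform[OF h(1)]; rule form_scale; rule form_linear)
  qed
  ultimately have "form m F'"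
    unfolding F'_def[abs_def] by (intro form_add[OF F(1)]) simp
  moreover have "F' (v + t *s p) = F' v" for v t
    by (simp add: F'_def F(2) X ell_add ell_self)
  moreover have "F' (pt \<alpha> \<beta> j x y) = cf j p * (x ^ m - y ^ m)" if "j \<in> insert i J" for j x y
  proof (cases "j = i")
    case True
    show ?thesis unfolding True F'_def X fac[symmetric] h(2)[symmetric] g_def by simp
  next
    case False
    then have "j \<in> J" using that by simp
    then have "(\<Prod>k\<in>J. ell k p (pt \<alpha> \<beta> j x y)) = 0"
      using insert.hyps(1) \<open>j \<in> J\<close> ell_pt_same[of j] by auto
    then show ?thesis using F(3)[OF \<open>j \<in> J\<close>] by (simp add: F'_def)
  qed
  ultimately show ?case by (intro exI[of _ F'] conjI ballI allI)
qed

text \<open>If the image of the point lay on the image of line j, taking m-th powers would remove r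
  and the difference between the two brackets, leaving \<open>cf j p = 0\<close>.\<close>

lemma ell_pt_nonzero:
  assumes p: "generic p" and "j \<noteq> i" "r ^ m = 1"
  shows "ell j p (pt \<alpha> \<beta> i 1 r) \<noteq> 0"
proof
  assume "ell j p (pt \<alpha> \<beta> i 1 r) = 0"
  then have "dy j p * bracket \<alpha> j i = dx j p * bracket \<beta> j i * r" by (simp add: ell_pt)
  then have "(dy j p * bracket \<alpha> j i) ^ m = (dx j p * bracket \<beta> j i * r) ^ m" by simp
  then have "dy j p ^ m * bracket \<alpha> j i ^ m = dx j p ^ m * bracket \<alpha> j i ^ m"
    using bracket_power[OF assms(2)] assms(3) by (simp add: power_mult_distrib)
  then have "cf j p = 0" using bracket_nz(1)[OF assms(2)] by (simp add: cf_def)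
  then show False using p by (simp add: generic_def)
qed

lemma generic_open: "\<exists>d G. nzform d G \<and> G 0 = 0 \<and> (\<forall>p. G p \<noteq> 0 \<longrightarrow> generic p)"
proof -
  define G1 where "G1 p = (\<Prod>i\<in>UNIV. dx i p * dy i p * cf i p)" for p
  let ?I = "{(i, j, k). i \<noteq> j \<and> i \<noteq> k \<and> j \<noteq> (k :: 4)}"
  define G2 where "G2 p = (\<Prod>(i, j, k)\<in>?I. conc i j k p)" for p
  have "nzform (1 + 1 + m) (\<lambda>p. dx i p * dy i p * cf i p)" for i
    by (rule nzform_mult[OF nzform_mult[OF nzform_dx nzform_dy] nzform_cf])
  then have 1: "nzform (\<Sum>i\<in>(UNIV::4 set). 1 + 1 + m) G1"
    unfolding G1_def[abs_def] by (rule nzform_prod)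
  have 2: "nzform (\<Sum>i\<in>?I. 2) G2"
    unfolding G2_def[abs_def] by (rule nzform_prod) (auto intro: nzform_conc)
  have "generic p" if "G1 p * G2 p \<noteq> 0" for p
  proof -
    have "dx i p \<noteq> 0 \<and> dy i p \<noteq> 0 \<and> cf i p \<noteq> 0" for i
      using that by (auto simp: G1_def)
    moreover have "finite ?I" by (rule finite_subset[OF subset_UNIV finite])
    then have "conc i j k p \<noteq> 0" if "i \<noteq> j" "i \<noteq> k" "j \<noteq> k" for i j k
      using \<open>G1 p * G2 p \<noteq> 0\<close> that by (auto simp: G2_def)
    ultimately show ?thesis by (simp add: generic_def)
  qed
  moreover have "G1 0 * G2 0 = 0" by (simp add: G1_def dx_def)
  ultimately show ?thesis using nzform_mult[OF 1 2] by blast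
qed

text \<open>Projection to H is induced by a linear map that changes a vector only by a multiple of
  p. The interpolating form and every \<open>ell i p\<close> are invariant under such changes, so
  all computations in H take place in the coordinates x and y of the lines in space.\<close>

lemma projected_config:
  assumes p: "generic p" and hp: "h p \<noteq> 0"
    and add: "\<And>u v. h (u + v) = h u + h v" and scale: "\<And>c v. h (c *s v) = c * h v"
    and H: "H = {v. h v = 0}"
  defines "P \<equiv> vec.span {p}" and "Z \<equiv> std_config m \<alpha> \<beta>"
  shows "card (project P H ` Z) = m * 4"
    and "\<And>i. plane_curve H 1 (ell i p)"
    and "\<And>i. {v \<in> H. ell i p v = 0} = project P H (std_line \<alpha> \<beta> i)"
    and "plane_curve H 4 (\<lambda>v. \<Prod>i\<in>UNIV. ell i p v)"
    and "\<exists>F. plane_curve H m F \<and>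
      transverse_intersection H F (\<lambda>v. \<Prod>i\<in>UNIV. ell i p v) (project P H ` Z)"
proof -
  have m0: "m > 0" using m_ge by simp
  have d: "dx j p \<noteq> 0" "dy j p \<noteq> 0" "cf j p \<noteq> 0" for j using p by (auto simp: generic_def)
  \<comment> \<open>The multiple of p that moves v into the kernel H of h.\<close>
  define \<tau> where "\<tau> v = - h v / h p" for v
  define \<pi> where "\<pi> v = v + \<tau> v *s p" for v
  have \<pi>H: "\<pi> v \<in> H" for v
  proof -
    have "h (\<pi> v) = h v + \<tau> v * h p" unfolding \<pi>_def add scale ..
    then show ?thesis using hp by (simp add: H \<tau>_def)
  qed
  have \<pi>_id: "\<pi> v = v" if "v \<in> H" for v using that by (simp add: H \<pi>_def \<tau>_def)
  have \<tau>: "\<tau> (u + v) = \<tau> u + \<tau> v" "\<tau> (c *s v) = c * \<tau> v" "\<tau> p = - 1" for u v c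
    using hp by (simp_all add: \<tau>_def add scale field_simps)
  have \<pi>_add: "\<pi> (u + v) = \<pi> u + \<pi> v" for u v
    by (simp add: \<pi>_def \<tau> vec_eq_iff algebra_simps)
  have \<pi>_scale: "\<pi> (c *s v) = c *s \<pi> v" for c v
    by (simp add: \<pi>_def \<tau> vec_eq_iff algebra_simps)
  have \<pi>_p: "\<pi> (c *s p) = 0" for c by (simp add: \<pi>_def \<tau> vec_eq_iff)
  have proj: "project P H X = \<pi> ` X" if X: "vec.subspace X" for X
  proof -
    have sp: "vec.span (P \<union> X) = {x + y |x y. x \<in> vec.span {p} \<and> y \<in> X}"
      using X by (simp add: P_def vec.span_Un vec.span_eq_iff[THEN iffD2])
    show ?thesis
    proof (intro set_eqI iffI)
      fix z assume "z \<in> project P H X"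
      then obtain c y where z: "z \<in> H" "z = c *s p + y" "y \<in> X"
        unfolding project_def sp by (auto simp: vec.span_singleton)
      then have "z = \<pi> y" using \<pi>_id[of z] by (simp add: \<pi>_add \<pi>_p)
      then show "z \<in> \<pi> ` X" using z by simp
    next
      fix z assume "z \<in> \<pi> ` X"
      then obtain y where y: "z = \<pi> y" "y \<in> X" by auto
      have "z = \<tau> y *s p + y" using y by (simp add: \<pi>_def add.commute)
      moreover have "\<tau> y *s p \<in> vec.span {p}" by (auto simp: vec.span_singleton)
      moreover have "z \<in> H" using y(1) \<pi>H by simp
      ultimately show "z \<in> project P H X"
        unfolding project_def sp using y(2) by blast
    qed
  qed
  have proj_span: "project P H (vec.span {v}) = vec.span {\<pi> v}" for v
    unfolding proj[OF vec.subspace_span] by (simp add: vec.span_singleton image_image \<pi>_scale)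
  have ell\<pi>: "ell i p (\<pi> v) = ell i p v" for i v
    by (simp add: \<pi>_def ell_add ell_self)
  define S where "S = project P H ` Z"
  have S: "S = {vec.span {\<pi> (pt \<alpha> \<beta> i 1 r)} | i r. r ^ m = 1}"
    unfolding S_def Z_def std_config_def proj_span[symmetric] by blast
  have \<pi>_pt_nz: "\<pi> (pt \<alpha> \<beta> i x y) = 0 \<longleftrightarrow> x = 0 \<and> y = 0" for i x y
  proof
    assume 0: "\<pi> (pt \<alpha> \<beta> i x y) = 0"
    obtain j where j: "j \<noteq> i" by (rule index_4_other)
    define t where "t = - \<tau> (pt \<alpha> \<beta> i x y)"
    have e: "pt \<alpha> \<beta> i x y = t *s p"
      using 0 by (simp add: \<pi>_def t_def vec_eq_iff eq_neg_iff_add_eq_0)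
    have "dx i (pt \<alpha> \<beta> i x y) = t * dx i p" unfolding e by (simp add: dx_def algebra_simps)
    then have "t = 0" using d by (simp add: dx_pt bracket_def)
    then show "x = 0 \<and> y = 0" using e by simp
  qed (use \<pi>_scale[of 0 0] in simp)
  have inj: "inj_on (project P H) Z"
  proof (rule inj_onI)
    fix z w assume "z \<in> Z" "w \<in> Z" and e: "project P H z = project P H w"
    then obtain i r j s where zw: "z = vec.span {pt \<alpha> \<beta> i 1 r}" "r ^ m = 1"
      "w = vec.span {pt \<alpha> \<beta> j 1 s}" "s ^ m = 1"
      unfolding Z_def std_config_def by auto
    obtain c where c: "\<pi> (pt \<alpha> \<beta> i 1 r) = c *s \<pi> (pt \<alpha> \<beta> j 1 s)"
      using e unfolding zw proj_span by (rule span_sing_eqE)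
    have "c \<noteq> 0" using c \<pi>_pt_nz[of i 1 r] by auto
    have "ell i p (pt \<alpha> \<beta> i 1 r) = c * ell i p (pt \<alpha> \<beta> j 1 s)"
      using arg_cong[OF c, of "ell i p"] by (simp add: ell_scale ell\<pi>)
    then have "ell i p (pt \<alpha> \<beta> j 1 s) = 0" using \<open>c \<noteq> 0\<close> by (simp add: ell_pt_same)
    then have ij: "i = j" using ell_pt_nonzero[OF p, of i j s] zw by auto
    have "\<pi> (pt \<alpha> \<beta> i 1 r + (- c) *s pt \<alpha> \<beta> i 1 s) = 0"
      using c unfolding \<pi>_add \<pi>_scale ij by (simp add: vec_eq_iff)
    then have "1 - c = 0 \<and> r - c * s = 0"
      using \<pi>_pt_nz[of i "1 - c" "r - c * s"] by (simp add: pt_add pt_scale del: vector_smult_lneg)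
    then show "z = w" using zw ij by simp
  qed
  show "card (project P H ` Z) = m * 4"
    using card_image[OF inj] card_std_config[OF m0 params] by (simp add: Z_def)
  show pc1: "plane_curve H 1 (ell i p)" for i
  proof -
    obtain j where j: "j \<noteq> i" by (rule index_4_other)
    then have "ell i p (\<pi> (pt \<alpha> \<beta> j 1 0)) \<noteq> 0"
      unfolding ell\<pi> ell_pt using d bracket_nz by auto
    then show ?thesis unfolding plane_curve_def using form_ell \<pi>H by blast
  qed
  show lines: "{v \<in> H. ell i p v = 0} = project P H (std_line \<alpha> \<beta> i)" for i
  proof -
    have "v \<in> \<pi> ` std_line \<alpha> \<beta> i" if v: "v \<in> H" "ell i p v = 0" for v
    proof -
      \<comment> \<open>Move v along p until \<open>dx i\<close> vanishes. Because
        \<open>ell i p v = 0\<close>, \<open>dy i\<close> vanishes as well, and the vector has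
        reached the line in space.\<close>
      define t where "t = - dx i v / dx i p"
      define u where "u = v + t *s p"
      have "dx i u = dx i v + t * dx i p" "dy i u = dy i v + t * dy i p"
        by (simp_all add: u_def dx_add dy_add)
      then have "dx i u = 0" "dy i u = 0"
        using v(2) d[of i] by (simp_all add: t_def ell_def field_simps)
      then have u: "crd0 i * u $ 2 = crd1 \<alpha> i * u $ 1" "crd0 i * u $ 4 = crd1 \<beta> i * u $ 3"
        by (simp_all add: dx_def dy_def)
      have "u = (if i = 2 then pt \<alpha> \<beta> i (u $ 2) (u $ 4) else pt \<alpha> \<beta> i (u $ 1) (u $ 3))"
        using u exhaust_4[of i] by (auto simp: vec_eq_iff forall_4 crd0_def crd1_def)
      then have "u \<in> std_line \<alpha> \<beta> i" by (metis pt_in_std_line)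
      moreover have "v = \<pi> u"
        using \<pi>_id[OF v(1)] \<pi>_p[of t] by (simp add: u_def \<pi>_add)
      ultimately show ?thesis by auto
    qed
    moreover have "\<pi> u \<in> H \<and> ell i p (\<pi> u) = 0" if "u \<in> std_line \<alpha> \<beta> i" for u
      using that \<pi>H ell_pt_same by (auto simp: std_line_def ell\<pi>)
    ultimately show ?thesis unfolding proj[OF subspace_std_line] by auto
  qed
  show "plane_curve H 4 (\<lambda>v. \<Prod>i\<in>UNIV. ell i p v)"
  proof -
    have "nzform 1 (ell i p)" for i using pc1[of i] by (auto simp: plane_curve_def nzform_def)
    then have "nzform (\<Sum>i\<in>(UNIV :: 4 set). 1) (\<lambda>v. \<Prod>i\<in>UNIV. ell i p v)"
      by (rule nzform_prod)
    then obtain v where "form 4 (\<lambda>v. \<Prod>i\<in>UNIV. ell i p v)" "(\<Prod>i\<in>UNIV. ell i p v) \<noteq> 0"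
      by (auto simp: nzform_def)
    moreover from this(2) have "(\<Prod>i\<in>UNIV. ell i p (\<pi> v)) \<noteq> 0" by (simp add: ell\<pi>)
    ultimately show ?thesis unfolding plane_curve_def using \<pi>H by blast
  qed
  obtain F where F: "form m F" "\<And>v t. F (v + t *s p) = F v"
    "\<And>j x y. F (pt \<alpha> \<beta> j x y) = cf j p * (x ^ m - y ^ m)"
    using interpolation[OF p, of UNIV] by auto
  have F\<pi>: "F (\<pi> v) = F v" for v by (simp only: \<pi>_def F(2))
  let ?G = "\<lambda>v. \<Prod>i\<in>UNIV. ell i p v"
  have "F (\<pi> (pt \<alpha> \<beta> 1 1 0)) \<noteq> 0" unfolding F\<pi> F(3) using d m0 by (simp add: power_0_left)
  then have pcF: "plane_curve H m F" unfolding plane_curve_def using F(1) \<pi>H by blast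
  have "S = curve_points H F \<inter> curve_points H ?G"
  proof (intro set_eqI iffI)
    fix q assume "q \<in> S"
    then obtain i r where q: "q = vec.span {\<pi> (pt \<alpha> \<beta> i 1 r)}" "r ^ m = 1" unfolding S by auto
    have "F v = 0 \<and> ?G v = 0 \<and> v \<in> H" if vq: "v \<in> q" for v
    proof -
      obtain c where v: "v = \<pi> (pt \<alpha> \<beta> i c (c * r))"
        using vq unfolding q(1) vec.span_singleton by (auto simp: \<pi>_scale[symmetric] pt_scale)
      have "F v = 0" unfolding v F\<pi> F(3) using q(2) by (simp add: power_mult_distrib)
      moreover have "ell i p v = 0" unfolding v ell\<pi> by (rule ell_pt_same)
      then have "?G v = 0" by auto
      ultimately show ?thesis using \<pi>H v by simp
    qed
    moreover have "proj_point q" unfolding q(1) using \<pi>_pt_nz by (intro proj_point_span) simp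
    ultimately show "q \<in> curve_points H F \<inter> curve_points H ?G"
      unfolding curve_points_def by blast
  next
    fix q assume q: "q \<in> curve_points H F \<inter> curve_points H ?G"
    then obtain v where v: "v \<noteq> 0" "q = vec.span {v}"
      using proj_pointE unfolding curve_points_def by blast
    have "v \<in> q" using v by (simp add: vec.span_base)
    then have "v \<in> H" "F v = 0" "?G v = 0" using q unfolding curve_points_def by auto
    then obtain i where "ell i p v = 0" by auto
    then have "v \<in> \<pi> ` std_line \<alpha> \<beta> i"
      using lines \<open>v \<in> H\<close> proj[OF subspace_std_line] by auto
    then obtain x y where xy: "v = \<pi> (pt \<alpha> \<beta> i x y)" by (auto simp: std_line_def)
    have e: "x ^ m = y ^ m" using \<open>F v = 0\<close> d unfolding xy F\<pi> F(3) by simp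
    have "x \<noteq> 0" using e v(1) \<pi>_pt_nz[of i x y] m0 unfolding xy by (auto simp: power_0_left)
    have "q = vec.span {\<pi> (pt \<alpha> \<beta> i 1 (y / x))}"
      using span_sing_scale[OF \<open>x \<noteq> 0\<close>, of "\<pi> (pt \<alpha> \<beta> i 1 (y / x))"] \<open>x \<noteq> 0\<close>
      unfolding v(2) xy by (simp add: \<pi>_scale[symmetric] pt_scale)
    moreover have "(y / x) ^ m = 1" using e \<open>x \<noteq> 0\<close> by (simp add: power_divide flip: e)
    ultimately show "q \<in> S" unfolding S by blast
  qed
  moreover have "transverse_at H F ?G q" if qS: "q \<in> S" for q
    unfolding transverse_at_def
  proof (intro ballI allI impI)
    obtain i r where q: "q = vec.span {\<pi> (pt \<alpha> \<beta> i 1 r)}" "r ^ m = 1"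
      using qS unfolding S by auto
    fix v A B
    assume "v \<in> q - {0}" and AB: "\<forall>w\<in>H. A * dir_deriv F v w + B * dir_deriv ?G v w = 0"
    then obtain c where c: "v = \<pi> (pt \<alpha> \<beta> i c (c * r))" "v \<noteq> 0"
      unfolding q(1) vec.span_singleton by (auto simp: \<pi>_scale[symmetric] pt_scale)
    have "c \<noteq> 0" using c \<pi>_pt_nz[of i c "c * r"] by auto
    \<comment> \<open>The direction of the projected line i itself: G is constantly 0 along it,
      while F restricts to a binary form with simple zeros. This yields A = 0.\<close>
    define w where "w = \<pi> (pt \<alpha> \<beta> i 1 0)"
    have "F (v + t *s w) = cf i p * ((c + t) ^ m - (c * r) ^ m)" for t
    proof -
      have "v + t *s w = \<pi> (pt \<alpha> \<beta> i (c + t) (c * r))"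
        unfolding c w_def by (simp add: \<pi>_scale[symmetric] \<pi>_add[symmetric] pt_scale pt_add)
      then show ?thesis by (simp add: F\<pi> F(3))
    qed
    moreover have "((\<lambda>t. cf i p * ((c + t) ^ m - (c * r) ^ m)) has_field_derivative
        cf i p * (of_nat m * c ^ (m - 1))) (at 0)"
      by (auto intro!: derivative_eq_intros)
    ultimately have "dir_deriv F v w = cf i p * (of_nat m * c ^ (m - 1))"
      unfolding dir_deriv_def by (simp add: DERIV_imp_deriv)
    then have 1: "dir_deriv F v w \<noteq> 0" using d m0 \<open>c \<noteq> 0\<close> by simp
    have "ell i p (v + t *s w) = 0" for t
      unfolding ell_add c(1) w_def ell\<pi> ell_pt_same by simp
    then have "(\<lambda>t. ?G (v + t *s w)) = (\<lambda>t. 0)" by (intro ext prod_zero) auto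
    then have "dir_deriv ?G v w = 0" unfolding dir_deriv_def by simp
    moreover have "w \<in> H" unfolding w_def by (rule \<pi>H)
    ultimately have A0: "A = 0" using AB 1 by force
    obtain j where j: "j \<noteq> i" by (rule index_4_other)
    \<comment> \<open>A direction leaving line i: exactly one of the four factors of G vanishes at
      v, and it does so to first order along u. This yields B = 0.\<close>
    define u where "u = \<pi> (pt \<alpha> \<beta> j 1 0)"
    have u: "ell i p u \<noteq> 0" unfolding u_def ell\<pi> ell_pt using j d bracket_nz by auto
    define R where "R t = (\<Prod>k\<in>UNIV - {i}. ell k p v + t * ell k p u)" for t
    have "?G (v + t *s u) = t * (ell i p u * R t)" for t
    proof -
      have "?G (v + t *s u) = ell i p (v + t *s u) * (\<Prod>k\<in>UNIV - {i}. ell k p (v + t *s u))"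
        by (rule prod.remove) auto
      also have "ell i p (v + t *s u) = t * ell i p u"
        unfolding ell_add c(1) ell\<pi> ell_pt_same by simp
      finally show ?thesis by (simp add: R_def ell_add)
    qed
    moreover have "((\<lambda>t. t * (ell i p u * R t)) has_field_derivative ell i p u * R 0) (at 0)"
      \<comment> \<open>Caratheodory's criterion: the derivative at 0 of t times a continuous
        function is the value of that function at 0.\<close>
      unfolding CARAT_DERIV
    proof (intro exI[of _ "\<lambda>t. ell i p u * R t"] conjI allI)
      show "isCont (\<lambda>t. ell i p u * R t) 0" unfolding R_def by (intro continuous_intros)
    qed auto
    ultimately have "dir_deriv ?G v u = ell i p u * R 0"
      unfolding dir_deriv_def by (simp add: DERIV_imp_deriv)
    moreover have "ell k p v \<noteq> 0" if "k \<noteq> i" for k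
    proof -
      have "v = c *s \<pi> (pt \<alpha> \<beta> i 1 r)" unfolding c(1) by (simp add: \<pi>_scale[symmetric] pt_scale)
      then have "ell k p v = c * ell k p (pt \<alpha> \<beta> i 1 r)" by (simp add: ell_scale ell\<pi>)
      then show ?thesis using ell_pt_nonzero[OF p that q(2)] \<open>c \<noteq> 0\<close> by simp
    qed
    then have "R 0 \<noteq> 0" by (simp add: R_def)
    ultimately have "dir_deriv ?G v u \<noteq> 0" using u by simp
    moreover have "u \<in> H" unfolding u_def by (rule \<pi>H)
    ultimately have "B = 0" using AB A0 by force
    then show "A = 0 \<and> B = 0" using A0 by simp
  qed
  ultimately have "transverse_intersection H F ?G S" unfolding transverse_intersection_def by blast
  then show "\<exists>F. plane_curve H m F \<and> transverse_intersection H F ?G (project P H ` Z)"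
    using pcF unfolding S_def by blast
qed

end

section \<open>Standard configurations as orbits\<close>

lemma two_points_determine_line:
  assumes "proj_line L" "proj_line M" "proj_point p" "proj_point q" "p \<noteq> q"
    "p \<subseteq> L" "q \<subseteq> L" "p \<subseteq> M" "q \<subseteq> M"
  shows "L = M"
proof -
  obtain v w where vw: "v \<noteq> 0" "p = vec.span {v}" "w \<noteq> 0" "q = vec.span {w}"
    using assms proj_pointE by metis
  have "v \<notin> vec.span {w}"
  proof
    assume "v \<in> vec.span {w}"
    then obtain c where "v = c *s w" by (auto simp: vec.span_singleton)
    then show False using vw assms(5) span_sing_scale[of c w] by auto
  qed
  then have d: "vec.dim (vec.span {v, w}) = 2" using vw by (simp add: vec.dim_insert)
  have "vec.span {v, w} = X" if X: "proj_line X" "p \<subseteq> X" "q \<subseteq> X" for X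
  proof (rule vec.subspace_dim_equal)
    show "vec.subspace X" using X by (simp add: proj_line_def)
    then show "vec.span {v, w} \<subseteq> X"
      using X vw by (intro vec.span_minimal) (auto simp: span_sing_subset)
    show "vec.dim (vec.span {v, w}) \<ge> vec.dim X" using X d by (simp add: proj_line_def)
  qed simp
  then show ?thesis using assms by metis
qed

lemma point_not_in_two_skew_lines:
  assumes "skew_lines \<L>" "L \<in> \<L>" "M \<in> \<L>" "proj_point p" "p \<subseteq> L" "p \<subseteq> M"
  shows "L = M"
proof (rule ccontr)
  assume "L \<noteq> M"
  then have "L \<inter> M = {0}" using assms by (auto simp: skew_lines_def)
  then have "p \<subseteq> {0}" using assms by auto
  then show False using assms(4) by (auto simp: proj_point_def simp flip: vec.dim_eq_0)
qed

text \<open>A line outside the family shares at most one point with each member, so its points in Z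
  inject into the family.\<close>

lemma line_with_many_points:
  assumes \<L>: "skew_lines \<L>" and Z: "\<And>p. p \<in> Z \<Longrightarrow> proj_point p" "\<And>p. p \<in> Z \<Longrightarrow> \<exists>L\<in>\<L>. p \<subseteq> L"
    and M: "proj_line M" "card {p \<in> Z. p \<subseteq> M} > card \<L>"
  shows "M \<in> \<L>"
proof (rule ccontr)
  assume "M \<notin> \<L>"
  obtain f where f: "\<And>p. p \<in> Z \<Longrightarrow> f p \<in> \<L> \<and> p \<subseteq> f p" using Z(2) by metis
  have "inj_on f {p \<in> Z. p \<subseteq> M}"
  proof (rule inj_onI, rule ccontr)
    fix p q assume pq: "p \<in> {p \<in> Z. p \<subseteq> M}" "q \<in> {p \<in> Z. p \<subseteq> M}" "f p = f q" "p \<noteq> q"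
    then have "f p = M"
      using f[of p] f[of q] \<L> M Z(1)
      by (intro two_points_determine_line[of "f p" M p q]) (auto simp: skew_lines_def)
    then show False using f[of p] pq \<open>M \<notin> \<L>\<close> by auto
  qed
  moreover have "f ` {p \<in> Z. p \<subseteq> M} \<subseteq> \<L>" using f by auto
  moreover have "finite \<L>" using \<L> by (simp add: skew_lines_def)
  ultimately have "card {p \<in> Z. p \<subseteq> M} \<le> card \<L>" by (rule card_inj_on_le)
  then show False using M(2) by simp
qed

text \<open>If s^k = 1 with 0 < k < m, a Bezout relation between k and the prime m would give s =
  1.\<close>

lemma power_inj_prime:
  fixes s :: complex
  assumes "prime m" "s ^ m = 1" "s \<noteq> 1"
  shows "inj_on (\<lambda>n. s ^ n) {..<m}"
proof -
  have m0: "m > 0" using assms(1) prime_gt_0_nat by simp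
  have s0: "s \<noteq> 0" using assms(2) m0 by (auto simp: power_0_left)
  have no: "s ^ k \<noteq> 1" if "0 < k" "k < m" for k
  proof
    assume 1: "s ^ k = 1"
    have "coprime k m"
      using assms(1) that by (metis coprime_commute nat_dvd_not_less prime_imp_coprime)
    moreover have "k \<noteq> 0" using that by simp
    then obtain x y where "k * x = m * y + gcd k m" using bezout_nat by blast
    ultimately have "k * x = m * y + 1" by simp
    then have "(s ^ k) ^ x = (s ^ m) ^ y * s" by (simp flip: power_mult add: power_add)
    then show False using 1 assms by simp
  qed
  show "inj_on (\<lambda>n. s ^ n) {..<m}"
  proof (rule linorder_inj_onI')
    fix i j assume ij: "i \<in> {..<m}" "j \<in> {..<m}" "i < j"
    then have "s ^ j = s ^ i * s ^ (j - i)" by (simp flip: power_add)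
    then show "s ^ i \<noteq> s ^ j" using no[of "j - i"] ij s0 by auto
  qed
qed

text \<open>The first m powers of s are distinct, and there are only m roots in all.\<close>

lemma roots_of_unity_prime:
  fixes s :: complex
  assumes "prime m" "s ^ m = 1" "s \<noteq> 1" "r ^ m = 1"
  shows "\<exists>n<m. r = s ^ n"
proof -
  have m0: "m > 0" using assms(1) prime_gt_0_nat by simp
  have "card ((\<lambda>n. s ^ n) ` {..<m}) = card {z :: complex. z ^ m = 1}"
    using card_roots_unity_eq[of m] m0 card_image[OF power_inj_prime[OF assms(1-3)]] by simp
  moreover have "(\<lambda>n. s ^ n) ` {..<m} \<subseteq> {z. z ^ m = 1}"
  proof clarify
    fix n show "(s ^ n) ^ m = 1" using assms(2) by (metis mult.commute power_mult power_one)
  qed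
  ultimately have "(\<lambda>n. s ^ n) ` {..<m} = {z. z ^ m = 1}"
    using finite_roots_unity[of m] m0 by (intro card_subset_eq) auto
  then show ?thesis using assms(4) by blast
qed

lemma gridE:
  assumes "grid a b Z"
  obtains A B where "skew_lines A" "card A = a" "skew_lines B" "card B = b"
    "\<forall>L\<in>A. \<forall>M\<in>B. \<exists>!p. proj_point p \<and> p \<subseteq> L \<and> p \<subseteq> M"
    "Z = {p. proj_point p \<and> (\<exists>L\<in>A. p \<subseteq> L) \<and> (\<exists>M\<in>B. p \<subseteq> M)}"
proof -
  obtain A B where "skew_lines A \<and> card A = a \<and> skew_lines B \<and> card B = b \<and>
     (\<forall>L\<in>A. \<forall>M\<in>B. \<exists>!p. proj_point p \<and> p \<subseteq> L \<and> p \<subseteq> M) \<and>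
     Z = {p. proj_point p \<and> (\<exists>L\<in>A. p \<subseteq> L) \<and> (\<exists>M\<in>B. p \<subseteq> M)}"
    using assms unfolding grid_def by (elim exE)
  then show ?thesis by (intro that[of A B]) simp_all
qed

text \<open>The groupoid acts on the coordinate y / x through these quotients alone: passing from
  line i to line j along k multiplies it by
  \<open>ratio \<alpha> \<beta> i k / ratio \<alpha> \<beta> j k\<close>.\<close>

definition ratio :: "complex \<Rightarrow> complex \<Rightarrow> 4 \<Rightarrow> 4 \<Rightarrow> complex" where
  "ratio \<alpha> \<beta> i j = bracket \<beta> i j / bracket \<alpha> i j"

locale std_lines =
  fixes \<alpha> \<beta> :: complex
  assumes nondeg: "\<alpha> \<noteq> 0" "\<alpha> \<noteq> 1" "\<beta> \<noteq> 0" "\<beta> \<noteq> 1"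
begin

abbreviation "\<L> \<equiv> range (std_line \<alpha> \<beta>)"

lemma ratio_nonzero: "i \<noteq> j \<Longrightarrow> ratio \<alpha> \<beta> i j \<noteq> 0"
  using nondeg bracket_nonzero by (simp add: ratio_def)

lemma pt_in_std_line_iff:
  assumes "x \<noteq> 0 \<or> y \<noteq> 0"
  shows "pt \<alpha> \<beta> i x y \<in> std_line \<alpha> \<beta> j \<longleftrightarrow> i = j"
proof
  assume *: "pt \<alpha> \<beta> i x y \<in> std_line \<alpha> \<beta> j"
  show "i = j"
  proof (rule ccontr)
    assume "i \<noteq> j"
    then have "pt \<alpha> \<beta> i x y \<in> {0}"
      unfolding std_line_Int[OF nondeg \<open>i \<noteq> j\<close>, symmetric] using * by simp
    then show False using assms by auto
  qed
qed auto

lemma span_pt_subset_iff: "vec.span {pt \<alpha> \<beta> i 1 r} \<subseteq> std_line \<alpha> \<beta> j \<longleftrightarrow> i = j"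
  by (simp add: span_sing_subset subspace_std_line pt_in_std_line_iff)

lemma inj_std_line: "inj (std_line \<alpha> \<beta>)"
proof (rule injI)
  fix i j assume "std_line \<alpha> \<beta> i = std_line \<alpha> \<beta> j"
  then have "pt \<alpha> \<beta> i 1 1 \<in> std_line \<alpha> \<beta> j" using pt_in_std_line by metis
  then show "i = j" by (simp add: pt_in_std_line_iff)
qed

lemma skew_std_lines: "skew_lines \<L>"
  unfolding skew_lines_def
proof (intro conjI ballI impI)
  fix L M assume "L \<in> \<L>" "M \<in> \<L>" "L \<noteq> M"
  then obtain i j where "L = std_line \<alpha> \<beta> i" "M = std_line \<alpha> \<beta> j" "i \<noteq> j" by auto
  then show "L \<inter> M = {0}" using std_line_Int[OF nondeg] by simp
qed (use proj_line_std_line in auto)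

lemma card_std_lines: "card \<L> = 4"
  using card_image[OF inj_std_line] by simp

lemma transfer_map_normalized:
  assumes "i \<noteq> k" "j \<noteq> k"
  shows "transfer_map (std_line \<alpha> \<beta> k) (std_line \<alpha> \<beta> j) (vec.span {pt \<alpha> \<beta> i 1 r}) =
    vec.span {pt \<alpha> \<beta> j 1 (r * ratio \<alpha> \<beta> i k / ratio \<alpha> \<beta> j k)}"
proof -
  have nz: "bracket \<alpha> i k \<noteq> 0" "bracket \<alpha> j k \<noteq> 0" "bracket \<beta> j k \<noteq> 0"
    using bracket_nonzero nondeg assms by simp_all
  have e: "bracket \<beta> i k / bracket \<beta> j k * r / (bracket \<alpha> i k / bracket \<alpha> j k) =
      r * ratio \<alpha> \<beta> i k / ratio \<alpha> \<beta> j k"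
    using nz by (simp add: ratio_def mult_ac)
  have "bracket \<alpha> i k / bracket \<alpha> j k \<noteq> 0" using nz by simp
  then show ?thesis
    unfolding transfer_map_pt[OF nondeg assms(2)] mult_1_right e[symmetric] by (rule span_pt_normalize)
qed

lemma reaches_step:
  assumes "reaches \<L> p (std_line \<alpha> \<beta> i) (vec.span {pt \<alpha> \<beta> i 1 r})" "i \<noteq> j" "i \<noteq> k" "j \<noteq> k"
  shows "reaches \<L> p (std_line \<alpha> \<beta> j) (vec.span {pt \<alpha> \<beta> j 1 (r * ratio \<alpha> \<beta> i k / ratio \<alpha> \<beta> j k)})"
  unfolding transfer_map_normalized[OF assms(3,4), symmetric]
  using assms inj_std_line by (intro reaches.step[OF assms(1)]) (auto simp: inj_eq)

text \<open>The exponent is arbitrary on purpose: with m = 0 the condition on the ratios is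
  trivially true, which gives the shape of the orbit points before s and t are known to be roots of
  unity.\<close>

lemma reachesD:
  assumes "reaches \<L> (vec.span {pt \<alpha> \<beta> 1 1 1}) M q" and m: "\<And>i j. i \<noteq> j \<Longrightarrow> ratio \<alpha> \<beta> i j ^ m = 1"
  shows "\<exists>i r. M = std_line \<alpha> \<beta> i \<and> q = vec.span {pt \<alpha> \<beta> i 1 r} \<and> r \<noteq> 0 \<and> r ^ m = 1"
  using assms(1)
proof induction
  case (start L)
  then have "L = std_line \<alpha> \<beta> 1" using span_pt_subset_iff by auto
  then have "L = std_line \<alpha> \<beta> 1 \<and> vec.span {pt \<alpha> \<beta> 1 1 1} = vec.span {pt \<alpha> \<beta> 1 1 1} \<and>
    (1::complex) \<noteq> 0 \<and> (1::complex) ^ m = 1" by simp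
  then show ?case by blast
next
  case (step M q N K)
  then obtain i r where q: "M = std_line \<alpha> \<beta> i" "q = vec.span {pt \<alpha> \<beta> i 1 r}" "r \<noteq> 0" "r ^ m = 1"
    by blast
  obtain j k where jk: "N = std_line \<alpha> \<beta> j" "K = std_line \<alpha> \<beta> k" using step.hyps by blast
  then have ne: "i \<noteq> k" "j \<noteq> k" using step.hyps q(1) by auto
  define r' where "r' = r * ratio \<alpha> \<beta> i k / ratio \<alpha> \<beta> j k"
  have "r' \<noteq> 0" "r' ^ m = 1"
    using q(3,4) ratio_nonzero ne by (simp_all add: r'_def power_mult_distrib power_divide m)
  moreover have "transfer_map K N q = vec.span {pt \<alpha> \<beta> j 1 r'}"
    unfolding q jk r'_def by (rule transfer_map_normalized[OF ne])
  ultimately show ?case using jk(1) by blast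
qed

lemma ratio_simps:
  "ratio \<alpha> \<beta> 1 2 = 1" "ratio \<alpha> \<beta> 2 1 = 1" "ratio \<alpha> \<beta> 1 3 = 1" "ratio \<alpha> \<beta> 3 1 = 1"
  "ratio \<alpha> \<beta> 2 3 = 1" "ratio \<alpha> \<beta> 3 2 = 1" "ratio \<alpha> \<beta> 2 4 = 1" "ratio \<alpha> \<beta> 4 2 = 1"
  "ratio \<alpha> \<beta> 1 4 = \<beta> / \<alpha>" "ratio \<alpha> \<beta> 4 1 = \<beta> / \<alpha>"
  "ratio \<alpha> \<beta> 3 4 = (\<beta> - 1) / (\<alpha> - 1)" "ratio \<alpha> \<beta> 4 3 = (\<beta> - 1) / (\<alpha> - 1)"
  using nondeg by (simp_all add: ratio_def bracket_def crd0_def crd1_def divide_simps)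
    (simp_all add: algebra_simps)

lemma ratio_power:
  assumes "(\<beta> / \<alpha>) ^ m = 1" "((\<beta> - 1) / (\<alpha> - 1)) ^ m = 1" "i \<noteq> j"
  shows "ratio \<alpha> \<beta> i j ^ m = 1"
proof -
  have "ratio \<alpha> \<beta> i j \<in> {1, \<beta> / \<alpha>, (\<beta> - 1) / (\<alpha> - 1)}"
    using exhaust_4[of i] exhaust_4[of j] assms(3) by (elim disjE) (simp_all add: ratio_simps)
  then show ?thesis using assms(1,2) by (elim insertE) (simp_all only: power_one empty_iff)
qed

lemma loops:
  assumes "reaches \<L> p (std_line \<alpha> \<beta> 1) (vec.span {pt \<alpha> \<beta> 1 1 r})"
  shows "reaches \<L> p (std_line \<alpha> \<beta> 1) (vec.span {pt \<alpha> \<beta> 1 1 (r * (\<beta> / \<alpha>))})"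
    and "reaches \<L> p (std_line \<alpha> \<beta> 1)
      (vec.span {pt \<alpha> \<beta> 1 1 (r * ((\<beta> / \<alpha>) / ((\<beta> - 1) / (\<alpha> - 1))))})"
  using reaches_step[OF reaches_step[OF assms, of 2 4], of 1 3]
    reaches_step[OF reaches_step[OF assms, of 3 4], of 1 2]
  by (simp_all add: ratio_simps mult.assoc)

lemma orbit_eq_std_config:
  assumes m: "prime m" "(\<beta> / \<alpha>) ^ m = 1" "((\<beta> - 1) / (\<alpha> - 1)) ^ m = 1" and ne: "\<alpha> \<noteq> \<beta>"
  shows "groupoid_orbit \<L> (vec.span {pt \<alpha> \<beta> 1 1 1}) = std_config m \<alpha> \<beta>"
proof
  let ?p = "vec.span {pt \<alpha> \<beta> 1 1 1}"
  show "groupoid_orbit \<L> ?p \<subseteq> std_config m \<alpha> \<beta>"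
  proof
    fix q assume "q \<in> groupoid_orbit \<L> ?p"
    then obtain M where "reaches \<L> ?p M q" unfolding groupoid_orbit_eq by blast
    from reachesD[OF this ratio_power[OF m(2,3)]] show "q \<in> std_config m \<alpha> \<beta>" unfolding std_config_def by blast
  qed
  have "reaches \<L> ?p (std_line \<alpha> \<beta> 1) (vec.span {pt \<alpha> \<beta> 1 1 ((\<beta> / \<alpha>) ^ n)})" for n
  proof (induction n)
    case 0
    show ?case by (simp add: reaches.start span_pt_subset_iff)
  next
    case (Suc n)
    show ?case using loops(1)[OF Suc.IH] by (simp only: power_Suc2)
  qed
  moreover have "\<exists>n. r = (\<beta> / \<alpha>) ^ n" if "r ^ m = 1" for r
    using roots_of_unity_prime[OF m(1,2) _ that] ne nondeg by auto
  ultimately have 1: "reaches \<L> ?p (std_line \<alpha> \<beta> 1) (vec.span {pt \<alpha> \<beta> 1 1 r})" if "r ^ m = 1" for r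
    using that by metis
  have "reaches \<L> ?p (std_line \<alpha> \<beta> i) (vec.span {pt \<alpha> \<beta> i 1 r})" if "r ^ m = 1" for i r
  proof -
    have "reaches \<L> ?p (std_line \<alpha> \<beta> 2) (vec.span {pt \<alpha> \<beta> 2 1 r})"
      "reaches \<L> ?p (std_line \<alpha> \<beta> 3) (vec.span {pt \<alpha> \<beta> 3 1 r})"
      "reaches \<L> ?p (std_line \<alpha> \<beta> 4) (vec.span {pt \<alpha> \<beta> 4 1 r})"
      using reaches_step[OF 1[OF that], of 2 3] reaches_step[OF 1[OF that], of 3 2]
        reaches_step[OF 1[OF that], of 4 2] by (simp_all add: ratio_simps)
    then show ?thesis using 1[OF that] exhaust_4[of i] by (elim disjE) simp_all
  qed
  then show "std_config m \<alpha> \<beta> \<subseteq> groupoid_orbit \<L> ?p"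
    unfolding groupoid_orbit_eq std_config_def by (intro subsetI) (elim CollectE exE conjE, simp, blast)
qed

lemma std_config_on_lines:
  assumes "q \<in> std_config m \<alpha> \<beta>"
  shows "proj_point q" "\<exists>L\<in>\<L>. q \<subseteq> L"
proof -
  obtain i r where "q = vec.span {pt \<alpha> \<beta> i 1 r}" using assms unfolding std_config_def by blast
  then show "proj_point q" "\<exists>L\<in>\<L>. q \<subseteq> L"
    using span_pt_subset_iff[of i r i] proj_point_span[of "pt \<alpha> \<beta> i 1 r"] by (simp, blast)
qed

lemma card_std_config_line:
  assumes "m > 0"
  shows "card {p \<in> std_config m \<alpha> \<beta>. p \<subseteq> std_line \<alpha> \<beta> i} = m"
proof -
  have "{p \<in> std_config m \<alpha> \<beta>. p \<subseteq> std_line \<alpha> \<beta> i} = (\<lambda>r. vec.span {pt \<alpha> \<beta> i 1 r}) ` {r. r ^ m = 1}"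
    (is "?A = ?B")
  proof (intro equalityI subsetI)
    fix q assume "q \<in> ?A"
    then obtain j r where q: "q = vec.span {pt \<alpha> \<beta> j 1 r}" "r ^ m = 1" "q \<subseteq> std_line \<alpha> \<beta> i"
      unfolding std_config_def by blast
    then have "j = i" using span_pt_subset_iff by simp
    then show "q \<in> ?B" using q by blast
  next
    fix q assume "q \<in> ?B"
    then obtain r where q: "q = vec.span {pt \<alpha> \<beta> i 1 r}" "r ^ m = 1" by blast
    then have "q \<subseteq> std_line \<alpha> \<beta> i" using span_pt_subset_iff by simp
    then show "q \<in> ?A" using q unfolding std_config_def by blast
  qed
  moreover have "inj_on (\<lambda>r. vec.span {pt \<alpha> \<beta> i 1 r}) {r. r ^ m = 1}"
  proof (rule inj_onI)
    fix r s :: complex assume "r \<in> {r. r ^ m = 1}" "vec.span {pt \<alpha> \<beta> i 1 r} = vec.span {pt \<alpha> \<beta> i 1 s}"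
    moreover from this have "r \<noteq> 0" using assms by (auto simp: power_0_left)
    ultimately show "r = s" using span_pt_eq_iff by blast
  qed
  ultimately show ?thesis using card_roots_unity_eq[of m] assms by (simp add: card_image)
qed

lemma no_transversal_through_std_point:
  assumes "\<alpha> \<noteq> \<beta>" and M: "proj_line M" "pt \<alpha> \<beta> 1 1 1 \<in> M"
    and meets: "\<And>i. \<exists>p. proj_point p \<and> p \<subseteq> std_line \<alpha> \<beta> i \<and> p \<subseteq> M"
  shows False
proof -
  have sub: "vec.subspace M" using M by (simp add: proj_line_def)
  have pts: "\<exists>x y. (x \<noteq> 0 \<or> y \<noteq> 0) \<and> pt \<alpha> \<beta> i x y \<in> M" for i
  proof -
    obtain p where p: "proj_point p" "p \<subseteq> std_line \<alpha> \<beta> i" "p \<subseteq> M" using meets by blast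
    obtain v where v: "v \<noteq> 0" "p = vec.span {v}" using p(1) proj_pointE by blast
    then have "v \<in> p" by (simp add: vec.span_base)
    then obtain x y where "v = pt \<alpha> \<beta> i x y" using p by (auto simp: std_line_def)
    then show ?thesis using v(1) \<open>v \<in> p\<close> p(3) by auto
  qed
  obtain x y where xy: "x \<noteq> 0 \<or> y \<noteq> 0" "pt \<alpha> \<beta> 2 x y \<in> M" using pts by blast
  have "pt \<alpha> \<beta> 2 x y \<notin> vec.span {pt \<alpha> \<beta> 1 1 1}"
    using xy(1) by (auto simp: vec.span_singleton pt_scale vec_eq_iff forall_4 crd0_def crd1_def)
  then have "vec.dim (vec.span {pt \<alpha> \<beta> 2 x y, pt \<alpha> \<beta> 1 1 1}) = 2"
    by (simp add: vec.dim_insert)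
  then have sp: "vec.span {pt \<alpha> \<beta> 2 x y, pt \<alpha> \<beta> 1 1 1} = M"
    using M sub xy by (intro vec.subspace_dim_equal vec.span_minimal) (auto simp: proj_line_def)
  have lin: "\<exists>c d. v = c *s pt \<alpha> \<beta> 1 1 1 + d *s pt \<alpha> \<beta> 2 x y" if v: "v \<in> M" for v
  proof -
    obtain d where "v - d *s pt \<alpha> \<beta> 2 x y \<in> vec.span {pt \<alpha> \<beta> 1 1 1}"
      using v unfolding sp[symmetric] vec.span_breakdown_eq[of v] by (elim exE)
    then obtain c where "v - d *s pt \<alpha> \<beta> 2 x y = c *s pt \<alpha> \<beta> 1 1 1"
      unfolding vec.span_singleton by blast
    then have "v = c *s pt \<alpha> \<beta> 1 1 1 + d *s pt \<alpha> \<beta> 2 x y" by (simp only: diff_eq_eq)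
    then show ?thesis by blast
  qed
  obtain x3 y3 where 3: "x3 \<noteq> 0 \<or> y3 \<noteq> 0" "pt \<alpha> \<beta> 3 x3 y3 \<in> M" using pts by blast
  obtain x4 y4 where 4: "x4 \<noteq> 0 \<or> y4 \<noteq> 0" "pt \<alpha> \<beta> 4 x4 y4 \<in> M" using pts by blast
  have "x = y" "x \<noteq> 0"
    using lin[OF 3(2)] 3(1) by (auto simp: vec_eq_iff forall_4 crd0_def crd1_def)
  then obtain d where "\<alpha> * x4 = d * y" "\<beta> * x4 = d * y" "x4 \<noteq> 0"
    using lin[OF 4(2)] 4(1) by (auto simp: vec_eq_iff forall_4 crd0_def crd1_def)
  then show False using assms(1) by (metis mult_right_cancel)
qed

lemma std_point_in_config: "vec.span {pt \<alpha> \<beta> i 1 1} \<in> std_config m \<alpha> \<beta>"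
proof -
  have "(1::complex) ^ m = 1" by simp
  then show ?thesis unfolding std_config_def by blast
qed

text \<open>Each line of A carries d > 4 points, so it is one of the standard lines. All four of
  these must occur in A to cover the configuration, and then a line of B through the base point is a
  common transversal.\<close>

lemma not_grid_aux:
  assumes "\<alpha> \<noteq> \<beta>" "m > 0" "grid c d (std_config m \<alpha> \<beta>)" "d > 4"
  shows False
proof -
  let ?Z = "std_config m \<alpha> \<beta>"
  obtain A B where AB: "skew_lines A" "card A = c" "skew_lines B" "card B = d"
    "\<forall>L\<in>A. \<forall>M\<in>B. \<exists>!p. proj_point p \<and> p \<subseteq> L \<and> p \<subseteq> M"
    and Z: "?Z = {p. proj_point p \<and> (\<exists>L\<in>A. p \<subseteq> L) \<and> (\<exists>M\<in>B. p \<subseteq> M)}"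
    by (rule gridE[OF assms(3)])
  note meet = AB(5)[rule_format]
  have finZ: "finite ?Z" using card_std_config assms nondeg by blast
  have "L \<in> \<L>" if L: "L \<in> A" for L
  proof (rule line_with_many_points[OF skew_std_lines])
    obtain f where f: "\<And>M. M \<in> B \<Longrightarrow> proj_point (f M) \<and> f M \<subseteq> L \<and> f M \<subseteq> M"
      using meet[OF L] by metis
    have "inj_on f B"
    proof (rule inj_onI)
      fix M N assume "M \<in> B" "N \<in> B" "f M = f N"
      then show "M = N" using f[of M] f[of N] by (intro point_not_in_two_skew_lines[OF AB(3), of M N "f M"]) auto
    qed
    moreover have "f ` B \<subseteq> {p \<in> ?Z. p \<subseteq> L}"
    proof (rule image_subsetI)
      fix M assume "M \<in> B"
      then show "f M \<in> {p \<in> ?Z. p \<subseteq> L}" using f[of M] L unfolding Z by blast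
    qed
    moreover have "finite {p \<in> ?Z. p \<subseteq> L}" using finZ by simp
    ultimately have "d \<le> card {p \<in> ?Z. p \<subseteq> L}"
      unfolding AB(4)[symmetric] by (rule card_inj_on_le)
    then show "card {p \<in> ?Z. p \<subseteq> L} > card \<L>" using assms(4) card_std_lines by simp
    show "proj_line L" using AB(1) L by (simp add: skew_lines_def)
  qed (use std_config_on_lines in auto)
  then have "A \<subseteq> \<L>" by blast
  have AL: "std_line \<alpha> \<beta> i \<in> A" for i
  proof -
    have "vec.span {pt \<alpha> \<beta> i 1 1} \<in> ?Z" by (rule std_point_in_config)
    then obtain L where L: "L \<in> A" "vec.span {pt \<alpha> \<beta> i 1 1} \<subseteq> L" unfolding Z by blast
    then obtain j where "L = std_line \<alpha> \<beta> j" using \<open>A \<subseteq> \<L>\<close> by blast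
    then show ?thesis using L span_pt_subset_iff by auto
  qed
  have "vec.span {pt \<alpha> \<beta> 1 1 1} \<in> ?Z" by (rule std_point_in_config)
  then obtain M where M: "M \<in> B" "vec.span {pt \<alpha> \<beta> 1 1 1} \<subseteq> M" unfolding Z by blast
  have "proj_line M" using AB(3) M by (simp add: skew_lines_def)
  moreover have "pt \<alpha> \<beta> 1 1 1 \<in> M" using M(2) by (meson in_mono insertI1 vec.span_superset)
  moreover have "\<exists>p. proj_point p \<and> p \<subseteq> std_line \<alpha> \<beta> i \<and> p \<subseteq> M" for i
    using meet[OF AL M(1)] by blast
  ultimately show False using no_transversal_through_std_point[OF assms(1)] by blast
qed

lemma std_config_not_grid:
  assumes "\<alpha> \<noteq> \<beta>" "m \<ge> 5"
  shows "\<not> grid c d (std_config m \<alpha> \<beta>)"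
proof
  assume g: "grid c d (std_config m \<alpha> \<beta>)"
  obtain A B where AB: "skew_lines A" "card A = c" "skew_lines B" "card B = d"
    "\<forall>L\<in>A. \<forall>M\<in>B. \<exists>!p. proj_point p \<and> p \<subseteq> L \<and> p \<subseteq> M"
    and Z: "std_config m \<alpha> \<beta> = {p. proj_point p \<and> (\<exists>L\<in>A. p \<subseteq> L) \<and> (\<exists>M\<in>B. p \<subseteq> M)}"
    by (rule gridE[OF g])
  note meet = AB(5)[rule_format]
  \<comment> \<open>The two families play symmetric roles, so both have at most four lines. That
    allows at most 16 points, fewer than 4 m.\<close>
  have "grid d c (std_config m \<alpha> \<beta>)"
    unfolding grid_def
  proof (rule exI[of _ B], rule exI[of _ A], intro conjI ballI)
    show "\<exists>!p. proj_point p \<and> p \<subseteq> L \<and> p \<subseteq> M" if "L \<in> B" "M \<in> A" for L M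
      using meet[OF that(2,1)] by (simp only: conj_commute)
    show "std_config m \<alpha> \<beta> = {p. proj_point p \<and> (\<exists>L\<in>B. p \<subseteq> L) \<and> (\<exists>M\<in>A. p \<subseteq> M)}"
      unfolding Z by (simp only: conj_commute)
  qed (use AB in auto)
  then have "\<not> d > 4" "\<not> c > 4"
    using not_grid_aux[OF assms(1)] g assms(2) by (meson less_le_trans zero_less_numeral)+
  then have "c \<le> 4" "d \<le> 4" by simp_all
  have fin: "finite A" "finite B" using AB by (auto simp: skew_lines_def)
  let ?f = "\<lambda>(L, M). THE p. proj_point p \<and> p \<subseteq> L \<and> p \<subseteq> M"
  have "std_config m \<alpha> \<beta> \<subseteq> ?f ` (A \<times> B)"
  proof
    fix p assume "p \<in> std_config m \<alpha> \<beta>"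
    then obtain L M where LM: "proj_point p" "L \<in> A" "M \<in> B" "p \<subseteq> L" "p \<subseteq> M" unfolding Z by blast
    then have "?f (L, M) = p" using the1_equality[OF meet[OF LM(2,3)], of p] by simp
    then show "p \<in> ?f ` (A \<times> B)" using LM by blast
  qed
  then have "card (std_config m \<alpha> \<beta>) \<le> card (A \<times> B)"
    using fin by (intro surj_card_le) simp_all
  moreover have "card (std_config m \<alpha> \<beta>) = m * 4"
    using card_std_config(1)[OF _ nondeg, of m] assms(2) by simp
  ultimately have "m * 4 \<le> card (A \<times> B)" by simp
  also have "\<dots> = c * d" using AB by (simp add: card_cartesian_product)
  also have "\<dots> \<le> 4 * 4" using \<open>c \<le> 4\<close> \<open>d \<le> 4\<close> by (intro mult_le_mono)
  finally show False using assms(2) by simp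
qed

end

section \<open>Finite orbits of four skew lines\<close>

lemma skew_decomposition:
  assumes "proj_line K" "proj_line N" "K \<inter> N = {0}"
  obtains k n where "k \<in> K" "n \<in> N" "v = k + n"
proof -
  have sub: "vec.subspace K" "vec.subspace N" using assms by (auto simp: proj_line_def)
  let ?S = "{x + y |x y. x \<in> K \<and> y \<in> N}"
  have "vec.dim ?S + vec.dim (K \<inter> N) = vec.dim K + vec.dim N"
    by (rule vec.dim_sums_Int[OF sub])
  then have "vec.dim ?S = 4" using assms by (simp add: proj_line_def)
  moreover have "vec.dim (UNIV :: (complex^4) set) = 4"
    using vec_dim_card[where 'a = complex and 'n = 4] by (simp del: vec.dim_UNIV)
  ultimately have "?S = UNIV"
    by (intro vec.subspace_dim_equal vec.subspace_sums sub) auto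
  then have "v \<in> ?S" by simp
  then show ?thesis using that by blast
qed

lemma groupoid_orbit_image:
  fixes T :: "complex^4^4"
  assumes "invertible T"
  shows "groupoid_orbit ((`) ((*v) T) ` \<L>) ((*v) T ` p) = (`) ((*v) T) ` groupoid_orbit \<L> p"
proof
  show "(`) ((*v) T) ` groupoid_orbit \<L> p \<subseteq> groupoid_orbit ((`) ((*v) T) ` \<L>) ((*v) T ` p)"
    unfolding groupoid_orbit_eq
  proof (rule image_subsetI)
    fix q assume "q \<in> {q. \<exists>M. reaches \<L> p M q}"
    then obtain M where "reaches \<L> p M q" by blast
    from reaches_image[OF assms this]
    show "(*v) T ` q \<in> {q. \<exists>M. reaches ((`) ((*v) T) ` \<L>) ((*v) T ` p) M q}" by blast
  qed
  obtain S where S: "S ** T = mat 1" "T ** S = mat 1" using assms unfolding invertible_def by auto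
  then have "invertible S" unfolding invertible_def by auto
  have ST: "(*v) S ` (*v) T ` X = X" and TS: "(*v) T ` (*v) S ` X = X" for X
    using S by (simp_all add: image_image matrix_vector_mul_assoc)
  have STL: "(`) ((*v) S) ` (`) ((*v) T) ` \<L> = \<L>" by (simp add: image_image[of "(`) ((*v) S)"] ST)
  show "groupoid_orbit ((`) ((*v) T) ` \<L>) ((*v) T ` p) \<subseteq> (`) ((*v) T) ` groupoid_orbit \<L> p"
  proof
    fix q assume "q \<in> groupoid_orbit ((`) ((*v) T) ` \<L>) ((*v) T ` p)"
    then obtain M where "reaches ((`) ((*v) T) ` \<L>) ((*v) T ` p) M q"
      unfolding groupoid_orbit_eq by blast
    from reaches_image[OF \<open>invertible S\<close> this]
    have "reaches \<L> p ((*v) S ` M) ((*v) S ` q)" unfolding STL ST .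
    then have "(*v) S ` q \<in> groupoid_orbit \<L> p" unfolding groupoid_orbit_eq by blast
    then have "(*v) T ` (*v) S ` q \<in> (`) ((*v) T) ` groupoid_orbit \<L> p" by (rule imageI)
    then show "q \<in> (`) ((*v) T) ` groupoid_orbit \<L> p" unfolding TS .
  qed
qed

text \<open>Multiplication by g permutes R; compare the product of all elements before and
  after.\<close>

lemma closed_under_mult_imp_root_of_unity:
  fixes R :: "complex set"
  assumes "finite R" "0 \<notin> R" "\<And>r. r \<in> R \<Longrightarrow> r * g \<in> R" "g \<noteq> 0"
  shows "g ^ card R = 1"
proof -
  have inj: "inj_on (\<lambda>r. r * g) R" using assms(4) by (auto intro: inj_onI)
  then have "(\<lambda>r. r * g) ` R = R" using assms by (intro endo_inj_surj) auto
  then have "(\<Prod>r\<in>R. r) = (\<Prod>r\<in>R. r * g)"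
    using prod.reindex[OF inj, of "\<lambda>r. r"] by simp
  also have "\<dots> = (\<Prod>r\<in>R. r) * g ^ card R" by (simp add: prod.distrib)
  finally show ?thesis using assms(1,2) by auto
qed

locale skew_quadruple =
  fixes N :: "4 \<Rightarrow> subsp"
  assumes line: "proj_line (N i)" and skew: "i \<noteq> j \<Longrightarrow> N i \<inter> N j = {0}"
begin

lemma sub: "vec.subspace (N i)"
  using line by (simp add: proj_line_def)

lemma in_two: "v \<in> N i \<Longrightarrow> v \<in> N j \<Longrightarrow> i \<noteq> j \<Longrightarrow> v = 0"
  using skew[of i j] by blast

lemma N_eq_iff: "N i = N j \<longleftrightarrow> i = j"
proof
  assume e: "N i = N j"
  show "i = j"
  proof (rule ccontr)
    assume "i \<noteq> j"
    then have "N i = {0}" using skew[of i j] e by simp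
    then show False using line[of i] by (simp add: proj_line_def)
  qed
qed simp

lemma mem_add: "u \<in> N i \<Longrightarrow> v \<in> N i \<Longrightarrow> u + v \<in> N i"
  using sub by (rule vec.subspace_add)
lemma mem_scale: "u \<in> N i \<Longrightarrow> c *s u \<in> N i"
  using sub by (rule vec.subspace_scale)
lemma mem_diff: "u \<in> N i \<Longrightarrow> v \<in> N i \<Longrightarrow> u - v \<in> N i"
  using sub by (rule vec.subspace_diff)

lemmas mem = mem_add mem_scale mem_diff

text \<open>With v running through a third line, this exhibits N j as a graph over that line with
  values in N i.\<close>

lemma graph:
  assumes "i \<noteq> j" obtains w where "w \<in> N i" "v + w \<in> N j"
proof -
  obtain k n where kn: "k \<in> N i" "n \<in> N j" "v = k + n"
    using skew_decomposition[OF line line skew[OF assms]] .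
  have "- k \<in> N i" using kn(1) sub by (simp add: vec.subspace_neg)
  moreover have "v + - k \<in> N j" using kn by simp
  ultimately show ?thesis using that by blast
qed

lemma reaches_decomposed:
  assumes "reaches (range N) p (N i) (vec.span {n + k})" "n \<in> N j" "k \<in> N l" "i \<noteq> j" "i \<noteq> l" "j \<noteq> l"
  shows "reaches (range N) p (N j) (vec.span {n})"
proof -
  have "transfer_map (N l) (N j) (vec.span {n + k}) = vec.span {n}"
    using assms skew[of l j] by (intro transfer_map_span sub) auto
  moreover have "reaches (range N) p (N j) (transfer_map (N l) (N j) (vec.span {n + k}))"
    using assms by (intro reaches.step[OF assms(1)]) (auto simp: N_eq_iff)
  ultimately show ?thesis by simp
qed

text \<open>By the hypotheses, the span of \<open>u\<close> and \<open>w\<close> is a common transversal of the four lines.\<close>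

lemma orbit_of_transversal_point:
  assumes u: "u \<in> N 1" "u \<noteq> 0" and w: "w \<in> N 2" and uw: "u + w \<in> N 3" "u + c *s w \<in> N 4"
  shows "{q \<in> groupoid_orbit (range N) (vec.span {u}). q \<subseteq> N 1} \<subseteq> {vec.span {u}}"
proof -
  \<comment> \<open>A vector on the intersection of the transversal with N i. The plane through
    \<open>v i\<close> and N k contains the whole transversal, so the transfer to N j leads to
    \<open>v j\<close>.\<close>
  define v where "v i = crd0 i *s u + crd1 c i *s w" for i
  have w0: "w \<noteq> 0" using uw(1) u in_two[of u 1 3] by auto
  have indep: "a = 0 \<and> b = 0" if "a *s u + b *s w = 0" for a b
  proof -
    have "a *s u = (- b) *s w" using that by (simp add: eq_neg_iff_add_eq_0 vec.scale_minus_left)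
    then have "a *s u \<in> N 2" using mem_scale[OF w, of "- b"] by simp
    then have "a *s u = 0" using mem_scale[OF u(1)] by (intro in_two[of "a *s u" 1 2]) simp_all
    then show ?thesis using that u(2) w0 by simp
  qed
  have c: "c \<noteq> 0" "c \<noteq> 1"
  proof -
    show "c \<noteq> 0" using uw(2) u in_two[of u 1 4] by auto
    show "c \<noteq> 1"
    proof
      assume "c = 1"
      then have "1 *s u + 1 *s w = 0" using uw in_two[of "u + w" 3 4] by simp
      then show False using indep[of 1 1] by simp
    qed
  qed
  have vN: "v i \<in> N i" for i
    using exhaust_4[of i] u w uw mem_scale[OF w] by (elim disjE) (simp_all add: v_def crd0_def crd1_def)
  have v0: "v i \<noteq> 0" for i
    using indep[of "crd0 i" "crd1 c i"] crd_nonzero[of i c] by (auto simp: v_def)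
  have cramer: "v i = (bracket c i k / bracket c j k) *s v j + (bracket c i j / bracket c k j) *s v k"
    if "j \<noteq> k" for i j k
  proof -
    have nz: "bracket c j k \<noteq> 0" "bracket c k j = - bracket c j k"
      using bracket_nonzero[OF c that] bracket_antisym[of c k j] by simp_all
    have "bracket c j k * crd0 i = bracket c i k * crd0 j - bracket c i j * crd0 k"
      "bracket c j k * crd1 c i = bracket c i k * crd1 c j - bracket c i j * crd1 c k"
      by (simp_all add: bracket_def algebra_simps)
    then have "crd0 i = bracket c i k / bracket c j k * crd0 j + bracket c i j / bracket c k j * crd0 k"
      "crd1 c i = bracket c i k / bracket c j k * crd1 c j + bracket c i j / bracket c k j * crd1 c k"
      unfolding nz(2) using nz(1) by (simp_all add: divide_simps mult.commute)
    then have "v i = (bracket c i k / bracket c j k * crd0 j + bracket c i j / bracket c k j * crd0 k) *s u +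
      (bracket c i k / bracket c j k * crd1 c j + bracket c i j / bracket c k j * crd1 c k) *s w"
      unfolding v_def by (simp only:)
    then show ?thesis by (simp add: v_def vec_eq_iff algebra_simps)
  qed
  have r: "\<exists>i. M = N i \<and> q = vec.span {v i}" if "reaches (range N) (vec.span {u}) M q" for M q
    using that
  proof induction
    case (start L)
    then obtain i where i: "L = N i" by blast
    then have "u \<in> N i" using start(2) by (meson insertI1 subsetD vec.span_superset)
    then have "i = 1" using in_two[OF u(1)] u(2) by blast
    moreover have "v 1 = u" by (simp add: v_def crd0_def crd1_def)
    ultimately show ?case using i by blast
  next
    case (step M q N' K)
    then obtain i where i: "M = N i" "q = vec.span {v i}" by blast
    obtain j k where jk: "N' = N j" "K = N k" using step.hyps by blast
    have ne: "i \<noteq> j" "i \<noteq> k" "j \<noteq> k" using step.hyps i jk by (auto simp: N_eq_iff)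
    have nz: "bracket c i k / bracket c j k \<noteq> 0" using bracket_nonzero c ne by simp
    have "transfer_map (N k) (N j) (vec.span {v i}) = vec.span {(bracket c i k / bracket c j k) *s v j}"
      unfolding cramer[OF ne(3), of i]
      using ne(3) skew[of k j] by (intro transfer_map_span sub mem_scale vN) auto
    also have "\<dots> = vec.span {v j}" by (rule span_sing_scale[OF nz])
    finally show ?case unfolding i jk by blast
  qed
  show ?thesis
  proof
    fix q assume q: "q \<in> {q \<in> groupoid_orbit (range N) (vec.span {u}). q \<subseteq> N 1}"
    then obtain i where i: "q = vec.span {v i}" using r unfolding groupoid_orbit_eq by blast
    then have "v i \<in> N 1" using q by (simp add: span_sing_subset[OF sub])
    then have "i = 1" using in_two[OF vN[of i]] v0 by blast
    then show "q \<in> {vec.span {u}}" unfolding i by (simp add: v_def crd0_def crd1_def)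
  qed
qed

text \<open>The case of a double eigenvalue: the loop from the first to the second line and back acts on
  the first line as a translation by \<open>1 / \<alpha>\<close>.\<close>

lemma orbit_of_unipotent_infinite:
  assumes e: "e1 \<in> N 1" "e2 \<in> N 1" "e2 \<noteq> 0" "e1 \<notin> vec.span {e2}" and f: "f1 \<in> N 2" "f2 \<in> N 2"
    and 3: "e1 + f1 \<in> N 3" "e2 + f2 \<in> N 3"
    and 4: "e1 + \<alpha> *s f1 + f2 \<in> N 4" "e2 + \<alpha> *s f2 \<in> N 4"
  shows "infinite (groupoid_orbit (range N) (vec.span {e1}))"
proof -
  have \<alpha>: "\<alpha> \<noteq> 0" using 4(2) e(2,3) in_two[of e2 1 4] by auto
  have reach: "reaches (range N) (vec.span {e1}) (N 1) (vec.span {e1 + (of_nat n / \<alpha>) *s e2})" for n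
  proof (induction n)
    case 0
    show ?case using e(1) by (simp add: reaches.start span_sing_subset[OF sub])
  next
    case (Suc n)
    define \<kappa> where "\<kappa> = of_nat n / \<alpha>"
    \<comment> \<open>One turn of the loop: \<open>f\<close> is the component in N 2 of the current
      vector along N 4, and \<open>e'\<close> is the component of \<open>f\<close> in N 1 along N
      3.\<close>
    define f where "f = (-1) *s (\<alpha> *s f1 + (1 + \<kappa> * \<alpha>) *s f2)"
    define g where "g = (e1 + \<alpha> *s f1 + f2) + \<kappa> *s (e2 + \<alpha> *s f2)"
    define e' where "e' = \<alpha> *s e1 + (1 + \<kappa> * \<alpha>) *s e2"
    define d where "d = (-1) *s (\<alpha> *s (e1 + f1) + (1 + \<kappa> * \<alpha>) *s (e2 + f2))"
    have N: "f \<in> N 2" "g \<in> N 4" "e' \<in> N 1" "d \<in> N 3"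
      unfolding f_def g_def e'_def d_def by (intro mem e f 3 4)+
    have "e1 + \<kappa> *s e2 = f + g" by (simp add: f_def g_def vec_eq_iff algebra_simps)
    then have "reaches (range N) (vec.span {e1}) (N 1) (vec.span {f + g})"
      using Suc.IH by (simp add: \<kappa>_def)
    then have "reaches (range N) (vec.span {e1}) (N 2) (vec.span {f})"
      using N(1,2) by (rule reaches_decomposed) simp_all
    moreover have "f = e' + d" by (simp add: f_def e'_def d_def vec_eq_iff algebra_simps)
    ultimately have "reaches (range N) (vec.span {e1}) (N 2) (vec.span {e' + d})" by simp
    then have 1: "reaches (range N) (vec.span {e1}) (N 1) (vec.span {e'})"
      using N(3,4) by (rule reaches_decomposed) simp_all
    have "e' = \<alpha> *s (e1 + (of_nat (Suc n) / \<alpha>) *s e2)"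
      using \<alpha> by (simp add: e'_def \<kappa>_def vec_eq_iff field_simps)
    then have "vec.span {e'} = vec.span {e1 + (of_nat (Suc n) / \<alpha>) *s e2}"
      by (simp only: span_sing_scale[OF \<alpha>])
    then show ?case using 1 by simp
  qed
  let ?f = "\<lambda>n :: nat. vec.span {e1 + (of_nat n / \<alpha>) *s e2}"
  have "inj ?f"
  proof (rule injI)
    fix n k assume "?f n = ?f k"
    then obtain c where c: "e1 + (of_nat n / \<alpha>) *s e2 = c *s (e1 + (of_nat k / \<alpha>) *s e2)"
      by (rule span_sing_eqE)
    have "(1 - c) *s e1 - ((c * of_nat k - of_nat n) / \<alpha>) *s e2 =
        (e1 + (of_nat n / \<alpha>) *s e2) - c *s (e1 + (of_nat k / \<alpha>) *s e2)"
      by (simp add: vec_eq_iff algebra_simps diff_divide_distrib)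
    also have "\<dots> = 0" unfolding c by simp
    finally have eq: "(1 - c) *s e1 = ((c * of_nat k - of_nat n) / \<alpha>) *s e2" by simp
    have "c = 1"
    proof (rule ccontr)
      assume "c \<noteq> 1"
      then have "1 / (1 - c) * (1 - c) = 1" by simp
      then have "e1 = (1 / (1 - c)) *s ((1 - c) *s e1)" by (simp only: vec.scale_scale vec.scale_one)
      also have "\<dots> = ((1 / (1 - c)) * ((c * of_nat k - of_nat n) / \<alpha>)) *s e2" unfolding eq by (simp only: vec.scale_scale)
      finally show False using e(4) unfolding vec.span_singleton by blast
    qed
    then show "n = k" using eq e(3) \<alpha> by simp
  qed
  then have "infinite (range ?f)" by (rule range_inj_infinite)
  moreover have "range ?f \<subseteq> groupoid_orbit (range N) (vec.span {e1})"
    unfolding groupoid_orbit_eq using reach by blast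
  ultimately show ?thesis using infinite_super by blast
qed

text \<open>N 3 identifies N 1 with N 2, and N 4 is then the graph of a map that is diagonal in the
  basis \<open>e1\<close>, \<open>e2\<close>. An eigenvalue 0 or 1 would make N 4 meet N 1 or N 3.
  The columns of the matrix follow the order of the coordinates of \<open>pt\<close>.\<close>

lemma diagonal_form:
  assumes e: "e1 \<in> N 1" "e2 \<in> N 1" and f: "f1 \<in> N 2" "f2 \<in> N 2"
    and 3: "e1 + f1 \<in> N 3" "e2 + f2 \<in> N 3" and 4: "e1 + \<alpha> *s f1 \<in> N 4" "e2 + \<beta> *s f2 \<in> N 4"
    and indep: "\<And>a b. a *s e1 + b *s e2 = 0 \<Longrightarrow> a = 0 \<and> b = 0"
  shows "std_lines \<alpha> \<beta>"
    and "\<exists>T. invertible T \<and> (\<forall>i. (*v) T ` std_line \<alpha> \<beta> i = N i) \<and> T *v pt \<alpha> \<beta> 1 1 1 = e1 + e2"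
proof -
  have e0: "e1 \<noteq> 0" "e2 \<noteq> 0" using indep[of 1 0] indep[of 0 1] by auto
  have indepf: "a = 0 \<and> b = 0" if "a *s f1 + b *s f2 = 0" for a b
  proof -
    have "a *s (e1 + f1) + b *s (e2 + f2) = (a *s e1 + b *s e2) + (a *s f1 + b *s f2)"
      by (simp add: vec_eq_iff algebra_simps)
    also have "\<dots> = a *s e1 + b *s e2" unfolding that by simp
    finally have eq: "a *s (e1 + f1) + b *s (e2 + f2) = a *s e1 + b *s e2" .
    have "a *s (e1 + f1) + b *s (e2 + f2) \<in> N 3" by (intro mem 3)
    moreover have "a *s e1 + b *s e2 \<in> N 1" by (intro mem e)
    ultimately have "a *s e1 + b *s e2 = 0"
      unfolding eq by (intro in_two[of "a *s e1 + b *s e2" 3 1]) simp_all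
    then show ?thesis by (rule indep)
  qed
  have no0: "z \<noteq> 0" if "x \<in> N 1" "x + z *s y \<in> N 4" "x \<noteq> 0" for x y z
    using in_two[of x 1 4] that by auto
  have no1: "z \<noteq> 1" if "x \<in> N 1" "y \<in> N 2" "x + y \<in> N 3" "x + z *s y \<in> N 4" "x \<noteq> 0" for x y z
  proof
    assume "z = 1"
    then have "x + y = 0" using in_two[of "x + y" 3 4] that by simp
    then have "y = (-1) *s x" by (simp add: eq_neg_iff_add_eq_0 add.commute)
    then have "y \<in> N 1" using mem_scale[OF that(1), of "-1"] by simp
    then have "y = 0" using in_two[of y 1 2] that(2) by simp
    then show False using \<open>x + y = 0\<close> that(5) by simp
  qed
  show "std_lines \<alpha> \<beta>"
    by unfold_locales (use no0[OF e(1) 4(1) e0(1)] no0[OF e(2) 4(2) e0(2)]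
      no1[OF e(1) f(1) 3(1) 4(1) e0(1)] no1[OF e(2) f(2) 3(2) 4(2) e0(2)] in auto)
  define T :: "complex^4^4" where "T = (\<chi> r c. if c = 1 then e1 $ r else if c = 2 then f1 $ r
      else if c = 3 then e2 $ r else f2 $ r)"
  have T: "T *v v = v $ 1 *s e1 + v $ 2 *s f1 + v $ 3 *s e2 + v $ 4 *s f2" for v
    by (simp add: T_def vec_eq_iff matrix_vector_mult_def sum_4 mult.commute)
  have "v = 0" if Tv: "T *v v = 0" for v
  proof -
    define x where "x = v $ 1 *s e1 + v $ 3 *s e2"
    define y where "y = v $ 2 *s f1 + v $ 4 *s f2"
    have xy: "x \<in> N 1" "y \<in> N 2" unfolding x_def y_def by (intro mem e f)+
    have "x + y = 0" using Tv unfolding T x_def y_def by (simp add: add_ac)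
    then have "x = (-1) *s y" by (simp add: eq_neg_iff_add_eq_0)
    then have "x \<in> N 2" using mem_scale[OF xy(2), of "-1"] by simp
    then have "x = 0" using in_two[of x 1 2] xy by simp
    then have "y = 0" using \<open>x + y = 0\<close> by simp
    show "v = 0"
      using indep[OF \<open>x = 0\<close>[unfolded x_def]] indepf[OF \<open>y = 0\<close>[unfolded y_def]]
      by (simp add: vec_eq_iff forall_4)
  qed
  then have inv: "invertible T"
    by (metis invertible_left_inverse matrix_left_invertible_ker)
  have img: "(*v) T ` std_line \<alpha> \<beta> i = N i" for i
  proof (rule vec.subspace_dim_equal)
    show "vec.subspace ((*v) T ` std_line \<alpha> \<beta> i)" by (intro vec.subspace_image subspace_std_line)
    show "(*v) T ` std_line \<alpha> \<beta> i \<subseteq> N i"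
    proof (rule image_subsetI)
      fix v assume "v \<in> std_line \<alpha> \<beta> i"
      then obtain x y where v: "v = pt \<alpha> \<beta> i x y" unfolding std_line_def by blast
      have "T *v v = x *s (crd0 i *s e1 + crd1 \<alpha> i *s f1) + y *s (crd0 i *s e2 + crd1 \<beta> i *s f2)"
        unfolding T v by (simp add: vec_eq_iff algebra_simps)
      moreover have "crd0 i *s e1 + crd1 \<alpha> i *s f1 \<in> N i" "crd0 i *s e2 + crd1 \<beta> i *s f2 \<in> N i"
        using exhaust_4[of i] e f 3 4 by (elim disjE; simp add: crd0_def crd1_def)+
      ultimately show "T *v v \<in> N i" by (simp only: mem)
    qed
    have "vec.dim ((*v) T ` std_line \<alpha> \<beta> i) = vec.dim (std_line \<alpha> \<beta> i)"
      using inj_matrix_vector_mult[OF inv]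
      by (intro vec.dim_image_eq) (auto intro: inj_on_subset)
    then show "vec.dim (N i) \<le> vec.dim ((*v) T ` std_line \<alpha> \<beta> i)"
      using line[of i] proj_line_std_line[of \<alpha> \<beta> i] by (simp add: proj_line_def)
  qed (rule sub)
  have "T *v pt \<alpha> \<beta> 1 1 1 = e1 + e2" unfolding T by (simp add: crd0_def crd1_def)
  then show "\<exists>T. invertible T \<and> (\<forall>i. (*v) T ` std_line \<alpha> \<beta> i = N i) \<and> T *v pt \<alpha> \<beta> 1 1 1 = e1 + e2"
    using inv img by blast
qed

text \<open>Identify N 1 with N 2 through N 3, and let A be the map whose graph is N 4. Then
  \<open>w1\<close>, \<open>w2\<close>, \<open>w3\<close> stand for u, A u and A^2 u, and
  \<open>u2\<close> is A u read in N 1. Since u turns out to be a cyclic vector, the relation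
  between these three gives the characteristic equation of A.\<close>

lemma orbit_classification:
  assumes u: "u \<in> N 1" "u \<noteq> 0" and fin: "finite (groupoid_orbit (range N) (vec.span {u}))"
    and card: "card {q \<in> groupoid_orbit (range N) (vec.span {u}). q \<subseteq> N 1} = m" "m > 1"
  shows "\<exists>\<alpha> \<beta> T. std_lines \<alpha> \<beta> \<and> \<alpha> \<noteq> \<beta> \<and> (\<beta> / \<alpha>) ^ m = 1 \<and> ((\<beta> - 1) / (\<alpha> - 1)) ^ m = 1 \<and>
    invertible T \<and> groupoid_orbit (range N) (vec.span {u}) =
      (`) ((*v) T) ` groupoid_orbit (range (std_line \<alpha> \<beta>)) (vec.span {pt \<alpha> \<beta> 1 1 1})"
proof -
  obtain w1 where w1: "w1 \<in> N 2" "u + w1 \<in> N 3" using graph[of 2 3 u] by auto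
  obtain w2 where w2: "w2 \<in> N 2" "u + w2 \<in> N 4" using graph[of 2 4 u] by auto
  obtain u2 where u2: "u2 \<in> N 1" "w2 + u2 \<in> N 3" using graph[of 1 3 w2] by auto
  \<comment> \<open>Otherwise u would be an eigenvector of A and lie on a transversal, so that its
    orbit has only one point on N 1.\<close>
  have not_dep: "u2 \<notin> vec.span {u}"
  proof
    assume "u2 \<in> vec.span {u}"
    then obtain c where c: "u2 = c *s u" by (auto simp: vec.span_singleton)
    have "w2 - c *s w1 = (w2 + u2) - c *s (u + w1)"
      unfolding c by (simp add: vec_eq_iff algebra_simps)
    moreover have "(w2 + u2) - c *s (u + w1) \<in> N 3" by (intro mem u2 w1)
    moreover have "w2 - c *s w1 \<in> N 2" by (intro mem w1 w2)
    ultimately have "w2 - c *s w1 = 0" by (intro in_two[of "w2 - c *s w1" 3 2]) simp_all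
    then have "u + c *s w1 \<in> N 4" using w2 by simp
    from orbit_of_transversal_point[OF u w1 this]
    have "card {q \<in> groupoid_orbit (range N) (vec.span {u}). q \<subseteq> N 1} \<le> 1"
      by (metis (no_types, lifting) card.empty card_insert_disjoint card_mono empty_iff finite.emptyI
        finite.insertI One_nat_def)
    then show False using card by simp
  qed
  have indep: "a = 0 \<and> b = 0" if ab: "a *s u + b *s u2 = 0" for a b
  proof -
    have "b = 0"
    proof (rule ccontr)
      assume "b \<noteq> 0"
      have "b *s u2 = (- a) *s u" using ab by (simp add: eq_neg_iff_add_eq_0 add.commute)
      then have "(1 / b) *s (b *s u2) = (1 / b) *s ((- a) *s u)" by simp
      then have "u2 = (- a / b) *s u" using \<open>b \<noteq> 0\<close> by simp
      then show False using not_dep unfolding vec.span_singleton by blast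
    qed
    then show ?thesis using ab u(2) by simp
  qed
  obtain w3 where w3: "w3 \<in> N 2" "u2 + w3 \<in> N 4" using graph[of 2 4 u2] by auto
  text \<open>\<open>w1\<close>, \<open>w2\<close> span the second line, so the fourth one is the graph of a companion matrix.\<close>
  have "\<exists>c t. w3 = c *s w1 + t *s w2"
  proof -
    have "w2 \<notin> vec.span {w1}"
    proof
      assume "w2 \<in> vec.span {w1}"
      then obtain k where k: "w2 = k *s w1" by (auto simp: vec.span_singleton)
      have "(w2 + u2) - k *s (u + w1) = u2 - k *s u" unfolding k by (simp add: vec_eq_iff algebra_simps)
      moreover have "(w2 + u2) - k *s (u + w1) \<in> N 3" by (intro mem u2 w1)
      moreover have "u2 - k *s u \<in> N 1" by (intro mem u2 u)
      ultimately have "u2 - k *s u = 0" by (intro in_two[of "u2 - k *s u" 3 1]) simp_all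
      then show False using not_dep unfolding vec.span_singleton by auto
    qed
    moreover have "w1 \<noteq> 0" using w1(2) u in_two[of u 1 3] by auto
    ultimately have "vec.dim (vec.span {w2, w1}) = 2" by (simp add: vec.dim_insert)
    then have "vec.span {w2, w1} = N 2"
      using line[of 2] w1 w2 sub by (intro vec.subspace_dim_equal vec.span_minimal) (auto simp: proj_line_def)
    then have "w3 \<in> vec.span {w2, w1}" using w3 by simp
    then obtain t where "w3 - t *s w2 \<in> vec.span {w1}" unfolding vec.span_breakdown_eq[of w3] by (elim exE)
    then obtain c where "w3 - t *s w2 = c *s w1" unfolding vec.span_singleton by blast
    then have "w3 = c *s w1 + t *s w2" by (simp only: diff_eq_eq)
    then show ?thesis by blast
  qed
  then obtain c t where ct: "w3 = c *s w1 + t *s w2" by blast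
  \<comment> \<open>The two roots of z^2 = t z + c, that is, the eigenvalues of A.\<close>
  define \<alpha> where "\<alpha> = (t + csqrt (t\<^sup>2 + 4 * c)) / 2"
  define \<beta> where "\<beta> = (t - csqrt (t\<^sup>2 + 4 * c)) / 2"
  have "t = \<alpha> + \<beta>" unfolding \<alpha>_def \<beta>_def by (simp add: field_simps)
  moreover have "c = - (\<alpha> * \<beta>)"
  proof -
    have "4 * (\<alpha> * \<beta>) = t\<^sup>2 - (csqrt (t\<^sup>2 + 4 * c))\<^sup>2"
      unfolding \<alpha>_def \<beta>_def by (simp add: field_simps power2_eq_square)
    then have "4 * (\<alpha> * \<beta>) = - 4 * c" by simp
    then show ?thesis by simp
  qed
  ultimately have 4: "u2 + (- (\<alpha> * \<beta>) *s w1 + (\<alpha> + \<beta>) *s w2) \<in> N 4" using w3 ct by simp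
  have 3: "u2 + w2 \<in> N 3" using u2 by (simp add: add.commute)
  have ne: "\<alpha> \<noteq> \<beta>"
  proof
    assume e: "\<alpha> = \<beta>"
    have "infinite (groupoid_orbit (range N) (vec.span {u}))"
    \<comment> \<open>For a double eigenvalue, \<open>u2 - \<alpha> *s u\<close> is an eigenvector,
      and u completes it to a Jordan basis.\<close>
    proof (rule orbit_of_unipotent_infinite[of u "u2 - \<alpha> *s u" w1 "w2 - \<alpha> *s w1" \<alpha>])
      show "u2 - \<alpha> *s u \<in> N 1" "w2 - \<alpha> *s w1 \<in> N 2" by (intro mem u u2 w1 w2)+
      show "u2 - \<alpha> *s u \<noteq> 0" using not_dep unfolding vec.span_singleton by auto
      show "u \<notin> vec.span {u2 - \<alpha> *s u}"
      proof
        assume "u \<in> vec.span {u2 - \<alpha> *s u}"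
        then obtain k where "u = k *s (u2 - \<alpha> *s u)" by (auto simp: vec.span_singleton)
        then have "(1 + k * \<alpha>) *s u + (- k) *s u2 = 0"
          by (simp add: vec_eq_iff algebra_simps)
        from indep[OF this] show False by auto
      qed
      have "(u2 + w2) - \<alpha> *s (u + w1) \<in> N 3" by (intro mem 3 w1)
      then show "u2 - \<alpha> *s u + (w2 - \<alpha> *s w1) \<in> N 3" by (simp add: algebra_simps)
      show "u + \<alpha> *s w1 + (w2 - \<alpha> *s w1) \<in> N 4" using w2 by simp
      have "(u2 + (- (\<alpha> * \<beta>) *s w1 + (\<alpha> + \<beta>) *s w2)) - \<alpha> *s (u + w2) \<in> N 4" by (intro mem 4 w2)
      moreover have "(u2 + (- (\<alpha> * \<beta>) *s w1 + (\<alpha> + \<beta>) *s w2)) - \<alpha> *s (u + w2) =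
          u2 - \<alpha> *s u + \<alpha> *s (w2 - \<alpha> *s w1)"
        unfolding e by (simp add: vec_eq_iff algebra_simps)
      ultimately show "u2 - \<alpha> *s u + \<alpha> *s (w2 - \<alpha> *s w1) \<in> N 4" by (simp only:)
    qed (use u w1 in auto)
    then show False using fin by simp
  qed
  \<comment> \<open>\<open>e1\<close> = k (A - \<beta>) u and \<open>e2\<close> = k (\<alpha> - A) u
    are the components of u in the two eigenspaces. This k makes them add up to u, so that the base
    point acquires the coordinates (1, 1).\<close>
  define k where "k = 1 / (\<alpha> - \<beta>)"
  have k: "k * \<alpha> = k * \<beta> + 1" using ne by (simp add: k_def field_simps)
  define e1 where "e1 = k *s (u2 - \<beta> *s u)"
  define e2 where "e2 = k *s (\<alpha> *s u - u2)"
  define f1 where "f1 = k *s (w2 - \<beta> *s w1)"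
  define f2 where "f2 = k *s (\<alpha> *s w1 - w2)"
  have eN: "e1 \<in> N 1" "e2 \<in> N 1" "f1 \<in> N 2" "f2 \<in> N 2"
    unfolding e1_def e2_def f1_def f2_def by (intro mem u u2 w1 w2)+
  have "e1 + f1 = k *s ((u2 + w2) - \<beta> *s (u + w1))" "e2 + f2 = k *s (\<alpha> *s (u + w1) - (u2 + w2))"
    by (simp_all add: e1_def e2_def f1_def f2_def vec_eq_iff algebra_simps)
  then have N3: "e1 + f1 \<in> N 3" "e2 + f2 \<in> N 3" by (simp_all only: mem 3 w1)
  let ?w = "u2 + (- (\<alpha> * \<beta>) *s w1 + (\<alpha> + \<beta>) *s w2)"
  have "e1 + \<alpha> *s f1 = k *s (?w - \<beta> *s (u + w2))" "e2 + \<beta> *s f2 = k *s (\<alpha> *s (u + w2) - ?w)"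
    by (simp_all add: e1_def e2_def f1_def f2_def vec_eq_iff algebra_simps)
  then have N4: "e1 + \<alpha> *s f1 \<in> N 4" "e2 + \<beta> *s f2 \<in> N 4" by (simp_all only: mem 4 w2)
  have ind: "a = 0 \<and> b = 0" if "a *s e1 + b *s e2 = 0" for a b
  proof -
    have "(k * (b * \<alpha> - a * \<beta>)) *s u + (k * (a - b)) *s u2 = a *s e1 + b *s e2"
      by (simp add: e1_def e2_def vec_eq_iff algebra_simps)
    then have "k * (b * \<alpha> - a * \<beta>) = 0 \<and> k * (a - b) = 0" using that by (intro indep) simp
    then show ?thesis using ne by (auto simp: k_def)
  qed
  have u_sum: "e1 + e2 = u"
  proof -
    have "e1 + e2 = (k * \<alpha> - k * \<beta>) *s u"
      by (simp add: e1_def e2_def vec_eq_iff algebra_simps)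
    then show ?thesis using k by simp
  qed
  have std: "std_lines \<alpha> \<beta>" by (rule diagonal_form(1)[OF eN N3 N4 ind])
  obtain T where T: "invertible T" "\<And>i. (*v) T ` std_line \<alpha> \<beta> i = N i" "T *v pt \<alpha> \<beta> 1 1 1 = u"
    using diagonal_form(2)[OF eN N3 N4 ind] unfolding u_sum by blast
  interpret std: std_lines \<alpha> \<beta> by (rule std)
  let ?O = "groupoid_orbit (range (std_line \<alpha> \<beta>)) (vec.span {pt \<alpha> \<beta> 1 1 1})"
  have "range N = (`) ((*v) T) ` range (std_line \<alpha> \<beta>)" by (simp add: image_image T(2))
  moreover have "vec.span {u} = (*v) T ` vec.span {pt \<alpha> \<beta> 1 1 1}"
    using vec.span_image[of T "{pt \<alpha> \<beta> 1 1 1}"] T(3) by simp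
  ultimately have O: "groupoid_orbit (range N) (vec.span {u}) = (`) ((*v) T) ` ?O"
    using groupoid_orbit_image[OF T(1)] by simp
  have injT: "inj ((`) ((*v) T))" using inj_matrix_vector_mult[OF T(1)]
    by (intro injI) (simp add: inj_image_eq_iff)
  \<comment> \<open>The coordinates of the orbit points on the first line. By \<open>loops\<close>,
    R is closed under multiplication by s and by s / t.\<close>
  define R where "R = {r. reaches (range (std_line \<alpha> \<beta>)) (vec.span {pt \<alpha> \<beta> 1 1 1}) (std_line \<alpha> \<beta> 1)
    (vec.span {pt \<alpha> \<beta> 1 1 r})}"
  have R: "{q \<in> ?O. q \<subseteq> std_line \<alpha> \<beta> 1} = (\<lambda>r. vec.span {pt \<alpha> \<beta> 1 1 r}) ` R"
  proof (intro equalityI subsetI)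
    fix q assume q: "q \<in> {q \<in> ?O. q \<subseteq> std_line \<alpha> \<beta> 1}"
    then obtain M where M: "reaches (range (std_line \<alpha> \<beta>)) (vec.span {pt \<alpha> \<beta> 1 1 1}) M q"
      unfolding groupoid_orbit_eq by blast
    obtain i r where ir: "M = std_line \<alpha> \<beta> i" "q = vec.span {pt \<alpha> \<beta> i 1 r}"
      using std.reachesD[OF M, of 0] by auto
    then have "i = 1" using q std.span_pt_subset_iff by simp
    then show "q \<in> (\<lambda>r. vec.span {pt \<alpha> \<beta> 1 1 r}) ` R" using M ir unfolding R_def by blast
  next
    fix q assume "q \<in> (\<lambda>r. vec.span {pt \<alpha> \<beta> 1 1 r}) ` R"
    then obtain r where r: "q = vec.span {pt \<alpha> \<beta> 1 1 r}"
      "reaches (range (std_line \<alpha> \<beta>)) (vec.span {pt \<alpha> \<beta> 1 1 1}) (std_line \<alpha> \<beta> 1) q"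
      unfolding R_def by blast
    then show "q \<in> {q \<in> ?O. q \<subseteq> std_line \<alpha> \<beta> 1}"
      using reaches_subset unfolding groupoid_orbit_eq by blast
  qed
  have R0: "r \<noteq> 0" if "r \<in> R" for r
  proof -
    have "reaches (range (std_line \<alpha> \<beta>)) (vec.span {pt \<alpha> \<beta> 1 1 1}) (std_line \<alpha> \<beta> 1)
      (vec.span {pt \<alpha> \<beta> 1 1 r})" using that by (simp add: R_def)
    from std.reachesD[OF this, of 0] obtain i s
      where s: "std_line \<alpha> \<beta> 1 = std_line \<alpha> \<beta> i" "vec.span {pt \<alpha> \<beta> 1 1 r} = vec.span {pt \<alpha> \<beta> i 1 s}" "s \<noteq> 0"
      by auto
    have "i = 1" using s(1) std.inj_std_line by (simp add: inj_eq)
    then show ?thesis using s span_pt_eq_iff by blast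
  qed
  have "inj_on (\<lambda>r. vec.span {pt \<alpha> \<beta> 1 1 r}) R"
    using R0 span_pt_eq_iff by (intro inj_onI) blast
  then have bij: "bij_betw (\<lambda>r. vec.span {pt \<alpha> \<beta> 1 1 r}) R {q \<in> ?O. q \<subseteq> std_line \<alpha> \<beta> 1}"
    unfolding R by (rule inj_on_imp_bij_betw)
  have "{q \<in> (`) ((*v) T) ` ?O. q \<subseteq> N 1} = (`) ((*v) T) ` {q \<in> ?O. q \<subseteq> std_line \<alpha> \<beta> 1}"
    unfolding T(2)[symmetric] using inj_image_subset_iff[OF inj_matrix_vector_mult[OF T(1)]] by auto
  then have "card {q \<in> ?O. q \<subseteq> std_line \<alpha> \<beta> 1} = m"
    using card(1) card_image[OF inj_on_subset[OF injT subset_UNIV]] unfolding O by simp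
  then have cR: "card R = m" using bij_betw_same_card[OF bij] by simp
  then have finR: "finite R" using card(2) by (intro card_ge_0_finite) simp
  note nd = std.nondeg
  have 1: "(\<beta> / \<alpha>) ^ m = 1"
    unfolding cR[symmetric]
  proof (rule closed_under_mult_imp_root_of_unity[OF finR])
    show "r * (\<beta> / \<alpha>) \<in> R" if "r \<in> R" for r using that std.loops(1) unfolding R_def by simp
  qed (use R0 nd in auto)
  have "((\<beta> / \<alpha>) / ((\<beta> - 1) / (\<alpha> - 1))) ^ m = 1"
    unfolding cR[symmetric]
  proof (rule closed_under_mult_imp_root_of_unity[OF finR])
    show "r * ((\<beta> / \<alpha>) / ((\<beta> - 1) / (\<alpha> - 1))) \<in> R" if "r \<in> R" for r
      using that std.loops(2) unfolding R_def by blast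
  qed (use R0 nd in auto)
  then have "((\<beta> - 1) / (\<alpha> - 1)) ^ m = 1"
    unfolding power_divide[of "\<beta> / \<alpha>"] 1 by simp
  then show ?thesis using std ne 1 T(1) O by blast
qed

end

section \<open>Projective equivalence\<close>

lemma projectively_equivalent_refl: "projectively_equivalent Z Z"
proof -
  have "invertible (mat 1 :: complex^4^4)"
    unfolding invertible_def by (rule exI[of _ "mat 1"]) simp
  moreover have "Z = (\<lambda>p. (*v) (mat 1) ` p) ` Z" by simp
  ultimately show ?thesis unfolding projectively_equivalent_def by blast
qed

lemma projectively_equivalent_sym:
  assumes "projectively_equivalent Z W" shows "projectively_equivalent W Z"
proof -
  obtain A :: "complex^4^4" where A: "invertible A" "W = (`) ((*v) A) ` Z"
    using assms unfolding projectively_equivalent_def by blast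
  obtain B where B: "A ** B = mat 1" "B ** A = mat 1" using A(1) unfolding invertible_def by blast
  have "invertible B" using B unfolding invertible_def by blast
  moreover have "(*v) B ` (*v) A ` X = X" for X
    using B by (simp add: image_image matrix_vector_mul_assoc)
  then have "Z = (`) ((*v) B) ` W"
    unfolding A(2) by (simp add: image_image[of "(`) ((*v) B)"])
  ultimately show ?thesis unfolding projectively_equivalent_def by blast
qed

lemma projectively_equivalent_trans:
  assumes "projectively_equivalent Z W" "projectively_equivalent W V"
  shows "projectively_equivalent Z V"
proof -
  obtain A B :: "complex^4^4" where A: "invertible A" "W = (`) ((*v) A) ` Z"
    and B: "invertible B" "V = (`) ((*v) B) ` W"
    using assms unfolding projectively_equivalent_def by blast
  have "V = (`) ((*v) (B ** A)) ` Z"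
    unfolding A(2) B(2) by (simp add: image_image matrix_vector_mul_assoc)
  then show ?thesis
    using invertible_mult[OF B(1) A(1)] unfolding projectively_equivalent_def by blast
qed

text \<open>An involution is its own inverse, so the two inclusions between the configurations
  already give equality of the image with W.\<close>

lemma projectively_equivalent_involution:
  fixes T :: "complex^4^4"
  assumes "\<And>v. T *v (T *v v) = v" "\<And>p. p \<in> Z \<Longrightarrow> (*v) T ` p \<in> W" "\<And>p. p \<in> W \<Longrightarrow> (*v) T ` p \<in> Z"
  shows "projectively_equivalent Z W"
proof -
  have "T ** T = mat 1" using assms(1) by (simp add: matrix_eq matrix_vector_mul_assoc)
  then have "invertible T" unfolding invertible_def by blast
  moreover have "W = (`) ((*v) T) ` Z"
  proof (intro equalityI subsetI)
    fix p assume "p \<in> W"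
    moreover have "p = (*v) T ` (*v) T ` p" using assms(1) by (simp add: image_image)
    ultimately show "p \<in> (`) ((*v) T) ` Z" using assms(3) by blast
  qed (use assms(2) in blast)
  ultimately show ?thesis unfolding projectively_equivalent_def by blast
qed

lemma image_span_pt:
  fixes T :: "complex^4^4"
  assumes "T *v pt \<alpha> \<beta> i 1 r = pt \<alpha>' \<beta>' j x y" "x \<noteq> 0" "(y / x) ^ m = 1"
  shows "(*v) T ` vec.span {pt \<alpha> \<beta> i 1 r} \<in> std_config m \<alpha>' \<beta>'"
proof -
  have "(*v) T ` vec.span {pt \<alpha> \<beta> i 1 r} = vec.span {pt \<alpha>' \<beta>' j 1 (y / x)}"
    using vec.span_image[of T "{pt \<alpha> \<beta> i 1 r}"] assms(1) span_pt_normalize[OF assms(2)] by simp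
  then show ?thesis using assms(3) unfolding std_config_def by blast
qed

lemma std_config_image:
  fixes T :: "complex^4^4"
  assumes "\<And>i r. r ^ m = 1 \<Longrightarrow> \<exists>j x y. T *v pt \<alpha> \<beta> i 1 r = pt \<alpha>' \<beta>' j x y \<and> x \<noteq> 0 \<and> (y / x) ^ m = 1"
    "p \<in> std_config m \<alpha> \<beta>"
  shows "(*v) T ` p \<in> std_config m \<alpha>' \<beta>'"
proof -
  obtain i r where p: "p = vec.span {pt \<alpha> \<beta> i 1 r}" "r ^ m = 1"
    using assms(2) unfolding std_config_def by blast
  obtain j x y where "T *v pt \<alpha> \<beta> i 1 r = pt \<alpha>' \<beta>' j x y" "x \<noteq> 0" "(y / x) ^ m = 1"
    using assms(1)[OF p(2)] by blast
  then show ?thesis unfolding p(1) by (rule image_span_pt)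
qed

section \<open>Explicit projectivities between standard configurations\<close>

definition swap_eigen :: "complex^4^4" where
  "swap_eigen = (\<chi> r c. if r = 1 \<and> c = 3 \<or> r = 2 \<and> c = 4 \<or> r = 3 \<and> c = 1 \<or> r = 4 \<and> c = 2 then 1 else 0)"

lemma swap_eigen_nth: "(swap_eigen *v v) $ 1 = v $ 3" "(swap_eigen *v v) $ 2 = v $ 4"
  "(swap_eigen *v v) $ 3 = v $ 1" "(swap_eigen *v v) $ 4 = v $ 2"
  by (simp_all add: swap_eigen_def matrix_vector_mult_def sum_4)

lemma equiv_swap:
  assumes "m > 0"
  shows "projectively_equivalent (std_config m \<alpha> \<beta>) (std_config m \<beta> \<alpha>)"
proof -
  have ex: "\<exists>j x y. swap_eigen *v pt \<alpha> \<beta> i 1 r = pt \<beta> \<alpha> j x y \<and> x \<noteq> 0 \<and> (y / x) ^ m = 1"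
    if "r ^ m = 1" for \<alpha> \<beta> i r
  proof (rule exI[of _ i], rule exI[of _ r], rule exI[of _ 1], intro conjI)
    show "swap_eigen *v pt \<alpha> \<beta> i 1 r = pt \<beta> \<alpha> i r 1"
      by (simp add: vec_eq_iff forall_4 swap_eigen_nth)
    show "r \<noteq> 0" using that assms by (auto simp: power_0_left)
    show "(1 / r) ^ m = 1" using that by (simp add: power_one_over)
  qed
  have *: "(*v) swap_eigen ` p \<in> std_config m \<beta> \<alpha>" if "p \<in> std_config m \<alpha> \<beta>" for \<alpha> \<beta> p
    by (rule std_config_image[OF ex that])
  show ?thesis
    by (rule projectively_equivalent_involution[of swap_eigen])
      (simp add: vec_eq_iff forall_4 swap_eigen_nth, (rule *, assumption)+)
qed

definition reflect_lines :: "complex^4^4" where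
  "reflect_lines = (\<chi> r c. if r = 1 \<and> c = 1 \<or> r = 2 \<and> c = 1 \<or> r = 3 \<and> c = 3 \<or> r = 4 \<and> c = 3 then 1
     else if r = 2 \<and> c = 2 \<or> r = 4 \<and> c = 4 then -1 else 0)"

lemma reflect_lines_nth: "(reflect_lines *v v) $ 1 = v $ 1" "(reflect_lines *v v) $ 2 = v $ 1 - v $ 2"
  "(reflect_lines *v v) $ 3 = v $ 3" "(reflect_lines *v v) $ 4 = v $ 3 - v $ 4"
  by (simp_all add: reflect_lines_def matrix_vector_mult_def sum_4)

lemma equiv_one_minus:
  "projectively_equivalent (std_config m \<alpha> \<beta>) (std_config m (1 - \<alpha>) (1 - \<beta>))"
proof -
  have ex: "\<exists>j x y. reflect_lines *v pt \<alpha> \<beta> i 1 r = pt (1 - \<alpha>) (1 - \<beta>) j x y \<and> x \<noteq> 0 \<and> (y / x) ^ m = 1"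
    if r: "r ^ m = 1" for \<alpha> \<beta> i r
  proof -
    have "reflect_lines *v pt \<alpha> \<beta> 1 1 r = pt (1 - \<alpha>) (1 - \<beta>) 3 1 r"
      "reflect_lines *v pt \<alpha> \<beta> 2 1 r = pt (1 - \<alpha>) (1 - \<beta>) 2 (-1) (-r)"
      "reflect_lines *v pt \<alpha> \<beta> 3 1 r = pt (1 - \<alpha>) (1 - \<beta>) 1 1 r"
      "reflect_lines *v pt \<alpha> \<beta> 4 1 r = pt (1 - \<alpha>) (1 - \<beta>) 4 1 r"
      by (simp_all add: vec_eq_iff forall_4 reflect_lines_nth crd0_def crd1_def algebra_simps)
    moreover have "(r / 1) ^ m = 1" "(- r / - 1) ^ m = 1" "(1::complex) \<noteq> 0" "(-1::complex) \<noteq> 0"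
      using r by simp_all
    ultimately show ?thesis using exhaust_4[of i] by metis
  qed
  have *: "(*v) reflect_lines ` p \<in> std_config m (1 - \<alpha>) (1 - \<beta>)" if "p \<in> std_config m \<alpha> \<beta>" for \<alpha> \<beta> p
    by (rule std_config_image[OF ex that])
  show ?thesis
  proof (rule projectively_equivalent_involution[of reflect_lines])
    show "(*v) reflect_lines ` p \<in> std_config m \<alpha> \<beta>" if "p \<in> std_config m (1 - \<alpha>) (1 - \<beta>)" for p
      using *[OF that] by simp
  qed (simp add: vec_eq_iff forall_4 reflect_lines_nth, rule *)
qed

definition swap_lines :: "complex^4^4" where
  "swap_lines = (\<chi> r c. if r = 1 \<and> c = 2 \<or> r = 2 \<and> c = 1 \<or> r = 3 \<and> c = 4 \<or> r = 4 \<and> c = 3 then 1 else 0)"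

lemma swap_lines_nth: "(swap_lines *v v) $ 1 = v $ 2" "(swap_lines *v v) $ 2 = v $ 1"
  "(swap_lines *v v) $ 3 = v $ 4" "(swap_lines *v v) $ 4 = v $ 3"
  by (simp_all add: swap_lines_def matrix_vector_mult_def sum_4)

lemma equiv_inverse:
  assumes "\<alpha> \<noteq> 0" "\<beta> \<noteq> 0" "(\<beta> / \<alpha>) ^ m = 1"
  shows "projectively_equivalent (std_config m \<alpha> \<beta>) (std_config m (1 / \<alpha>) (1 / \<beta>))"
proof -
  have ex: "\<exists>j x y. swap_lines *v pt \<alpha> \<beta> i 1 r = pt (1 / \<alpha>) (1 / \<beta>) j x y \<and> x \<noteq> 0 \<and> (y / x) ^ m = 1"
    if nz: "\<alpha> \<noteq> 0" "\<beta> \<noteq> 0" "(\<beta> / \<alpha>) ^ m = 1" and r: "r ^ m = 1" for \<alpha> \<beta> i r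
  proof -
    have "swap_lines *v pt \<alpha> \<beta> 1 1 r = pt (1 / \<alpha>) (1 / \<beta>) 2 1 r"
      "swap_lines *v pt \<alpha> \<beta> 2 1 r = pt (1 / \<alpha>) (1 / \<beta>) 1 1 r"
      "swap_lines *v pt \<alpha> \<beta> 3 1 r = pt (1 / \<alpha>) (1 / \<beta>) 3 1 r"
      "swap_lines *v pt \<alpha> \<beta> 4 1 r = pt (1 / \<alpha>) (1 / \<beta>) 4 \<alpha> (\<beta> * r)"
      using nz by (simp_all add: vec_eq_iff forall_4 swap_lines_nth crd0_def crd1_def)
    moreover have "(\<beta> * r / \<alpha>) ^ m = 1"
      using nz(3) r by (simp add: power_divide power_mult_distrib)
    moreover have "(r / 1) ^ m = 1" "(1::complex) \<noteq> 0" using r by simp_all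
    ultimately show ?thesis using exhaust_4[of i] nz(1) by metis
  qed
  have *: "(*v) swap_lines ` p \<in> std_config m (1 / \<alpha>) (1 / \<beta>)"
    if "p \<in> std_config m \<alpha> \<beta>" "\<alpha> \<noteq> 0" "\<beta> \<noteq> 0" "(\<beta> / \<alpha>) ^ m = 1" for \<alpha> \<beta> p
    by (rule std_config_image[OF ex[OF that(2-4)] that(1)])
  have inv: "(1 / \<beta> / (1 / \<alpha>)) ^ m = 1" using assms by (simp add: power_divide)
  show ?thesis
  proof (rule projectively_equivalent_involution[of swap_lines])
    show "(*v) swap_lines ` p \<in> std_config m \<alpha> \<beta>" if "p \<in> std_config m (1 / \<alpha>) (1 / \<beta>)" for p
      using *[OF that _ _ inv] assms by simp
  qed (simp add: vec_eq_iff forall_4 swap_lines_nth, rule *[OF _ assms])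
qed

section \<open>Cross ratios on the transversals as invariants\<close>

definition cross_ratio :: "complex \<Rightarrow> 4 \<Rightarrow> 4 \<Rightarrow> 4 \<Rightarrow> 4 \<Rightarrow> complex" where
  "cross_ratio z a b c d = bracket z a d * bracket z b c / (bracket z a c * bracket z b d)"

definition anharmonic :: "(complex \<Rightarrow> complex) set" where
  "anharmonic = {\<lambda>z. z, \<lambda>z. 1 / z, \<lambda>z. 1 - z, \<lambda>z. 1 / (1 - z), \<lambda>z. (z - 1) / z, \<lambda>z. z / (z - 1)}"

lemma cross_ratio_std:
  "cross_ratio z 1 2 3 4 = z" "cross_ratio z 1 3 2 4 = z / (z - 1)" "cross_ratio z 2 1 3 4 = 1 / z"
  "cross_ratio z 2 3 1 4 = 1 / (1 - z)" "cross_ratio z 3 1 2 4 = (z - 1) / z" "cross_ratio z 3 2 1 4 = 1 - z"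
proof -
  have "bracket z 1 4 = z" "bracket z 2 4 = - 1" "bracket z 3 4 = z - 1"
    "bracket z 1 2 = 1" "bracket z 1 3 = 1" "bracket z 2 3 = - 1"
    "bracket z 2 1 = - 1" "bracket z 3 1 = - 1" "bracket z 3 2 = 1"
    by (simp_all add: bracket_def crd0_def crd1_def)
  moreover have "1 / (1 - z) = - 1 / (z - 1)" by (metis minus_diff_eq minus_divide_divide)
  ultimately show "cross_ratio z 1 2 3 4 = z" "cross_ratio z 1 3 2 4 = z / (z - 1)"
    "cross_ratio z 2 1 3 4 = 1 / z" "cross_ratio z 2 3 1 4 = 1 / (1 - z)"
    "cross_ratio z 3 1 2 4 = (z - 1) / z" "cross_ratio z 3 2 1 4 = 1 - z"
    by (simp_all add: cross_ratio_def)
qed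

text \<open>The cross ratio is invariant under double transpositions, so the index 4 can be moved to
  the last place; the six orders of 1, 2, 3 remain.\<close>

lemma cross_ratio_anharmonic:
  assumes ne: "a \<noteq> b" "a \<noteq> c" "a \<noteq> d" "b \<noteq> c" "b \<noteq> d" "c \<noteq> d"
  shows "\<exists>\<sigma>\<in>anharmonic. \<forall>z. cross_ratio z a b c d = \<sigma> z"
proof -
  have *: "\<exists>\<sigma>\<in>anharmonic. \<forall>z. cross_ratio z a b c 4 = \<sigma> z"
    if "a \<noteq> b" "a \<noteq> c" "b \<noteq> c" "a \<noteq> 4" "b \<noteq> 4" "c \<noteq> 4" for a b c
  proof -
    have "(a, b, c) \<in> {(1, 2, 3), (1, 3, 2), (2, 1, 3), (2, 3, 1), (3, 1, 2), (3, 2, 1)}"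
      using that exhaust_4[of a] exhaust_4[of b] exhaust_4[of c] by (elim disjE) simp_all
    then show ?thesis
      unfolding anharmonic_def by (elim insertE) (simp_all add: cross_ratio_std)
  qed
  have sym: "cross_ratio z a b c d = cross_ratio z d c b a" "cross_ratio z a b c d = cross_ratio z c d a b"
    "cross_ratio z a b c d = cross_ratio z b a d c" for z
    using bracket_antisym[of z a b] bracket_antisym[of z a c] bracket_antisym[of z a d]
      bracket_antisym[of z b c] bracket_antisym[of z b d] bracket_antisym[of z c d]
    by (simp_all add: cross_ratio_def mult.commute)
  have "a = 4 \<or> b = 4 \<or> c = 4 \<or> d = 4"
    using ne exhaust_4[of a] exhaust_4[of b] exhaust_4[of c] exhaust_4[of d] by (elim disjE) simp_all
  then show ?thesis
  proof (elim disjE)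
    assume "a = 4" then show ?thesis using *[of d c b] ne unfolding sym(1) by metis
  next
    assume "b = 4" then show ?thesis using *[of c d a] ne unfolding sym(2) by metis
  next
    assume "c = 4" then show ?thesis using *[of b a d] ne unfolding sym(3) by metis
  next
    assume "d = 4" then show ?thesis using *[of a b c] ne by metis
  qed
qed

text \<open>\<open>X i\<close> is the scalar by which a projectivity carries the \<open>i\<close>-th of four points on a line, in
  normalized coordinates, to the \<open>\<pi> i\<close>-th of four others; the relations are the images of the linear
  relations between three of the points.\<close>

lemma cross_ratio_of_relation:
  fixes X :: "4 \<Rightarrow> complex"
  assumes \<gamma>: "\<gamma> \<noteq> 0" "\<gamma> \<noteq> 1" and \<delta>: "\<delta> \<noteq> 0" "\<delta> \<noteq> 1" and \<pi>: "inj \<pi>"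
    and rel0: "\<And>i j k. i \<noteq> j \<Longrightarrow> bracket \<gamma> i j * (crd0 (\<pi> k) * X k) =
      bracket \<gamma> k j * (crd0 (\<pi> i) * X i) + bracket \<gamma> i k * (crd0 (\<pi> j) * X j)"
    and rel1: "\<And>i j k. i \<noteq> j \<Longrightarrow> bracket \<gamma> i j * (crd1 \<delta> (\<pi> k) * X k) =
      bracket \<gamma> k j * (crd1 \<delta> (\<pi> i) * X i) + bracket \<gamma> i k * (crd1 \<delta> (\<pi> j) * X j)"
  shows "(\<forall>i. X i = 0) \<or> \<gamma> = cross_ratio \<delta> (\<pi> 1) (\<pi> 2) (\<pi> 3) (\<pi> 4)"
proof -
  have nz: "bracket \<gamma> i j \<noteq> 0" "bracket \<delta> (\<pi> i) (\<pi> j) \<noteq> 0" if "i \<noteq> j" for i j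
    using that bracket_nonzero \<gamma> \<delta> inj_eq[OF \<pi>] by simp_all
  \<comment> \<open>Taking the bracket of the relation with the point of index \<pi> i removes the
    term in X i.\<close>
  have R: "bracket \<gamma> i j * X k * bracket \<delta> (\<pi> k) (\<pi> i) = bracket \<gamma> i k * X j * bracket \<delta> (\<pi> j) (\<pi> i)"
    if "i \<noteq> j" for i j k
  proof -
    have "bracket \<gamma> i j * X k * bracket \<delta> (\<pi> k) (\<pi> i) =
      (bracket \<gamma> i j * (crd0 (\<pi> k) * X k)) * crd1 \<delta> (\<pi> i) - (bracket \<gamma> i j * (crd1 \<delta> (\<pi> k) * X k)) * crd0 (\<pi> i)"
      unfolding bracket_def[of \<delta>] by (simp add: algebra_simps)
    also have "\<dots> = bracket \<gamma> i k * X j * bracket \<delta> (\<pi> j) (\<pi> i)"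
      unfolding rel0[OF that] rel1[OF that] bracket_def[of \<delta>] by (simp add: algebra_simps)
    finally show ?thesis .
  qed
  \<comment> \<open>With a third index i both brackets in the relation are nonzero, so that one
    vanishing scalar makes all of them vanish.\<close>
  have zero: "X k = 0" if "X j = 0" for j k
  proof (cases "k = j")
    case False
    obtain i where i: "i \<noteq> j" "i \<noteq> k"
    proof -
      have "card {j, k} \<le> 2" by (simp add: card_insert_if)
      moreover have "card (UNIV :: 4 set) = 4" by simp
      ultimately have "card {j, k} \<noteq> card (UNIV :: 4 set)" by simp
      then have "{j, k} \<noteq> UNIV" by metis
      then show ?thesis using that by blast
    qed
    have "bracket \<gamma> i j * X k * bracket \<delta> (\<pi> k) (\<pi> i) = 0" using R[OF i(1), of k] that by simp
    then show ?thesis using nz i by auto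
  qed (use that in simp)
  show ?thesis
  proof (cases "X 3 = 0 \<or> X 4 = 0")
    case False
    then have X: "X 3 \<noteq> 0" "X 4 \<noteq> 0" by auto
    define a b c d where "a = bracket \<delta> (\<pi> 1) (\<pi> 4)" "b = bracket \<delta> (\<pi> 2) (\<pi> 3)"
      "c = bracket \<delta> (\<pi> 1) (\<pi> 3)" "d = bracket \<delta> (\<pi> 2) (\<pi> 4)"
    have nz': "a \<noteq> 0" "b \<noteq> 0" "c \<noteq> 0" "d \<noteq> 0" unfolding a_b_c_d_def using nz by simp_all
    have "bracket \<gamma> 1 3 = 1" "bracket \<gamma> 1 4 = \<gamma>" "bracket \<gamma> 2 3 = -1" "bracket \<gamma> 2 4 = -1"
      by (simp_all add: bracket_def crd0_def crd1_def)
    then have "X 4 * a = \<gamma> * X 3 * c" "X 4 * d = X 3 * b"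
      using R[of 1 3 4] R[of 2 3 4] bracket_antisym[of \<delta> "\<pi> 1" "\<pi> 4"] bracket_antisym[of \<delta> "\<pi> 1" "\<pi> 3"]
        bracket_antisym[of \<delta> "\<pi> 2" "\<pi> 4"] bracket_antisym[of \<delta> "\<pi> 2" "\<pi> 3"]
      by (simp_all add: a_b_c_d_def)
    then have "(X 4 * a) * (X 3 * b) = (\<gamma> * X 3 * c) * (X 4 * d)" by simp
    then have "(X 3 * X 4) * (a * b) = (X 3 * X 4) * (\<gamma> * (c * d))" by (simp only: mult_ac)
    then have "a * b = \<gamma> * (c * d)" using X by simp
    then have "\<gamma> = a * b / (c * d)" using nz' by (simp add: field_simps)
    then show ?thesis by (simp add: cross_ratio_def a_b_c_d_def)
  qed (use zero in blast)
qed

text \<open>The products of \<open>ratio\<close> over the three pairings {12, 34}, {13, 24}, {14,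
  23} of the lines are t, 1 and s, and the entries are their quotients s / 1, 1 / t, t / s in cyclic
  order. Permuting the lines permutes the pairings: a cyclic permutation only moves the quotients
  around, a transposition also inverts them.\<close>

definition ratio_triple :: "complex \<Rightarrow> complex \<Rightarrow> complex multiset" where
  "ratio_triple \<alpha> \<beta> = (let s = \<beta> / \<alpha>; t = (\<beta> - 1) / (\<alpha> - 1) in {#s, 1 / t, t / s#})"

lemma ratio_triple_swap: "ratio_triple \<beta> \<alpha> = image_mset inverse (ratio_triple \<alpha> \<beta>)"
  by (simp add: ratio_triple_def Let_def divide_inverse mult.commute)

lemma ratio_triple_anharmonic:
  assumes "\<sigma> \<in> anharmonic" "\<alpha> \<noteq> 0" "\<alpha> \<noteq> 1" "\<beta> \<noteq> 0" "\<beta> \<noteq> 1"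
  shows "ratio_triple (\<sigma> \<alpha>) (\<sigma> \<beta>) = ratio_triple \<alpha> \<beta> \<or>
    ratio_triple (\<sigma> \<alpha>) (\<sigma> \<beta>) = image_mset inverse (ratio_triple \<alpha> \<beta>)"
proof -
  define s where "s = \<beta> / \<alpha>"
  define t where "t = (\<beta> - 1) / (\<alpha> - 1)"
  have st: "ratio_triple \<alpha> \<beta> = {#s, 1 / t, t / s#}" by (simp add: ratio_triple_def s_def t_def)
  have nz: "s \<noteq> 0" "t \<noteq> 0" using assms by (auto simp: s_def t_def)
  have nz1: "1 - \<alpha> \<noteq> 0" "1 - \<beta> \<noteq> 0" "\<alpha> - 1 \<noteq> 0" "\<beta> - 1 \<noteq> 0" using assms by auto
  have tri: "ratio_triple z w = {#u, 1 / v, v / u#}" if "w / z = u" "(w - 1) / (z - 1) = v" for z w u v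
    using that by (simp add: ratio_triple_def)
  have d: "1 / z - 1 = (1 - z) / z" "1 - z - 1 = - z" "1 / (1 - z) - 1 = z / (1 - z)"
    "(z - 1) / z - 1 = - 1 / z" "z / (z - 1) - 1 = 1 / (z - 1)" if "z \<noteq> 0" "z \<noteq> 1" for z :: complex
    using that by (simp_all add: field_simps)
  note d = d[OF assms(2,3)] d[OF assms(4,5)]
  have t': "t = (1 - \<beta>) / (1 - \<alpha>)" using nz1 by (simp add: t_def divide_simps) (simp add: algebra_simps)
  have "ratio_triple (1 / \<alpha>) (1 / \<beta>) = {#1 / s, 1 / (t / s), t / s / (1 / s)#}"
    by (rule tri; (unfold d)?; use assms nz1 in \<open>simp add: s_def t'\<close>)
  moreover have "ratio_triple (1 - \<alpha>) (1 - \<beta>) = {#t, 1 / s, s / t#}"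
    by (rule tri; (unfold d)?; use assms nz1 in \<open>simp add: s_def t'\<close>)
  moreover have "ratio_triple (1 / (1 - \<alpha>)) (1 / (1 - \<beta>)) = {#1 / t, 1 / (s / t), s / t / (1 / t)#}"
    by (rule tri; (unfold d)?; use assms nz1 in \<open>simp add: s_def t'\<close>)
  moreover have "ratio_triple ((\<alpha> - 1) / \<alpha>) ((\<beta> - 1) / \<beta>) = {#t / s, 1 / (1 / s), 1 / s / (t / s)#}"
    by (rule tri; (unfold d)?; use assms nz1 in \<open>simp add: s_def t_def\<close>)
  moreover have "ratio_triple (\<alpha> / (\<alpha> - 1)) (\<beta> / (\<beta> - 1)) = {#s / t, 1 / (1 / t), 1 / t / (s / t)#}"
    by (rule tri; (unfold d)?; use assms nz1 in \<open>simp add: s_def t_def\<close>)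
  ultimately show ?thesis
    using assms(1) nz st unfolding anharmonic_def st
    by (auto simp: inverse_eq_divide add_mset_commute st)
qed

text \<open>Each image line carries m > 4 points, so T permutes the lines. The points where the
  eigenspace of \<alpha> meets the four lines are collinear with cross ratio \<alpha>; their images
  are collinear points on the new lines, whose cross ratio is an anharmonic function of \<alpha>' or
  of \<beta>'.\<close>

lemma equiv_imp_ratio_triple:
  assumes std: "std_lines \<alpha> \<beta>" "std_lines \<alpha>' \<beta>'" and ne: "\<alpha> \<noteq> \<beta>" "\<alpha>' \<noteq> \<beta>'" and m: "m \<ge> 5"
    and eq: "projectively_equivalent (std_config m \<alpha> \<beta>) (std_config m \<alpha>' \<beta>')"
  shows "ratio_triple \<alpha> \<beta> = ratio_triple \<alpha>' \<beta>' \<or>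
    ratio_triple \<alpha> \<beta> = image_mset inverse (ratio_triple \<alpha>' \<beta>')"
proof -
  interpret A: std_lines \<alpha> \<beta> by (rule std)
  interpret B: std_lines \<alpha>' \<beta>' by (rule std)
  obtain T :: "complex^4^4" where T: "invertible T" "std_config m \<alpha>' \<beta>' = (`) ((*v) T) ` std_config m \<alpha> \<beta>"
    using eq unfolding projectively_equivalent_def by blast
  have inj: "inj ((*v) T)" by (rule inj_matrix_vector_mult[OF T(1)])
  have inj_im: "inj ((`) ((*v) T))" using inj by (intro injI) (simp add: inj_image_eq_iff)
  have "\<exists>j. (*v) T ` std_line \<alpha> \<beta> i = std_line \<alpha>' \<beta>' j" for i
  proof -
    have "(*v) T ` std_line \<alpha> \<beta> i \<in> range (std_line \<alpha>' \<beta>')"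
    proof (rule line_with_many_points[OF B.skew_std_lines])
      have "vec.dim ((*v) T ` std_line \<alpha> \<beta> i) = vec.dim (std_line \<alpha> \<beta> i)"
        using inj by (intro vec.dim_image_eq) (auto intro: inj_on_subset)
      moreover have "vec.subspace ((*v) T ` std_line \<alpha> \<beta> i)"
        by (intro vec.subspace_image subspace_std_line)
      ultimately show "proj_line ((*v) T ` std_line \<alpha> \<beta> i)"
        using proj_line_std_line[of \<alpha> \<beta> i] by (simp add: proj_line_def)
      have "{p \<in> std_config m \<alpha>' \<beta>'. p \<subseteq> (*v) T ` std_line \<alpha> \<beta> i} =
        (`) ((*v) T) ` {p \<in> std_config m \<alpha> \<beta>. p \<subseteq> std_line \<alpha> \<beta> i}"
        unfolding T(2) using inj_image_subset_iff[OF inj] by auto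
      then have "card {p \<in> std_config m \<alpha>' \<beta>'. p \<subseteq> (*v) T ` std_line \<alpha> \<beta> i} = m"
        using card_image[OF inj_on_subset[OF inj_im subset_UNIV]] A.card_std_config_line m by simp
      then show "card (range (std_line \<alpha>' \<beta>')) <
        card {p \<in> std_config m \<alpha>' \<beta>'. p \<subseteq> (*v) T ` std_line \<alpha> \<beta> i}"
        using B.card_std_lines m by simp
    qed (fact B.std_config_on_lines)+
    then show ?thesis by blast
  qed
  then obtain \<pi> where \<pi>: "\<And>i. (*v) T ` std_line \<alpha> \<beta> i = std_line \<alpha>' \<beta>' (\<pi> i)" by metis
  have inj\<pi>: "inj \<pi>"
  proof (rule injI)
    fix i j assume "\<pi> i = \<pi> j"
    then have "std_line \<alpha> \<beta> i = std_line \<alpha> \<beta> j" using \<pi> inj_im by (metis inj_eq)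
    then show "i = j" using A.inj_std_line by (simp add: inj_eq)
  qed
  have "\<exists>x y. T *v pt \<alpha> \<beta> i a b = pt \<alpha>' \<beta>' (\<pi> i) x y" for i a b
    using \<pi>[of i] pt_in_std_line[of \<alpha> \<beta> i a b] unfolding std_line_def by blast
  then obtain X Y where XY: "\<And>i a b. T *v pt \<alpha> \<beta> i a b = pt \<alpha>' \<beta>' (\<pi> i) (X i a b) (Y i a b)" by metis
  have nzXY: "X i a b \<noteq> 0 \<or> Y i a b \<noteq> 0" if "a \<noteq> 0 \<or> b \<noteq> 0" for i a b
  proof (rule ccontr)
    assume "\<not> ?thesis"
    then have "T *v pt \<alpha> \<beta> i a b = T *v 0" unfolding XY by simp
    then show False using inj that by (simp only: inj_eq) simp
  qed
  obtain \<sigma> where \<sigma>: "\<sigma> \<in> anharmonic"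
    "\<And>z. cross_ratio z (\<pi> 1) (\<pi> 2) (\<pi> 3) (\<pi> 4) = \<sigma> z"
    using cross_ratio_anharmonic[of "\<pi> 1" "\<pi> 2" "\<pi> 3" "\<pi> 4"] inj\<pi> by (simp add: inj_eq) blast
  \<comment> \<open>By \<open>comb\<close>, the vectors with coordinates (a, b) on the four lines
    satisfy the linear relations of four collinear points with cross ratio \<gamma>. Their images
    have nonzero x-parts or nonzero y-parts, and \<gamma> is read off with \<alpha>' or with
    \<beta>' accordingly.\<close>
  have core: "\<gamma> = \<sigma> \<alpha>' \<or> \<gamma> = \<sigma> \<beta>'"
    if \<gamma>: "\<gamma> \<noteq> 0" "\<gamma> \<noteq> 1" and ab: "a \<noteq> 0 \<or> b \<noteq> 0"
      and comb: "\<And>i j k. i \<noteq> j \<Longrightarrow> bracket \<gamma> i j *s pt \<alpha> \<beta> k a b =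
        bracket \<gamma> k j *s pt \<alpha> \<beta> i a b + bracket \<gamma> i k *s pt \<alpha> \<beta> j a b" for \<gamma> a b
  proof -
    define V where "V i = pt \<alpha>' \<beta>' (\<pi> i) (X i a b) (Y i a b)" for i
    have "bracket \<gamma> i j *s V k = bracket \<gamma> k j *s V i + bracket \<gamma> i k *s V j" if "i \<noteq> j" for i j k
      using arg_cong[OF comb[OF that, of k], of "(*v) T"]
      unfolding V_def XY[symmetric] by (simp add: vec.add vec.scale)
    then have rel: "bracket \<gamma> i j * V k $ n = bracket \<gamma> k j * V i $ n + bracket \<gamma> i k * V j $ n"
      if "i \<noteq> j" for i j k n using that by (metis vector_add_component vector_smult_component)
    have "(\<forall>i. X i a b = 0) \<or> \<gamma> = cross_ratio \<alpha>' (\<pi> 1) (\<pi> 2) (\<pi> 3) (\<pi> 4)"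
      using rel[of _ _ _ 1] rel[of _ _ _ 2] B.nondeg
      by (intro cross_ratio_of_relation \<gamma> inj\<pi>) (simp_all add: V_def)
    moreover have "(\<forall>i. Y i a b = 0) \<or> \<gamma> = cross_ratio \<beta>' (\<pi> 1) (\<pi> 2) (\<pi> 3) (\<pi> 4)"
      using rel[of _ _ _ 3] rel[of _ _ _ 4] B.nondeg
      by (intro cross_ratio_of_relation \<gamma> inj\<pi>) (simp_all add: V_def)
    moreover have "\<not> ((\<forall>i. X i a b = 0) \<and> (\<forall>i. Y i a b = 0))" using nzXY[OF ab] by blast
    ultimately show ?thesis unfolding \<sigma>(2) by blast
  qed
  have "\<alpha> = \<sigma> \<alpha>' \<or> \<alpha> = \<sigma> \<beta>'"
    by (rule core[of \<alpha> 1 0])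
      (use A.nondeg in \<open>simp_all add: vec_eq_iff forall_4, simp_all add: bracket_def algebra_simps\<close>)
  moreover have "\<beta> = \<sigma> \<alpha>' \<or> \<beta> = \<sigma> \<beta>'"
    by (rule core[of \<beta> 0 1])
      (use A.nondeg in \<open>simp_all add: vec_eq_iff forall_4, simp_all add: bracket_def algebra_simps\<close>)
  \<comment> \<open>Since \<alpha> and \<beta> differ, they cannot both be the image of the same new
    eigenvalue.\<close>
  ultimately have "\<alpha> = \<sigma> \<alpha>' \<and> \<beta> = \<sigma> \<beta>' \<or> \<alpha> = \<sigma> \<beta>' \<and> \<beta> = \<sigma> \<alpha>'" using ne by auto
  then show ?thesis
    using ratio_triple_anharmonic[OF \<sigma>(1), of \<alpha>' \<beta>'] ratio_triple_anharmonic[OF \<sigma>(1), of \<beta>' \<alpha>']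
      ratio_triple_swap[of \<alpha>' \<beta>'] ratio_triple_swap[of \<beta>' \<alpha>'] B.nondeg
    by metis
qed

section \<open>Single orbit half grids\<close>

context std_lines
begin

lemma unity_brackets:
  assumes "m \<ge> 3" "(\<beta> / \<alpha>) ^ m = 1" "((\<beta> - 1) / (\<alpha> - 1)) ^ m = 1"
  shows "unity_brackets m \<alpha> \<beta>"
proof
  fix i j :: 4 assume ij: "i \<noteq> j"
  have "(bracket \<beta> i j / bracket \<alpha> i j) ^ m = 1"
    using ratio_power[OF assms(2,3) ij] by (simp add: ratio_def)
  then show "bracket \<beta> i j ^ m = bracket \<alpha> i j ^ m"
    using bracket_nonzero[OF nondeg(1,2) ij] by (simp add: power_divide)
qed (use assms nondeg in auto)

lemma std_config_half_grid:
  assumes m: "m \<ge> 5" "(\<beta> / \<alpha>) ^ m = 1" "((\<beta> - 1) / (\<alpha> - 1)) ^ m = 1" and ne: "\<alpha> \<noteq> \<beta>"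
  shows "half_grid_wrt m 4 (range (std_line \<alpha> \<beta>)) (std_config m \<alpha> \<beta>)"
proof -
  interpret U: unity_brackets m \<alpha> \<beta> using unity_brackets[OF _ m(2,3)] m(1) by simp
  let ?Z = "std_config m \<alpha> \<beta>"
  \<comment> \<open>The linear forms have to be indexed by the lines themselves rather than by their
    numbers.\<close>
  define l where "l p L = U.ell (inv (std_line \<alpha> \<beta>) L) p" for p L
  have l: "l p (std_line \<alpha> \<beta> i) = U.ell i p" for p i by (simp add: l_def inj_std_line)
  have prod: "(\<lambda>v. \<Prod>L\<in>range (std_line \<alpha> \<beta>). l p L v) = (\<lambda>v. \<Prod>i\<in>UNIV. U.ell i p v)" for p
    by (rule ext) (simp add: prod.reindex[OF inj_std_line] l)
  \<comment> \<open>\<open>geproci\<close> and \<open>geproci_wrt\<close> both ask for facts about a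
    generic projection; this treats the generic point once for both.\<close>
  have key: "general_point Q"
    if H: "proj_plane H" and Q: "\<And>p F. \<lbrakk>card (project (vec.span {p}) H ` ?Z) = m * 4;
      plane_curve H m F; plane_curve H 4 (\<lambda>v. \<Prod>L\<in>range (std_line \<alpha> \<beta>). l p L v);
      \<forall>L\<in>range (std_line \<alpha> \<beta>). plane_curve H 1 (l p L) \<and> {v \<in> H. l p L v = 0} = project (vec.span {p}) H L;
      transverse_intersection H F (\<lambda>v. \<Prod>L\<in>range (std_line \<alpha> \<beta>). l p L v) (project (vec.span {p}) H ` ?Z)\<rbrakk>
        \<Longrightarrow> Q (vec.span {p})" for H Q
  proof -
    obtain h where h: "nzform 1 h" "\<forall>u v. h (u + v) = h u + h v"
      "\<forall>c v. h (c *s v) = c * h v" "H = {v. h v = 0}"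
      using functional_of_plane[OF H] by blast
    obtain d G where G: "nzform d G" "G 0 = 0" "\<And>p. G p \<noteq> 0 \<Longrightarrow> U.generic p"
      using U.generic_open by blast
    show ?thesis
    proof (rule general_point_nzform[OF nzform_mult[OF h(1) G(1)]])
      fix p assume "h p * G p \<noteq> 0"
      then have p: "U.generic p" "h p \<noteq> 0" using G(3) by auto
      note pc = U.projected_config[of p h H, OF p h(2,3)[rule_format] h(4)]
      obtain F where F: "plane_curve H m F" "transverse_intersection H F
          (\<lambda>v. \<Prod>i\<in>UNIV. U.ell i p v) (project (vec.span {p}) H ` ?Z)"
        using pc(5) by blast
      show "Q (vec.span {p})"
      proof (rule Q[of p F])
        show "\<forall>L\<in>range (std_line \<alpha> \<beta>). plane_curve H 1 (l p L) \<and>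
            {v \<in> H. l p L v = 0} = project (vec.span {p}) H L"
        proof
          fix L assume "L \<in> range (std_line \<alpha> \<beta>)"
          then obtain i where "L = std_line \<alpha> \<beta> i" by blast
          then show "plane_curve H 1 (l p L) \<and> {v \<in> H. l p L v = 0} = project (vec.span {p}) H L"
            using pc(2,3)[of i] by (simp only: l simp_thms)
        qed
        show "transverse_intersection H F (\<lambda>v. \<Prod>L\<in>range (std_line \<alpha> \<beta>). l p L v)
            (project (vec.span {p}) H ` ?Z)"
          unfolding prod by (rule F(2))
        show "plane_curve H 4 (\<lambda>v. \<Prod>L\<in>range (std_line \<alpha> \<beta>). l p L v)"
          unfolding prod by (rule pc(4))
      qed (fact pc(1) F(1))+
    qed (simp add: G(2))
  qed
  have m0: "m > 0" using m(1) by simp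
  have "geproci m 4 ?Z"
    unfolding geproci_def
  proof (intro conjI allI impI ballI)
    show "finite ?Z" "card ?Z = m * 4" using card_std_config[OF m0 nondeg] by simp_all
    show "proj_point q" if "q \<in> ?Z" for q using that by (rule std_config_on_lines)
    fix H assume H: "proj_plane H"
    show "general_point (\<lambda>P. card (project P H ` ?Z) = m * 4 \<and>
        (\<exists>F G. plane_curve H m F \<and> plane_curve H 4 G \<and> transverse_intersection H F G (project P H ` ?Z)))"
      by (rule key[OF H]) blast
  qed
  then have "geproci_wrt m 4 (range (std_line \<alpha> \<beta>)) ?Z"
    unfolding geproci_wrt_def
  proof (intro conjI allI impI ballI)
    show "skew_lines (range (std_line \<alpha> \<beta>))" by (rule skew_std_lines)
    show "card (range (std_line \<alpha> \<beta>)) = 4" by (rule card_std_lines)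
    show "\<exists>L\<in>range (std_line \<alpha> \<beta>). q \<subseteq> L" if "q \<in> ?Z" for q using that by (rule std_config_on_lines)
    show "card {q \<in> ?Z. q \<subseteq> L} = m" if "L \<in> range (std_line \<alpha> \<beta>)" for L
      using that card_std_config_line[OF m0] by blast
    fix H assume H: "proj_plane H"
    show "general_point (\<lambda>P. \<exists>F l. plane_curve H m F \<and>
        (\<forall>L\<in>range (std_line \<alpha> \<beta>). plane_curve H 1 (l L) \<and> {v \<in> H. l L v = 0} = project P H L) \<and>
        transverse_intersection H F (\<lambda>v. \<Prod>L\<in>range (std_line \<alpha> \<beta>). l L v) (project P H ` ?Z))"
    proof (rule key[OF H], rule exI, rule exI, intro conjI)
    qed assumption+
  qed
  then show ?thesis
    unfolding half_grid_wrt_def using std_config_not_grid[OF ne m(1)] by blast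
qed

lemma std_config_single_orbit:
  assumes m: "prime m" "m \<ge> 5" "(\<beta> / \<alpha>) ^ m = 1" "((\<beta> - 1) / (\<alpha> - 1)) ^ m = 1" and ne: "\<alpha> \<noteq> \<beta>"
  shows "single_orbit_half_grid m (std_config m \<alpha> \<beta>)"
  unfolding single_orbit_half_grid_def
proof (intro exI conjI bexI)
  show "half_grid_wrt m 4 (range (std_line \<alpha> \<beta>)) (std_config m \<alpha> \<beta>)"
    by (rule std_config_half_grid[OF m(2-4) ne])
  show "std_config m \<alpha> \<beta> = groupoid_orbit (range (std_line \<alpha> \<beta>)) (vec.span {pt \<alpha> \<beta> 1 1 1})"
    by (rule orbit_eq_std_config[OF m(1,3,4) ne, symmetric])
  show "proj_point (vec.span {pt \<alpha> \<beta> 1 1 1})" by (rule proj_point_span) simp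
  show "vec.span {pt \<alpha> \<beta> 1 1 1} \<subseteq> std_line \<alpha> \<beta> 1" by (simp add: span_pt_subset_iff)
qed simp

end

lemma single_orbit_half_grid_equiv_std:
  assumes m: "prime m" "m \<ge> 5" and Z: "single_orbit_half_grid m Z"
  shows "\<exists>\<alpha> \<beta>. std_lines \<alpha> \<beta> \<and> \<alpha> \<noteq> \<beta> \<and> (\<beta> / \<alpha>) ^ m = 1 \<and> ((\<beta> - 1) / (\<alpha> - 1)) ^ m = 1 \<and>
    projectively_equivalent (std_config m \<alpha> \<beta>) Z"
proof -
  obtain \<L> L p where hg: "half_grid_wrt m 4 \<L> Z" and L: "L \<in> \<L>" and p: "proj_point p" "p \<subseteq> L"
    and orb: "Z = groupoid_orbit \<L> p"
    using Z unfolding single_orbit_half_grid_def by blast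
  have gw: "geproci m 4 Z" "skew_lines \<L>" "card \<L> = 4" "\<forall>L\<in>\<L>. card {p \<in> Z. p \<subseteq> L} = m"
    using hg unfolding half_grid_wrt_def geproci_wrt_def by simp_all
  have fin: "finite Z" using gw(1) by (simp add: geproci_def)
  have "card (\<L> - {L}) = 3" using gw(3) L by (simp add: card_Diff_singleton)
  then obtain A B C where ABC: "\<L> - {L} = {A, B, C}" "A \<noteq> B" "A \<noteq> C" "B \<noteq> C"
    unfolding card_3_iff by auto
  have L_eq: "\<L> = {L, A, B, C}" unfolding ABC(1)[symmetric] using L by (simp add: insert_absorb)
  have "L \<notin> {A, B, C}" unfolding ABC(1)[symmetric] by simp
  then have ne: "L \<noteq> A" "L \<noteq> B" "L \<noteq> C" by simp_all
  \<comment> \<open>The line of the base point becomes N 1, where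
    \<open>orbit_classification\<close> starts.\<close>
  define N :: "4 \<Rightarrow> subsp" where "N i = (if i = 1 then L else if i = 2 then A else if i = 3 then B else C)" for i
  have N: "N 1 = L" "N 2 = A" "N 3 = B" "N 4 = C" by (simp_all add: N_def)
  have rN: "range N = \<L>" unfolding L_eq UNIV_4 by (simp add: N)
  have N_ne: "N i \<noteq> N j" if "i \<noteq> j" for i j
    using that ne ABC(2-4) exhaust_4[of i] exhaust_4[of j] by (elim disjE) (simp_all add: N)
  have N_line: "proj_line (N i)" for i using gw(2) rN unfolding skew_lines_def by blast
  have N_skew: "N i \<inter> N j = {0}" if "N i \<noteq> N j" for i j
    using that gw(2) rN unfolding skew_lines_def by blast
  interpret skew_quadruple N by unfold_locales (fact N_line, rule N_skew[OF N_ne])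
  obtain u where u: "u \<noteq> 0" "p = vec.span {u}" using p(1) by (rule proj_pointE)
  have uN: "u \<in> N 1" using p(2) unfolding u(2) N by (meson insertI1 subsetD vec.span_superset)
  have Zo: "groupoid_orbit (range N) (vec.span {u}) = Z" using orb rN u(2) by simp
  have "\<exists>\<alpha> \<beta> T. std_lines \<alpha> \<beta> \<and> \<alpha> \<noteq> \<beta> \<and> (\<beta> / \<alpha>) ^ m = 1 \<and> ((\<beta> - 1) / (\<alpha> - 1)) ^ m = 1 \<and>
    invertible T \<and> Z = (`) ((*v) T) ` groupoid_orbit (range (std_line \<alpha> \<beta>)) (vec.span {pt \<alpha> \<beta> 1 1 1})"
    using orbit_classification[OF uN u(1), of m] fin gw(4) L m(2) unfolding Zo N by simp
  then obtain \<alpha> \<beta> T where *: "std_lines \<alpha> \<beta>" "\<alpha> \<noteq> \<beta>" "(\<beta> / \<alpha>) ^ m = 1" "((\<beta> - 1) / (\<alpha> - 1)) ^ m = 1"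
    "invertible T" "Z = (`) ((*v) T) ` groupoid_orbit (range (std_line \<alpha> \<beta>)) (vec.span {pt \<alpha> \<beta> 1 1 1})"
    by blast
  then have "Z = (`) ((*v) T) ` std_config m \<alpha> \<beta>"
    using std_lines.orbit_eq_std_config[OF *(1) m(1) *(3,4,2)] by simp
  then have "projectively_equivalent (std_config m \<alpha> \<beta>) Z"
    unfolding projectively_equivalent_def using *(5) by blast
  then show ?thesis using * by blast
qed

section \<open>Partitions into three parts\<close>

text \<open>Encodes the partitions of n into parts x, y, z in nondecreasing order, with z implicit:
  the last condition says y <= n - x - y.\<close>

definition partition_pairs :: "nat \<Rightarrow> (nat \<times> nat) set" where
  "partition_pairs n = {(x, y). 0 < x \<and> x \<le> y \<and> x + 2 * y \<le> n}"

lemma finite_partition_pairs: "finite (partition_pairs n)"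
  by (rule finite_subset[of _ "{..n} \<times> {..n}"]) (auto simp: partition_pairs_def)

text \<open>Remove 2 from each of the three parts. This fails exactly when the smallest part is 1 or
  2, and those partitions are counted directly.\<close>

lemma card_partition_pairs_step: "card (partition_pairs (n + 6)) = card (partition_pairs n) + n + 3"
proof -
  let ?A = "(\<lambda>(x, y). (x + 2, y + 2)) ` partition_pairs n"
  let ?B = "Pair (1::nat) ` {1..(n + 5) div 2}"
  let ?C = "Pair (2::nat) ` {2..(n + 4) div 2}"
  have "partition_pairs (n + 6) = ?A \<union> (?B \<union> ?C)"
  proof (intro equalityI subsetI)
    fix q assume q: "q \<in> partition_pairs (n + 6)"
    obtain x y where xy: "q = (x, y)" by (cases q)
    have le: "0 < x" "x \<le> y" "x + 2 * y \<le> n + 6" using q by (simp_all add: xy partition_pairs_def)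
    consider "x = 1" | "x = 2" | "x > 2" using le by linarith
    then show "q \<in> ?A \<union> (?B \<union> ?C)"
    proof cases
      case 3
      then have "(x - 2, y - 2) \<in> partition_pairs n" using le by (auto simp: partition_pairs_def)
      moreover have "x - 2 + 2 = x" "y - 2 + 2 = y" using 3 le by simp_all
      then have "q = (\<lambda>(x, y). (x + 2, y + 2)) (x - 2, y - 2)" by (simp only: xy prod.case)
      ultimately show ?thesis by blast
    qed (use le xy in auto)
  next
    fix q assume "q \<in> ?A \<union> (?B \<union> ?C)"
    then show "q \<in> partition_pairs (n + 6)"
      by (elim UnE) (auto simp: partition_pairs_def)
  qed
  moreover have "card (?A \<union> (?B \<union> ?C)) = card ?A + card (?B \<union> ?C)"
    using finite_partition_pairs[of n] by (intro card_Un_disjoint) (auto simp: partition_pairs_def)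
  moreover have "card (?B \<union> ?C) = card ?B + card ?C" by (intro card_Un_disjoint) auto
  moreover have "card ?A = card (partition_pairs n)" by (intro card_image) (auto intro: inj_onI)
  moreover have "card ?B = (n + 5) div 2" "card ?C = (n + 4) div 2 - 1"
    by (simp_all add: card_image inj_on_def)
  ultimately have "card (partition_pairs (n + 6)) = card (partition_pairs n) + ((n + 5) div 2 + ((n + 4) div 2 - 1))"
    by (simp only:)
  also have "(n + 5) div 2 + ((n + 4) div 2 - 1) = n + 3" by presburger
  finally show ?thesis by (simp only: add.assoc)
qed

text \<open>Twelve times the increment n + 3 is the difference of (n + 6)^2 and n^2; the induction
  starts from 1 and 5.\<close>

lemma card_partition_pairs:
  assumes "n mod 6 = 1 \<or> n mod 6 = 5" shows "12 * card (partition_pairs n) + 1 = n\<^sup>2"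
  using assms
proof (induction n rule: less_induct)
  case (less n)
  show ?case
  proof (cases "n < 6")
    case True
    then have "n = 1 \<or> n = 5" using less.prems by auto
    moreover have "partition_pairs 1 = {}" by (auto simp: partition_pairs_def)
    moreover have "partition_pairs 5 = {(1, 1), (1, 2)}" by (auto simp: partition_pairs_def)
    ultimately show ?thesis by auto
  next
    case False
    define k where "k = n - 6"
    have n: "n = k + 6" using False by (simp add: k_def)
    have "k < n" "k mod 6 = 1 \<or> k mod 6 = 5" using less.prems unfolding n by simp_all
    then have "12 * card (partition_pairs k) + 1 = k\<^sup>2" by (rule less.IH)
    then show ?thesis unfolding n card_partition_pairs_step by (simp add: power2_eq_square algebra_simps)
  qed
qed

lemma prime_mod_6:
  assumes "prime (m :: nat)" "m \<ge> 5" shows "m mod 6 = 1 \<or> m mod 6 = 5"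
proof -
  have "\<not> 2 dvd m" "\<not> 3 dvd m"
    using assms primes_dvd_imp_eq[of 2 m] primes_dvd_imp_eq[of 3 m] by auto
  then show ?thesis by presburger
qed

section \<open>Counting the classes\<close>

text \<open>The eigenvalue \<open>\<alpha>\<close> determined by \<open>s = \<beta> / \<alpha>\<close> and \<open>t = (\<beta> - 1) / (\<alpha> - 1)\<close>.\<close>

definition eigen :: "complex \<Rightarrow> complex \<Rightarrow> complex" where
  "eigen s t = (1 - t) / (s - t)"

definition ratio_config :: "nat \<Rightarrow> complex \<Rightarrow> complex \<Rightarrow> subsp set" where
  "ratio_config m s t = std_config m (eigen s t) (s * eigen s t)"

lemma eigen_props:
  assumes "s \<noteq> 0" "t \<noteq> 0" "s \<noteq> 1" "t \<noteq> 1" "s \<noteq> t"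
  shows "std_lines (eigen s t) (s * eigen s t)" "eigen s t \<noteq> s * eigen s t"
    "s * eigen s t / eigen s t = s" "(s * eigen s t - 1) / (eigen s t - 1) = t"
proof -
  have d: "s - t \<noteq> 0" "1 - t \<noteq> 0" "1 - s \<noteq> 0" using assms by auto
  have 1: "eigen s t - 1 = (1 - s) / (s - t)" "s * eigen s t - 1 = t * (1 - s) / (s - t)"
    unfolding eigen_def using d(1) by (simp_all add: field_simps)
  have 0: "eigen s t \<noteq> 0" unfolding eigen_def using d by simp
  have "eigen s t - 1 \<noteq> 0" "s * eigen s t - 1 \<noteq> 0" unfolding 1 using d assms by simp_all
  then show "std_lines (eigen s t) (s * eigen s t)"
    using 0 assms(1) by unfold_locales auto
  show "eigen s t \<noteq> s * eigen s t" "s * eigen s t / eigen s t = s" using 0 assms(3) by simp_all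
  show "(s * eigen s t - 1) / (eigen s t - 1) = t" unfolding 1 using d by simp
qed

lemma eigen_unique:
  assumes "std_lines \<alpha> \<beta>" "\<alpha> \<noteq> \<beta>"
  defines "s \<equiv> \<beta> / \<alpha>" and "t \<equiv> (\<beta> - 1) / (\<alpha> - 1)"
  shows "eigen s t = \<alpha>" "s * eigen s t = \<beta>" "s \<noteq> 0" "t \<noteq> 0" "s \<noteq> 1" "t \<noteq> 1" "s \<noteq> t"
proof -
  interpret std_lines \<alpha> \<beta> by (rule assms(1))
  have d: "\<alpha> - 1 \<noteq> 0" "\<beta> - 1 \<noteq> 0" using nondeg by auto
  show "s \<noteq> 0" "t \<noteq> 0" "s \<noteq> 1" "t \<noteq> 1" using nondeg d assms(2) by (auto simp: s_def t_def)
  have st: "s - t = (\<alpha> - \<beta>) / (\<alpha> * (\<alpha> - 1))"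
    unfolding s_def t_def using nondeg d(1) by (simp add: field_simps)
  then show "s \<noteq> t" using nondeg d assms(2) by auto
  have "1 - t = (\<alpha> - \<beta>) / (\<alpha> - 1)" unfolding t_def using d(1) by (simp add: field_simps)
  then show e: "eigen s t = \<alpha>" unfolding eigen_def st using nondeg d assms(2) by simp
  show "s * eigen s t = \<beta>" unfolding e using nondeg by (simp add: s_def)
qed

lemma ratio_config_of_std:
  assumes "std_lines \<alpha> \<beta>" "\<alpha> \<noteq> \<beta>"
  shows "std_config m \<alpha> \<beta> = ratio_config m (\<beta> / \<alpha>) ((\<beta> - 1) / (\<alpha> - 1))"
  unfolding ratio_config_def
  by (rule arg_cong2[where f = "std_config m"]) (rule eigen_unique[OF assms, symmetric])+

context
  fixes m :: nat and s t :: complex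
  assumes st: "s \<noteq> 0" "t \<noteq> 0" "s \<noteq> 1" "t \<noteq> 1" "s \<noteq> t"
begin

lemma equiv_ratio_inverse:
  assumes "m > 0"
  shows "projectively_equivalent (ratio_config m s t) (ratio_config m (1 / s) (1 / t))"
proof -
  interpret std_lines "eigen s t" "s * eigen s t" by (rule eigen_props[OF st])
  have sw: "std_lines (s * eigen s t) (eigen s t)" using nondeg by unfold_locales
  have "std_config m (s * eigen s t) (eigen s t) =
      ratio_config m (eigen s t / (s * eigen s t)) ((eigen s t - 1) / (s * eigen s t - 1))"
    by (rule ratio_config_of_std[OF sw eigen_props(2)[OF st, symmetric]])
  also have "eigen s t / (s * eigen s t) = 1 / s" using nondeg by simp
  also have "(eigen s t - 1) / (s * eigen s t - 1) = 1 / t"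
    using arg_cong[OF eigen_props(4)[OF st], of "\<lambda>z. 1 / z"] by simp
  finally have "ratio_config m (1 / s) (1 / t) = std_config m (s * eigen s t) (eigen s t)" ..
  then show ?thesis using equiv_swap[OF assms, of "eigen s t" "s * eigen s t"]
    unfolding ratio_config_def[of m s t] by (simp only:)
qed

text \<open>On the triple (s, 1 / t, t / s) this inverts all entries and exchanges the first two;
  \<open>equiv_ratio_third\<close> inverts them and exchanges the last two. After the inversion of
  \<open>equiv_ratio_inverse\<close> pure transpositions are left.\<close>

lemma equiv_ratio_exchange:
  "projectively_equivalent (ratio_config m s t) (ratio_config m t s)"
proof -
  interpret std_lines "eigen s t" "s * eigen s t" by (rule eigen_props[OF st])
  have d: "s - t \<noteq> 0" "t - s \<noteq> 0" using st by auto
  have "1 - eigen s t = eigen t s" "1 - s * eigen s t = t * eigen t s"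
    unfolding eigen_def using d by (simp_all add: divide_simps) (simp_all add: algebra_simps)
  then show ?thesis using equiv_one_minus[of m "eigen s t" "s * eigen s t"]
    unfolding ratio_config_def by simp
qed

lemma equiv_ratio_third:
  assumes "s ^ m = 1"
  shows "projectively_equivalent (ratio_config m s t) (ratio_config m (1 / s) (t / s))"
proof -
  interpret std_lines "eigen s t" "s * eigen s t" by (rule eigen_props[OF st])
  have "1 - t / s = (s - t) / s" "1 / s - t / s = (1 - t) / s"
    using st by (simp_all add: diff_divide_distrib)
  then have "eigen (1 / s) (t / s) = 1 / eigen s t"
    unfolding eigen_def using st by simp
  then show ?thesis using equiv_inverse[OF nondeg(1,3), of m] assms eigen_props(3)[OF st]
    unfolding ratio_config_def by simp
qed

end

section \<open>Configurations indexed by exponents of a fixed root of unity\<close>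

locale prime_root =
  fixes m :: nat and \<zeta> :: complex
  assumes prime_m: "prime m" and m_ge: "m \<ge> 5" and \<zeta>: "\<zeta> ^ m = 1" "\<zeta> \<noteq> 1"
begin

text \<open>Configurations are indexed by triples \<open>x + y + z = m\<close> of positive integers, \<open>z\<close> being implicit:
  \<open>\<beta> / \<alpha>\<close>, \<open>(\<alpha> - 1) / (\<beta> - 1)\<close> and the inverse of their product are the powers of \<open>\<zeta>\<close> with
  exponents \<open>x\<close>, \<open>y\<close>, \<open>z\<close>.\<close>

definition config :: "nat \<Rightarrow> nat \<Rightarrow> subsp set" where
  "config x y = ratio_config m (\<zeta> ^ x) (1 / \<zeta> ^ y)"

lemma \<zeta>0: "\<zeta> ^ n \<noteq> 0"
  using \<zeta> m_ge by (auto simp: power_0_left)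

lemma power_eq_iff:
  assumes "i < m" "j < m" shows "\<zeta> ^ i = \<zeta> ^ j \<longleftrightarrow> i = j"
  using inj_on_eq_iff[OF power_inj_prime[OF prime_m \<zeta>]] assms by simp

lemma root: "(\<zeta> ^ n) ^ m = 1"
  using \<zeta>(1) by (metis mult.commute power_mult power_one)

lemma power_complement: "i \<le> m \<Longrightarrow> \<zeta> ^ (m - i) = 1 / \<zeta> ^ i"
  using \<zeta>(1) \<zeta>0[of i] by (simp add: field_simps flip: power_add)

lemma exponents:
  assumes "0 < x" "0 < y" "x + y < m"
  shows "\<zeta> ^ x \<noteq> 0" "1 / \<zeta> ^ y \<noteq> 0" "\<zeta> ^ x \<noteq> 1" "1 / \<zeta> ^ y \<noteq> 1" "\<zeta> ^ x \<noteq> 1 / \<zeta> ^ y"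
proof -
  have 1: "\<zeta> ^ n \<noteq> 1" if "0 < n" "n < m" for n
    using power_eq_iff[of n 0] that by simp
  show "\<zeta> ^ x \<noteq> 0" "1 / \<zeta> ^ y \<noteq> 0" using \<zeta>0 by simp_all
  show "\<zeta> ^ x \<noteq> 1" "1 / \<zeta> ^ y \<noteq> 1" using 1[of x] 1[of y] assms \<zeta>0[of y] by simp_all
  show "\<zeta> ^ x \<noteq> 1 / \<zeta> ^ y" using 1[of "x + y"] assms \<zeta>0[of y] by (simp add: power_add field_simps)
qed

text \<open>Exchanging s and t and then inverting both interchanges s and 1 / t. Together with
  \<open>config_rotate\<close>, which interchanges the exponents y and z, this generates all
  permutations of the three exponents.\<close>

lemma config_swap:
  assumes "0 < x" "0 < y" "x + y < m"
  shows "projectively_equivalent (config x y) (config y x)"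
proof -
  note e = exponents[OF assms]
  have "projectively_equivalent (ratio_config m (1 / \<zeta> ^ y) (\<zeta> ^ x)) (config y x)"
    using equiv_ratio_inverse[of "1 / \<zeta> ^ y" "\<zeta> ^ x" m] e m_ge by (simp add: config_def)
  then show ?thesis
    using projectively_equivalent_trans[OF equiv_ratio_exchange[OF e]] by (simp add: config_def)
qed

text \<open>Replacing (s, t) by (1 / s, t / s) and inverting keeps s and turns 1 / t into t / s, the
  power with exponent z.\<close>

lemma config_rotate:
  assumes "0 < x" "0 < y" "x + y + z = m" "0 < z"
  shows "projectively_equivalent (config x y) (config x z)"
proof -
  have xy: "x + y < m" using assms by simp
  note e = exponents[OF assms(1,2) xy]
  have z: "1 / \<zeta> ^ z = \<zeta> ^ (x + y)" using power_complement[of z] assms by (metis add_diff_cancel_right' le_add2)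
  have 1: "projectively_equivalent (config x y) (ratio_config m (1 / \<zeta> ^ x) (1 / \<zeta> ^ y / \<zeta> ^ x))"
    unfolding config_def by (rule equiv_ratio_third[OF e root])
  have xy1: "\<zeta> ^ x * \<zeta> ^ y \<noteq> 1" using e by (auto simp: field_simps)
  have "projectively_equivalent (ratio_config m (1 / \<zeta> ^ x) (1 / \<zeta> ^ y / \<zeta> ^ x))
      (ratio_config m (1 / (1 / \<zeta> ^ x)) (1 / (1 / \<zeta> ^ y / \<zeta> ^ x)))"
    by (rule equiv_ratio_inverse) (use e xy1 m_ge in \<open>auto simp: field_simps\<close>)
  also have "ratio_config m (1 / (1 / \<zeta> ^ x)) (1 / (1 / \<zeta> ^ y / \<zeta> ^ x)) = config x z"
    unfolding config_def z by (simp add: power_add mult.commute)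
  finally show ?thesis by (rule projectively_equivalent_trans[OF 1])
qed

lemma config_sorted:
  assumes "0 < x" "0 < y" "0 < z" "x + y + z = m"
  shows "\<exists>(x', y')\<in>partition_pairs m. projectively_equivalent (config x y) (config x' y')"
proof -
  let ?E = projectively_equivalent
  note tr = projectively_equivalent_trans
  have sw: "?E (config a b) (config b a)" if "0 < a" "0 < b" "0 < c" "a + b + c = m" for a b c
    using that by (intro config_swap) simp_all
  have ro: "?E (config a b) (config a c)" if "0 < a" "0 < b" "0 < c" "a + b + c = m" for a b c
    using that by (intro config_rotate) simp_all
  consider "x \<le> y" "y \<le> z" | "x \<le> z" "z \<le> y" | "y \<le> x" "x \<le> z" | "y \<le> z" "z \<le> x"
    | "z \<le> x" "x \<le> y" | "z \<le> y" "y \<le> x" by linarith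
  then show ?thesis
  proof cases
    case 1
    then have "(x, y) \<in> partition_pairs m" using assms by (simp add: partition_pairs_def)
    then show ?thesis using projectively_equivalent_refl by blast
  next
    case 2
    then have "(x, z) \<in> partition_pairs m" using assms by (simp add: partition_pairs_def)
    then show ?thesis using ro[of x y z] assms by blast
  next
    case 3
    then have "(y, x) \<in> partition_pairs m" using assms by (simp add: partition_pairs_def)
    then show ?thesis using sw[of x y z] assms by blast
  next
    case 4
    then have "(y, z) \<in> partition_pairs m" using assms by (simp add: partition_pairs_def)
    moreover have "?E (config x y) (config y z)"
      using tr[OF sw[of x y z] ro[of y x z]] assms by simp
    ultimately show ?thesis by blast
  next
    case 5
    then have "(z, x) \<in> partition_pairs m" using assms by (simp add: partition_pairs_def)
    moreover have "?E (config x y) (config z x)"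
      using tr[OF ro[of x y z] sw[of x z y]] assms by simp
    ultimately show ?thesis by blast
  next
    case 6
    then have "(z, y) \<in> partition_pairs m" using assms by (simp add: partition_pairs_def)
    moreover have "?E (config x y) (config z y)"
      using tr[OF tr[OF ro[of x y z] sw[of x z y]] ro[of z x y]] assms by simp
    ultimately show ?thesis by blast
  qed
qed

lemma std_config_equiv_config:
  assumes "std_lines \<alpha> \<beta>" "\<alpha> \<noteq> \<beta>" "(\<beta> / \<alpha>) ^ m = 1" "((\<beta> - 1) / (\<alpha> - 1)) ^ m = 1"
  shows "\<exists>(x, y)\<in>partition_pairs m. projectively_equivalent (std_config m \<alpha> \<beta>) (config x y)"
proof -
  define s where "s = \<beta> / \<alpha>"
  define t where "t = (\<beta> - 1) / (\<alpha> - 1)"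
  have st: "s \<noteq> 0" "t \<noteq> 0" "s \<noteq> 1" "t \<noteq> 1" "s \<noteq> t"
    unfolding s_def t_def by (rule eigen_unique[OF assms(1,2)])+
  have r: "s ^ m = 1" "(1 / t) ^ m = 1"
    using assms(3,4) by (simp_all only: s_def t_def power_one_over div_by_1)
  obtain x where x: "x < m" "s = \<zeta> ^ x" using roots_of_unity_prime[OF prime_m \<zeta> r(1)] by blast
  obtain y where y: "y < m" "1 / t = \<zeta> ^ y" using roots_of_unity_prime[OF prime_m \<zeta> r(2)] by blast
  have t: "t = 1 / \<zeta> ^ y" unfolding y(2)[symmetric] by simp
  have x0: "x > 0" and y0: "y > 0" using st x(2) t by (auto intro: gr0I)
  have ne: "x + y \<noteq> m"
  proof
    assume "x + y = m"
    then have "m - y = x" by simp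
    then have "\<zeta> ^ x = 1 / \<zeta> ^ y" using power_complement[of y] y by simp
    then show False using st(5) x(2) t by simp
  qed
  have C: "std_config m \<alpha> \<beta> = ratio_config m s t"
    unfolding s_def t_def by (rule ratio_config_of_std[OF assms(1,2)])
  show ?thesis
  proof (cases "x + y < m")
    case True
    have "std_config m \<alpha> \<beta> = config x y" unfolding C config_def x(2) t ..
    then show ?thesis using config_sorted[of x y "m - x - y"] True x0 y0 by simp
  next
    \<comment> \<open>Now x + y > m. Inversion replaces the exponents by m - x and m - y, and the
      third one, x + y - m, is positive.\<close>
    case False
    have "projectively_equivalent (std_config m \<alpha> \<beta>) (ratio_config m (1 / s) (1 / t))"
      unfolding C by (rule equiv_ratio_inverse[OF st]) (use m_ge in simp)
    moreover have "ratio_config m (1 / s) (1 / t) = config (m - x) (m - y)"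
      unfolding config_def using power_complement[of x] power_complement[of y] x y by simp
    moreover have "\<exists>(x', y')\<in>partition_pairs m. projectively_equivalent (config (m - x) (m - y)) (config x' y')"
      using config_sorted[of "m - x" "m - y" "x + y - m"] False ne x y by simp
    ultimately show ?thesis using projectively_equivalent_trans by fastforce
  qed
qed

lemma config_single_orbit:
  assumes "0 < x" "0 < y" "x + y < m"
  shows "single_orbit_half_grid m (config x y)"
proof -
  note e = exponents[OF assms]
  have "(1 / \<zeta> ^ y) ^ m = 1" using root by (simp add: power_one_over)
  then show ?thesis
    unfolding config_def ratio_config_def using eigen_props[OF e] prime_m m_ge root[of x]
    by (intro std_lines.std_config_single_orbit) simp_all
qed

lemma config_ratio_triple:
  assumes "0 < x" "0 < y" "0 < z" "x + y + z = m"
  shows "ratio_triple (eigen (\<zeta> ^ x) (1 / \<zeta> ^ y)) (\<zeta> ^ x * eigen (\<zeta> ^ x) (1 / \<zeta> ^ y)) =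
    image_mset (\<lambda>n. \<zeta> ^ n) {#x, y, z#}"
proof -
  have "x + y < m" using assms by simp
  note e = exponents[OF assms(1,2) this]
  have "\<zeta> ^ z * (\<zeta> ^ x * \<zeta> ^ y) = 1"
    using \<zeta>(1) assms(4) by (metis add.commute power_add)
  then have "1 / \<zeta> ^ y / \<zeta> ^ x = \<zeta> ^ z" using \<zeta>0[of x] \<zeta>0[of y] by (simp add: field_simps)
  then show ?thesis unfolding ratio_triple_def Let_def eigen_props(3,4)[OF e] by simp
qed

lemma config_inj:
  assumes xy: "(x, y) \<in> partition_pairs m" and xy': "(x', y') \<in> partition_pairs m"
    and eq: "projectively_equivalent (config x y) (config x' y')"
  shows "x = x' \<and> y = y'"
proof -
  obtain z where z: "x + y + z = m" "y \<le> z" "0 < x" "x \<le> y"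
    using xy that[of "m - x - y"] by (auto simp: partition_pairs_def)
  obtain z' where z': "x' + y' + z' = m" "y' \<le> z'" "0 < x'" "x' \<le> y'"
    using xy' that[of "m - x' - y'"] by (auto simp: partition_pairs_def)
  have pos: "0 < y" "0 < z" "0 < y'" "0 < z'" "x + y < m" "x' + y' < m" using z z' by simp_all
  note e = exponents[OF z(3) pos(1,5)] and e' = exponents[OF z'(3) pos(3,6)]
  let ?f = "\<lambda>n. \<zeta> ^ n"
  \<comment> \<open>A discrete logarithm, recovering exponents below m from the powers.\<close>
  define g where "g = inv_into {..<m} ?f"
  have g: "g (?f n) = n" if "n < m" for n
    unfolding g_def using inv_into_f_f[OF power_inj_prime[OF prime_m \<zeta>], of n] that by simp
  have "image_mset ?f {#x, y, z#} = image_mset ?f {#x', y', z'#} \<or>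
      image_mset ?f {#x, y, z#} = image_mset inverse (image_mset ?f {#x', y', z'#})"
    unfolding config_ratio_triple[OF z(3) pos(1,2) z(1), symmetric]
      config_ratio_triple[OF z'(3) pos(3,4) z'(1), symmetric]
    by (rule equiv_imp_ratio_triple[OF eigen_props(1)[OF e] eigen_props(1)[OF e']
      eigen_props(2)[OF e] eigen_props(2)[OF e'] m_ge eq[unfolded config_def ratio_config_def]])
  moreover have "image_mset inverse (image_mset ?f {#x', y', z'#}) = image_mset ?f {#m - x', m - y', m - z'#}"
    using power_complement[of x'] power_complement[of y'] power_complement[of z'] z'
    by (simp add: inverse_eq_divide)
  ultimately have "image_mset g (image_mset ?f {#x, y, z#}) = image_mset g (image_mset ?f {#x', y', z'#}) \<or>
      image_mset g (image_mset ?f {#x, y, z#}) = image_mset g (image_mset ?f {#m - x', m - y', m - z'#})"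
    by metis
  then have "{#x, y, z#} = {#x', y', z'#} \<or> {#x, y, z#} = {#m - x', m - y', m - z'#}"
    using z z' pos by (simp add: g)
  \<comment> \<open>The left multiset has sum m, the right one 3 m - m = 2 m.\<close>
  moreover have "{#x, y, z#} \<noteq> {#m - x', m - y', m - z'#}"
  proof
    assume "{#x, y, z#} = {#m - x', m - y', m - z'#}"
    then have "sum_mset {#x, y, z#} = sum_mset {#m - x', m - y', m - z'#}" by (rule arg_cong)
    then show False using z z' m_ge by simp
  qed
  ultimately have "mset [x, y, z] = mset [x', y', z']" by simp
  \<comment> \<open>Both triples are nondecreasing, so sorting the common multiset identifies them
    entry by entry.\<close>
  then have "sort [x, y, z] = sort [x', y', z']" by (metis sorted_list_of_multiset_mset)
  moreover have "sort [x, y, z] = [x, y, z]" "sort [x', y', z'] = [x', y', z']"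
    using z z' by (simp_all add: sorted_sort_id)
  ultimately show ?thesis by simp
qed

end

theorem theorem3p5p9:
  fixes m :: nat
  assumes "prime m" and "m \<ge> 5"
  defines "S \<equiv> {Z. single_orbit_half_grid m Z}"
  defines "classes \<equiv> S // {(Z, W). Z \<in> S \<and> W \<in> S \<and> projectively_equivalent Z W}"
  shows "finite classes \<and> real (card classes) = ((real m)\<^sup>2 - 1) / 12"
proof -
  have "\<not> {z :: complex. z ^ m = 1} \<subseteq> {1}"
  proof
    assume "{z :: complex. z ^ m = 1} \<subseteq> {1}"
    then have "card {z :: complex. z ^ m = 1} \<le> card {1 :: complex}" by (intro card_mono) simp_all
    then show False using card_roots_unity_eq[of m] assms(2) by simp
  qed
  then obtain \<zeta> :: complex where \<zeta>: "\<zeta> ^ m = 1" "\<zeta> \<noteq> 1" by blast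
  interpret prime_root m \<zeta> using assms(1,2) \<zeta> by unfold_locales
  define R where "R = {(Z, W). Z \<in> S \<and> W \<in> S \<and> projectively_equivalent Z W}"
  have R: "equiv S R"
  proof (rule equivI)
    show "R \<subseteq> S \<times> S" by (auto simp: R_def)
    show "refl_on S R" by (auto simp: R_def refl_on_def projectively_equivalent_refl)
    show "sym R" unfolding R_def by (rule symI) (auto intro: projectively_equivalent_sym)
    show "trans R" unfolding R_def by (rule transI) (auto intro: projectively_equivalent_trans)
  qed
  have in_S: "config x y \<in> S" if "(x, y) \<in> partition_pairs m" for x y
    unfolding S_def using that config_single_orbit[of x y] by (auto simp: partition_pairs_def)
  let ?f = "\<lambda>(x, y). R `` {config x y}"
  have "inj_on ?f (partition_pairs m)"
  proof (rule inj_onI, clarify)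
    fix x y x' y' assume xy: "(x, y) \<in> partition_pairs m" "(x', y') \<in> partition_pairs m"
      and "R `` {config x y} = R `` {config x' y'}"
    then have "(config x y, config x' y') \<in> R" using eq_equiv_class[OF _ R] in_S by blast
    then show "x = x' \<and> y = y'" using config_inj[OF xy] by (simp add: R_def)
  qed
  moreover have "?f ` partition_pairs m = S // R"
  proof (intro equalityI subsetI)
    fix c assume "c \<in> ?f ` partition_pairs m"
    then obtain x y where "c = R `` {config x y}" "(x, y) \<in> partition_pairs m" by auto
    then show "c \<in> S // R" using in_S by (auto intro: quotientI)
  next
    fix c assume "c \<in> S // R"
    then obtain Z where Z: "Z \<in> S" "c = R `` {Z}" by (rule quotientE)
    obtain \<alpha> \<beta> where ab: "std_lines \<alpha> \<beta>" "\<alpha> \<noteq> \<beta>" "(\<beta> / \<alpha>) ^ m = 1" "((\<beta> - 1) / (\<alpha> - 1)) ^ m = 1"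
      "projectively_equivalent (std_config m \<alpha> \<beta>) Z"
      using single_orbit_half_grid_equiv_std[OF assms(1,2)] Z(1) unfolding S_def by blast
    obtain x y where xy: "(x, y) \<in> partition_pairs m"
      "projectively_equivalent (std_config m \<alpha> \<beta>) (config x y)"
      using std_config_equiv_config[OF ab(1-4)] by blast
    have "projectively_equivalent Z (config x y)"
      by (rule projectively_equivalent_trans[OF projectively_equivalent_sym[OF ab(5)] xy(2)])
    then have "(Z, config x y) \<in> R" using Z(1) in_S[OF xy(1)] by (simp add: R_def)
    then have "c = R `` {config x y}" unfolding Z(2) by (rule equiv_class_eq[OF R])
    then show "c \<in> ?f ` partition_pairs m" using xy(1) by auto
  qed
  ultimately have "bij_betw ?f (partition_pairs m) (S // R)" by (simp add: bij_betw_def)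
  then have card: "card (S // R) = card (partition_pairs m)" and fin: "finite (S // R)"
    using bij_betw_same_card bij_betw_finite finite_partition_pairs by metis+
  have "12 * card (partition_pairs m) + 1 = m\<^sup>2"
    by (rule card_partition_pairs[OF prime_mod_6[OF assms(1,2)]])
  then have "12 * real (card (partition_pairs m)) + 1 = (real m)\<^sup>2"
    by (metis of_nat_1 of_nat_add of_nat_mult of_nat_numeral of_nat_power)
  then have "real (card (S // R)) = ((real m)\<^sup>2 - 1) / 12" unfolding card by simp
  then show ?thesis using fin unfolding classes_def R_def by simp
qed

end
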